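(* Assume that the QBD with transition matrix $P$ is null recurrent, let $\boldsymbol g=(\boldsymbol g_r)_{r\ge0}$ with $\boldsymbol g_r\in\mathbb C^m$, and assume that the series $\sum_{k=0}^\infty R^k\boldsymbol g_k$ is convergent. Then the general solution $\boldsymbol u=(\boldsymbol u_r)_{r\ge0}$ of the Poisson equation $(I-P)\boldsymbol u=\boldsymbol g$ is given by $$\boldsymbol u_0=\widetilde{\boldsymbol u}_0,\qquad \boldsymbol u_k=\widetilde{\boldsymbol u}_k+Q\sum_{i=0}^{k-1}\widetilde{\boldsymbol u}_i,\quad k\ge1,$$ where $$\widetilde{\boldsymbol u}_r=\widetilde G^r\boldsymbol x+\widetilde L\widetilde V_1^{-r}\boldsymbol y+\widetilde{\boldsymbol\sigma}_r,\qquad r\ge0,$$ $$\widetilde{\boldsymbol\sigma}_r=-\sum_{k=1}^{r}\left(\widetilde G^{r-k}-\widetilde L\widetilde V_1^{k-r}\widetilde E\right)\widetilde W\boldsymbol g_k-\sum_{j=1}^{\nu-1}\widetilde K\widetilde V_0^j\widetilde F\widetilde W\boldsymbol g_{j+r},\qquad r\ge0,$$ and $\boldsymbol x\in\mathbb C^m$, $\boldsymbol y\in\mathbb C^p$ are any vectors satisfying $$(I-B-A_1G)\boldsymbol x=\boldsymbol g_0+\left((\widetilde B-I)\ddot G+A_1\right)\left(\widetilde{\boldsymbol\sigma}_1+\widetilde L\widetilde V_1^{-1}\boldsymbol y\right),\qquad \widetilde B=B+A_1Q.$$ For given $\boldsymbol y$, this last linear system has a solution $\boldsymbol x$ if and only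 if $$\boldsymbol\pi_0^T\widetilde W^{-1}\widetilde L(\boldsymbol y-\widetilde{\boldsymbol y}^* )=\boldsymbol\pi^T\boldsymbol g,\qquad\text{where } \widetilde{\boldsymbol y}^*=-\sum_{k=1}^\infty\widetilde V_1^k\widetilde E\widetilde W\boldsymbol g_k .$$
   Context: QBD process. Let $m\ge1$ be an integer and let $B,A_{-1},A_0,A_1$ be nonnegative $m\times m$ matrices such that the infinite block tridiagonal matrix $P=(P_{i,j})_{i,j\ge 0}$ with $m\times m$ blocks $P_{0,0}=B$, $P_{i,i}=A_0$ for $i\ge1$, $P_{i,i+1}=A_1$ for $i\ge 0$, $P_{i,i-1}=A_{-1}$ for $i\ge1$, and all other blocks zero, is row-stochastic. $P$ is the transition matrix of a discrete-time Markov chain (a QBD) on $\mathbb N\times\mathcal E$, $\mathcal E=\{1,\dots,m\}$; "null recurrent" refers to this chain. Infinite vectors are partitioned into blocks of length $m$. Standing assumptions: $P$ is irreducible; $A_{-1}+A_0+A_1$ is irreducible; and the doubly infinite QBD on $\mathbb Z\times\mathcal E$ (with transition blocks $A_{-1},A_0,A_1$ for level changes $-1,0,+1$) has only one final class $\mathbb Z\times\mathcal E_*$, with $\emptyset\ne\mathcal E_*\subseteq\mathcal E$, and every other state is on a path to the final class. $G$, $\widehat G$, $R$, $\widehat R$ are the minimal nonnegative solutions of $A_{-1}+(A_0-I)X+A_1X^2=0$, $A_1+(A_0-I)X+A_{-1}X^2=0$, $A_1+X(A_0-I)+X^2A_{-1}=0$ and $A_{-1}+X(A_0-I)+X^2A_1=0$,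 respectively. Put $U=A_0+RA_{-1}$ (equivalently $U=A_0+A_1G$) and $\widehat H=A_0-I+A_{-1}\widehat G$. In the null recurrent case all four matrices $G,\widehat G,R,\widehat R$ have spectral radius $1$, and $1$ is a simple eigenvalue of each. Right shift. Let $\boldsymbol w_G$ be a nonnegative right eigenvector of $G$, $\boldsymbol v_{\widehat G}$ a nonnegative left eigenvector of $\widehat G$, and $\boldsymbol w_{\widehat R}$ a right eigenvector of $\widehat R$, of constant sign, all for the eigenvalue $1$, normalized so that $\boldsymbol v_{\widehat G}^T\boldsymbol w_G=1$ and $\boldsymbol v_{\widehat G}^T\widehat H^{-1}\boldsymbol w_{\widehat R}=-1$ (the latter scalar product is always nonzero). Put $Q=\boldsymbol w_G\boldsymbol v_{\widehat G}^T$, $\widetilde G=G-Q$, $\ddot G=\widehat G+(\boldsymbol w_G+\widehat H^{-1}\boldsymbol w_{\widehat R})\boldsymbol v_{\widehat G}^T$, and $\widetilde W=\sum_{i=0}^\infty\widetilde G^i(U-I)^{-1}R^i$. It is known (He, Meini, Rhee; Bini, Latouche, Meini) that, with $\widetilde A_{-1}=A_{-1}(I-Q)$, $\widetilde A_0=A_0+A_1Q$, $\widetilde A_1=A_1$, the matrices $\widetilde G$ and $\ddot G$ solve $\widetilde A_{-1}+(\widetilde A_0-I)X+\widetilde A_1X^2=0$ and $\widetilde A_1+(\widetilde A_0-I)X+\widetilde A_{-1}X^2=0$ respectively, that $\rho(\widetilde G)<1$, $\rho(\ddot G)=1$ ($\rho$ the spectral radius), $\det(I-\widetilde G\ddot G)\ne0$,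 and that $\widetilde W$ converges and is nonsingular. $\widetilde M$ is a nonsingular matrix with $\ddot G\widetilde M=\widetilde M\,\mathrm{diag}(\widetilde V_1,\widetilde V_0)$, where $\widetilde V_1$ is a nonsingular $p\times p$ matrix and $\widetilde V_0$ is an $(m-p)\times(m-p)$ matrix with spectral radius $0$; $\widetilde M=[\,\widetilde L\mid\widetilde K\,]$ with $\widetilde L$ of size $m\times p$ and $\widetilde K$ of size $m\times(m-p)$; $\widetilde M^{-1}=\begin{bmatrix}\widetilde E\\\widetilde F\end{bmatrix}$ with $\widetilde E$ of size $p\times m$ and $\widetilde F$ of size $(m-p)\times m$. $\nu$ is the smallest positive integer with $\widetilde V_0^\nu=0$. (Terms involving empty blocks are absent when $p=0$ or $p=m$.) $\boldsymbol\pi_0$ is a nonzero nonnegative vector with $\boldsymbol\pi_0^T(I-B-A_1G)=\boldsymbol 0$, and $\boldsymbol\pi^T\boldsymbol g$ denotes $\boldsymbol\pi_0^T\sum_{k=0}^\infty R^k\boldsymbol g_k$, i.e. $\boldsymbol\pi=(\boldsymbol\pi_i)_{i\ge 0}$ with $\boldsymbol\pi_i^T=\boldsymbol\pi_0^TR^i$. *)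

theory Defs
  imports
    "Jordan_Normal_Form.Spectral_Radius"
    "Jordan_Normal_Form.Gauss_Jordan_Elimination"
    "HOL-Analysis.Infinite_Sum"
begin

section \<open>Markov chains on a state set given by transition probabilities\<close>

text \<open>
  A chain is a state set \<open>S\<close> with a kernel \<open>p\<close>; \<open>p x y\<close> is the probability of a step from
  \<open>x\<close> to \<open>y\<close>.
\<close>

definition row_stochastic :: "'s set \<Rightarrow> ('s \<Rightarrow> 's \<Rightarrow> real) \<Rightarrow> bool" where
  "row_stochastic S p \<longleftrightarrow>
     (\<forall>x\<in>S. \<forall>y\<in>S. 0 \<le> p x y) \<and> (\<forall>x\<in>S. ((\<lambda>y. p x y) has_sum 1) S)"

definition transition_graph :: "'s set \<Rightarrow> ('s \<Rightarrow> 's \<Rightarrow> real) \<Rightarrow> ('s \<times> 's) set" where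
  "transition_graph S p = {(x, y). x \<in> S \<and> y \<in> S \<and> 0 < p x y}"

definition irreducible_on :: "'s set \<Rightarrow> ('s \<Rightarrow> 's \<Rightarrow> real) \<Rightarrow> bool" where
  "irreducible_on S p \<longleftrightarrow> (\<forall>x\<in>S. \<forall>y\<in>S. (x, y) \<in> (transition_graph S p)\<^sup>*)"

text \<open>
  A final class is a closed communicating class: the states reachable from any of its members
  are exactly its members.
\<close>

definition final_class :: "'s set \<Rightarrow> ('s \<Rightarrow> 's \<Rightarrow> real) \<Rightarrow> 's set \<Rightarrow> bool" where
  "final_class S p C \<longleftrightarrow> C \<noteq> {} \<and> C \<subseteq> S \<and>
     (\<forall>x\<in>C. \<forall>y\<in>S. (x, y) \<in> (transition_graph S p)\<^sup>* \<longleftrightarrow> y \<in> C)"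

text \<open>
  \<open>first_passage S p n x y\<close> is the probability that the chain started in \<open>x\<close> visits \<open>y\<close> for the
  first time after time \<open>0\<close> exactly at time \<open>n\<close>.
\<close>

fun first_passage :: "'s set \<Rightarrow> ('s \<Rightarrow> 's \<Rightarrow> real) \<Rightarrow> nat \<Rightarrow> 's \<Rightarrow> 's \<Rightarrow> real" where
  "first_passage S p 0 x y = 0"
| "first_passage S p (Suc 0) x y = p x y"
| "first_passage S p (Suc (Suc n)) x y =
     (\<Sum>\<^sub>\<infinity>z\<in>S - {y}. p x z * first_passage S p (Suc n) z y)"

definition recurrent_state :: "'s set \<Rightarrow> ('s \<Rightarrow> 's \<Rightarrow> real) \<Rightarrow> 's \<Rightarrow> bool" where
  "recurrent_state S p x \<longleftrightarrow> (\<lambda>n. first_passage S p n x x) sums 1"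

text \<open>Null recurrence: return is certain, but the mean return time is infinite.\<close>

definition null_recurrent :: "'s set \<Rightarrow> ('s \<Rightarrow> 's \<Rightarrow> real) \<Rightarrow> bool" where
  "null_recurrent S p \<longleftrightarrow>
     (\<forall>x\<in>S. recurrent_state S p x \<and> \<not> summable (\<lambda>n. real n * first_passage S p n x x))"

text \<open>
  The Poisson equation \<open>(I - P) u = g\<close>.  It is only used for kernels with finitely many nonzero
  entries in each row, for which the sum is a finite one.
\<close>

definition poisson_equation ::
  "'s set \<Rightarrow> ('s \<Rightarrow> 's \<Rightarrow> real) \<Rightarrow> ('s \<Rightarrow> complex) \<Rightarrow> ('s \<Rightarrow> complex) \<Rightarrow> bool" where
  "poisson_equation S p u g \<longleftrightarrow>
     (\<forall>x\<in>S. u x - (\<Sum>\<^sub>\<infinity>y\<in>S. complex_of_real (p x y) * u y) = g x)"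

section \<open>Quasi-birth-and-death processes\<close>

text \<open>A state is a pair (level, phase); the phases are numbered from \<open>0\<close> to \<open>m - 1\<close>.\<close>

definition qbd_states :: "nat \<Rightarrow> (nat \<times> nat) set" where
  "qbd_states m = UNIV \<times> {..<m}"

definition qbd_block ::
  "nat \<Rightarrow> real mat \<Rightarrow> real mat \<Rightarrow> real mat \<Rightarrow> real mat \<Rightarrow> nat \<Rightarrow> nat \<Rightarrow> real mat" where
  "qbd_block m B Am A0 A1 i j =
     (if i = 0 \<and> j = 0 then B
      else if j = i then A0
      else if j = i + 1 then A1
      else if i = j + 1 then Am
      else 0\<^sub>m m m)"

definition qbd_kernel ::
  "nat \<Rightarrow> real mat \<Rightarrow> real mat \<Rightarrow> real mat \<Rightarrow> real mat \<Rightarrow> nat \<times> nat \<Rightarrow> nat \<times> nat \<Rightarrow> real" where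
  "qbd_kernel m B Am A0 A1 = (\<lambda>(i, a) (j, b). qbd_block m B Am A0 A1 i j $$ (a, b))"

definition dqbd_states :: "nat \<Rightarrow> (int \<times> nat) set" where
  "dqbd_states m = UNIV \<times> {..<m}"

definition dqbd_kernel ::
  "real mat \<Rightarrow> real mat \<Rightarrow> real mat \<Rightarrow> int \<times> nat \<Rightarrow> int \<times> nat \<Rightarrow> real" where
  "dqbd_kernel Am A0 A1 = (\<lambda>(i, a) (j, b).
     if j = i - 1 then Am $$ (a, b)
     else if j = i then A0 $$ (a, b)
     else if j = i + 1 then A1 $$ (a, b)
     else 0)"

definition single_final_class :: "nat \<Rightarrow> real mat \<Rightarrow> real mat \<Rightarrow> real mat \<Rightarrow> bool" where
  "single_final_class m Am A0 A1 \<longleftrightarrow>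
     (\<exists>E \<subseteq> {..<m}. E \<noteq> {} \<and>
        (\<forall>C. final_class (dqbd_states m) (dqbd_kernel Am A0 A1) C \<longleftrightarrow> C = UNIV \<times> E) \<and>
        (\<forall>x \<in> dqbd_states m - UNIV \<times> E. \<exists>y \<in> UNIV \<times> E.
           (x, y) \<in> (transition_graph (dqbd_states m) (dqbd_kernel Am A0 A1))\<^sup>*))"

definition minimal_nonneg_solution :: "nat \<Rightarrow> (real mat \<Rightarrow> real mat) \<Rightarrow> real mat \<Rightarrow> bool" where
  "minimal_nonneg_solution m F X \<longleftrightarrow>
     X \<in> carrier_mat m m \<and> 0\<^sub>m m m \<le> X \<and> F X = 0\<^sub>m m m \<and>
     (\<forall>Y \<in> carrier_mat m m. 0\<^sub>m m m \<le> Y \<and> F Y = 0\<^sub>m m m \<longrightarrow> X \<le> Y)"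

section \<open>Matrix and vector notation\<close>

abbreviation cmat :: "real mat \<Rightarrow> complex mat" where
  "cmat \<equiv> map_mat complex_of_real"

abbreviation cvec :: "real vec \<Rightarrow> complex vec" where
  "cvec \<equiv> map_vec complex_of_real"

text \<open>Meaningful for nonsingular square matrices only.\<close>

definition mat_inv :: "'a::field mat \<Rightarrow> 'a mat" where
  "mat_inv A = the (mat_inverse A)"

definition outer_prod :: "'a::semiring_0 vec \<Rightarrow> 'a vec \<Rightarrow> 'a mat" where
  "outer_prod v w = mat (dim_vec v) (dim_vec w) (\<lambda>(i, j). v $ i * w $ j)"

text \<open>The block row \<open>[A | B]\<close>; the library has only the block column \<open>A @\<^sub>r B\<close>.\<close>

definition block_row :: "'a::zero mat \<Rightarrow> 'a mat \<Rightarrow> 'a mat" where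
  "block_row A B = four_block_mat A B (0\<^sub>m 0 (dim_col A)) (0\<^sub>m 0 (dim_col B))"

abbreviation vec_sum :: "nat \<Rightarrow> ('i \<Rightarrow> complex vec) \<Rightarrow> 'i set \<Rightarrow> complex vec" where
  "vec_sum \<equiv> finsum_vec TYPE(complex)"

text \<open>Convergence in finite dimension is entrywise convergence.\<close>

definition vec_summable :: "nat \<Rightarrow> (nat \<Rightarrow> complex vec) \<Rightarrow> bool" where
  "vec_summable n f \<longleftrightarrow> (\<forall>i<n. summable (\<lambda>k. f k $ i))"

definition vec_suminf :: "nat \<Rightarrow> (nat \<Rightarrow> complex vec) \<Rightarrow> complex vec" where
  "vec_suminf n f = vec n (\<lambda>i. \<Sum>k. f k $ i)"

definition mat_suminf :: "nat \<Rightarrow> nat \<Rightarrow> (nat \<Rightarrow> real mat) \<Rightarrow> real mat" where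
  "mat_suminf nr nc f = mat nr nc (\<lambda>ij. \<Sum>k. f k $$ ij)"

end

theory Submission
  imports Defs
begin

text \<open>
  Let \<open>H = U - I\<close>.  The minimal solutions factor the matrix polynomial of the level recursion,
  \<open>Am + z (A0 - I) + z\<^sup>2 A1 = (I - z R) H (z I - G)\<close>, and the right shift only replaces the last factor
  by \<open>z I - Gt\<close>.  On sequences the shift is \<open>u' 0 = u 0\<close>, \<open>u' r = u r - Q u (r - 1)\<close>; as \<open>Q\<close> is a projection onto
  the constant vectors, which are the right kernel of \<open>Am + A0 + A1 - I\<close>, the Poisson equation for \<open>u\<close>
  becomes the recursion with shifted coefficients for \<open>u'\<close>, and \<open>u\<close> is recovered from \<open>u'\<close> by the
  partial sums in the theorem.  The factorization splits the second order recursion into two of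
  first order: \<open>\<delta> r = H (u' (r + 1) - Gt u' r)\<close> runs backwards, \<open>\<delta> r = R \<delta> (r + 1) - g (r + 1)\<close>, and \<open>u'\<close> then runs forwards
  in \<open>Gt\<close> (\<open>poisson_iff_recursion\<close>).

  The matrix \<open>W\<close> conjugates \<open>R\<close> into \<open>Gdd\<close>, so that \<open>d r = W \<delta> r\<close> satisfies \<open>d r = Gdd d (r + 1) - W g (r + 1)\<close>.
  In the coordinates given by \<open>E\<close> and \<open>F\<close> the nilpotent part of this backward recursion is determined
  by \<open>g\<close> alone, while the invertible part can be solved forwards from an arbitrary initial vector:
  this is the free parameter \<open>y\<close>, and \<open>x = u' 0 - Gdd d 0\<close> is the other one
  (\<open>recursion_solutions\<close>).  Level \<open>0\<close> yields the linear system for \<open>x\<close>.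

  Three facts make this work.
  (i) \<open>H\<close> is nonsingular, and \<open>U\<close> and \<open>R\<close> are given by \<open>G\<close>: since \<open>G\<close> is the limit of the monotone iteration
  from \<open>0\<close> and has row sums \<open>1\<close>, the powers of \<open>U\<close> applied to the all-ones vector become small
  (\<open>U_transient\<close>, \<open>R_factor\<close>).
  (ii) \<open>W\<close> is the inverse of \<open>S = H (I - Gt Gdd)\<close>.  One has \<open>S Gdd = R S\<close>; hence the kernel of \<open>S\<close> is
  invariant under \<open>Gdd\<close>, and on it every \<open>Gt\<^sup>n Gdd\<^sup>n\<close> is the identity.  But these products tend to \<open>0\<close>,
  because \<open>Gt\<close> has spectral radius less than \<open>1\<close> and \<open>Gdd\<close> at most \<open>1\<close>; the first bound comes from a
  maximum principle on the doubly infinite chain, whose single final class is invariant under a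
  translation of the levels (\<open>unimodular_root\<close>).
  (iii) The right kernel of \<open>I - B - A1 G\<close> consists of the constant vectors, by the maximum principle for
  the bounded \<open>P\<close>-harmonic function \<open>G\<^sup>r x\<close>.  So \<open>\<pi>0\<close> spans the left kernel, the linear system is
  solvable if and only if \<open>\<pi>0\<close> annihilates its right-hand side, and a summation by means of
  \<open>Gdd\<^sup>k W = W R\<^sup>k\<close> gives this condition the form stated.
\<close>

section \<open>Kernels and the maximum principle\<close>

text \<open>
  The value at \<open>x\<close> is at most an average of the values at the successors of \<open>x\<close>.  At a maximal
  state none of these can be smaller, so the maximum propagates along the edges.
\<close>

lemma max_principle:
  fixes f :: "'s \<Rightarrow> real"
  assumes p: "row_stochastic S p"
    and sub: "\<And>x. x \<in> S \<Longrightarrow> \<exists>s. ((\<lambda>y. p x y * f y) has_sum s) S \<and> f x \<le> s"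
    and z: "z \<in> S" and max: "\<And>y. y \<in> S \<Longrightarrow> f y \<le> f z"
    and reach: "(z, y) \<in> (transition_graph S p)\<^sup>*"
  shows "f y = f z"
  using reach
proof (induction rule: rtrancl_induct)
  case base
  show ?case ..
next
  case (step x y)
  then have x: "x \<in> S" and y: "y \<in> S" and xy: "0 < p x y"
    by (auto simp: transition_graph_def)
  from sub[OF x] obtain s where s: "((\<lambda>y. p x y * f y) has_sum s) S" "f x \<le> s" by blast
  have nonneg: "0 \<le> p x w" if "w \<in> S" for w
    using p x that by (auto simp: row_stochastic_def)
  have "((\<lambda>y. p x y * f z) has_sum (1 * f z)) S"
    using p x by (intro has_sum_cmult_left) (auto simp: row_stochastic_def)
  from has_sum_add[OF this has_sum_uminusI[OF s(1)]]
  have d: "((\<lambda>y. p x y * (f z - f y)) has_sum (f z - s)) S"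
    by (simp add: algebra_simps)
  have "p x y * (f z - f y) = 0"
    by (rule nonneg_has_sum_le_0D[OF d _ _ y])
      (use s(2) step.IH nonneg max in \<open>auto intro!: mult_nonneg_nonneg\<close>)
  then show ?case using xy by simp
qed

lemma mat_vec_entry:
  "i < dim_row X \<Longrightarrow> dim_vec x = dim_col X \<Longrightarrow> (X *\<^sub>v x) $ i = (\<Sum>j<dim_col X. X $$ (i, j) * x $ j)"
  by (simp add: scalar_prod_def atLeast0LessThan)

text \<open>
  The row of level \<open>0\<close>; these sums serve row sums, harmonic functions and the Poisson equation,
  hence the general value type.
\<close>

lemma qbd_has_sum_0:
  fixes h :: "nat \<times> nat \<Rightarrow> 'b :: {real_normed_algebra_1}"
  assumes "a < m"
  shows "((\<lambda>y. of_real (qbd_kernel m B Am A0 A1 (0, a) y) * h y) has_sum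
    ((\<Sum>b<m. of_real (B $$ (a, b)) * h (0, b)) + (\<Sum>b<m. of_real (A1 $$ (a, b)) * h (1, b))))
    (qbd_states m)"
  by (rule has_sum_finite_neutralI[where B = "{0, 1} \<times> {..<m}"])
    (use assms in \<open>auto simp: qbd_states_def qbd_kernel_def qbd_block_def
      sum.cartesian_product' intro: ccontr\<close>)

lemma qbd_has_sum_Suc:
  fixes h :: "nat \<times> nat \<Rightarrow> 'b :: {real_normed_algebra_1}"
  assumes "a < m"
  shows "((\<lambda>y. of_real (qbd_kernel m B Am A0 A1 (Suc r, a) y) * h y) has_sum
    ((\<Sum>b<m. of_real (Am $$ (a, b)) * h (r, b)) + (\<Sum>b<m. of_real (A0 $$ (a, b)) * h (Suc r, b))
      + (\<Sum>b<m. of_real (A1 $$ (a, b)) * h (Suc (Suc r), b))))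
    (qbd_states m)"
  by (rule has_sum_finite_neutralI[where B = "{r, Suc r, Suc (Suc r)} \<times> {..<m}"])
    (use assms in \<open>auto simp: qbd_states_def qbd_kernel_def qbd_block_def
      sum.cartesian_product' add.assoc split: if_splits\<close>)

lemma dqbd_has_sum:
  fixes h :: "int \<times> nat \<Rightarrow> 'b :: {real_normed_algebra_1}"
  assumes "a < m"
  shows "((\<lambda>y. of_real (dqbd_kernel Am A0 A1 (n, a) y) * h y) has_sum
    ((\<Sum>b<m. of_real (Am $$ (a, b)) * h (n - 1, b)) + (\<Sum>b<m. of_real (A0 $$ (a, b)) * h (n, b))
      + (\<Sum>b<m. of_real (A1 $$ (a, b)) * h (n + 1, b))))
    (dqbd_states m)"
  by (rule has_sum_finite_neutralI[where B = "{n - 1, n, n + 1} \<times> {..<m}"])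
    (use assms in \<open>auto simp: dqbd_states_def dqbd_kernel_def
      sum.cartesian_product' add.assoc split: if_splits\<close>)

lemma stochastic_fixed_const:
  fixes f :: "nat \<Rightarrow> real"
  assumes p: "row_stochastic {..<m} p" and irr: "irreducible_on {..<m} p"
    and sub: "\<And>a. a < m \<Longrightarrow> f a \<le> (\<Sum>b<m. p a b * f b)"
    and "a < m" "b < m"
  shows "f a = f b"
proof -
  have "finite (f ` {..<m})" "f ` {..<m} \<noteq> {}" using assms by auto
  from Max_in[OF this] obtain z where z: "z < m" "f z = Max (f ` {..<m})" by force
  have mx: "f y \<le> f z" if "y \<in> {..<m}" for y using that z(2) by simp
  have "f y = f z" if "y < m" for y
    by (rule max_principle[where f = f and z = z, OF p _ _ mx])
      (use z(1) that irr sub in \<open>auto simp: irreducible_on_def has_sum_finite_iff\<close>)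
  with assms show ?thesis by simp
qed

section \<open>Nonnegative matrices and inverses\<close>

declare index_mult_mat_vec [simp del] index_mult_mat(1) [simp del]

abbreviation ones :: "nat \<Rightarrow> real vec" where
  "ones n \<equiv> vec n (\<lambda>_. 1)"

lemma square_mult_carrier [simp, intro]:
  "X \<in> carrier_mat n n \<Longrightarrow> Y \<in> carrier_mat n n \<Longrightarrow> X * Y \<in> carrier_mat n n"
  by (rule mult_carrier_mat)

lemma square_mult_vec_carrier [simp, intro]:
  "X \<in> carrier_mat n n \<Longrightarrow> X *\<^sub>v x \<in> carrier_vec n"
  unfolding carrier_vec_def carrier_mat_def by simp

lemma square_minus_carrier [simp, intro]:
  "X \<in> carrier_mat n n \<Longrightarrow> Y \<in> carrier_mat n n \<Longrightarrow> X - Y \<in> carrier_mat n n"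
  by (rule minus_carrier_mat)

lemma mat_mult_entry:
  "i < dim_row X \<Longrightarrow> j < dim_col Y \<Longrightarrow> dim_col X = dim_row Y \<Longrightarrow>
    (X * Y) $$ (i, j) = (\<Sum>k<dim_row Y. X $$ (i, k) * Y $$ (k, j))"
  by (simp add: index_mult_mat(1) scalar_prod_def atLeast0LessThan)

lemma mat_mult_mono:
  fixes X Y Z T :: "real mat"
  assumes "X \<in> carrier_mat nr n" "Z \<in> carrier_mat n nc"
    "0\<^sub>m nr n \<le> X" "X \<le> Y" "0\<^sub>m n nc \<le> Z" "Z \<le> T"
  shows "X * Z \<le> Y * T"
proof -
  have "(\<Sum>k<n. X $$ (i, k) * Z $$ (k, j)) \<le> (\<Sum>k<n. Y $$ (i, k) * T $$ (k, j))"
    if "i < nr" "j < nc" for i j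
  proof (intro sum_mono mult_mono)
    fix k assume "k \<in> {..<n}"
    with that assms show "X $$ (i, k) \<le> Y $$ (i, k)" "Z $$ (k, j) \<le> T $$ (k, j)"
        "0 \<le> Z $$ (k, j)" "0 \<le> Y $$ (i, k)"
      by (auto simp: less_eq_mat_def) (meson order_trans)
  qed
  moreover have "Y \<in> carrier_mat nr n" "T \<in> carrier_mat n nc"
    using assms by (auto simp: less_eq_mat_def)
  ultimately show ?thesis
    using assms by (auto simp: less_eq_mat_def mat_mult_entry)
qed

lemma mat_mult_nonneg:
  fixes X Z :: "real mat"
  assumes "X \<in> carrier_mat nr n" "Z \<in> carrier_mat n nc" "0\<^sub>m nr n \<le> X" "0\<^sub>m n nc \<le> Z"
  shows "0\<^sub>m nr nc \<le> X * Z"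
  using assms by (auto simp: less_eq_mat_def mat_mult_entry
      intro!: sum_nonneg mult_nonneg_nonneg)

lemma mat_add_mono:
  fixes X Y Z T :: "real mat"
  shows "X \<le> Y \<Longrightarrow> Z \<le> T \<Longrightarrow> dim_row X = dim_row Z \<Longrightarrow> dim_col X = dim_col Z \<Longrightarrow> X + Z \<le> Y + T"
  by (auto simp: less_eq_mat_def add_mono)

lemma mat_add_nonneg:
  fixes X Z :: "real mat"
  shows "0\<^sub>m nr nc \<le> X \<Longrightarrow> 0\<^sub>m nr nc \<le> Z \<Longrightarrow> 0\<^sub>m nr nc \<le> X + Z"
  by (auto simp: less_eq_mat_def)

lemma mat_vec_mono:
  fixes X :: "real mat" and x y :: "real vec"
  assumes "X \<in> carrier_mat nr n" "x \<in> carrier_vec n" "0\<^sub>m nr n \<le> X" "x \<le> y"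
  shows "X *\<^sub>v x \<le> X *\<^sub>v y"
  using assms by (auto simp: less_eq_mat_def less_eq_vec_def mat_vec_entry
      intro!: sum_mono mult_left_mono)

lemma mat_vec_mono_left:
  fixes X Y :: "real mat" and x :: "real vec"
  assumes "X \<in> carrier_mat nr n" "x \<in> carrier_vec n" "X \<le> Y" "0\<^sub>v n \<le> x"
  shows "X *\<^sub>v x \<le> Y *\<^sub>v x"
  using assms by (auto simp: less_eq_mat_def less_eq_vec_def mat_vec_entry
      intro!: sum_mono mult_right_mono)

lemma vec_add_mono:
  fixes x y z t :: "real vec"
  shows "x \<le> y \<Longrightarrow> z \<le> t \<Longrightarrow> dim_vec x = dim_vec z \<Longrightarrow> x + z \<le> y + t"
  by (auto simp: less_eq_vec_def add_mono)

lemma mat_eqI_vec: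
  fixes X Y :: "'a :: semiring_1 mat"
  assumes "X \<in> carrier_mat nr nc" "Y \<in> carrier_mat nr nc"
    and "\<And>x. x \<in> carrier_vec nc \<Longrightarrow> X *\<^sub>v x = Y *\<^sub>v x"
  shows "X = Y"
proof (rule eq_matI)
  fix i j assume ij: "i < dim_row Y" "j < dim_col Y"
  then have "(X *\<^sub>v unit_vec nc j) $ i = (Y *\<^sub>v unit_vec nc j) $ i"
    using assms by simp
  then show "X $$ (i, j) = Y $$ (i, j)" using ij assms(1,2)
    by (simp add: index_mult_mat_vec scalar_prod_right_unit)
qed (use assms in auto)

text \<open>
  For a substochastic \<open>U\<close>: after some number of steps the chain has stopped with positive probability,
  whatever its initial state.  The condition makes \<open>I - U\<close> an M-matrix.
\<close>

definition transient :: "nat \<Rightarrow> real mat \<Rightarrow> bool" where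
  "transient m U \<longleftrightarrow> U \<in> carrier_mat m m \<and> 0\<^sub>m m m \<le> U \<and> (\<exists>n. \<forall>i<m. (U ^\<^sub>m n *\<^sub>v ones m) $ i < 1)"

lemma pow_nonneg:
  fixes U :: "real mat"
  assumes "U \<in> carrier_mat m m" "0\<^sub>m m m \<le> U"
  shows "0\<^sub>m m m \<le> U ^\<^sub>m n"
proof (induction n)
  case 0 then show ?case using assms by (auto simp: less_eq_mat_def)
next
  case (Suc n)
  then show ?case using assms by (simp add: mat_mult_nonneg[where n = m])
qed

lemma pow_mat_Suc_left:
  fixes X :: "'a :: semiring_1 mat"
  assumes "X \<in> carrier_mat n n"
  shows "X ^\<^sub>m Suc k = X * X ^\<^sub>m k"
  using assms
proof (induction k)
  case (Suc k)
  have "X ^\<^sub>m Suc (Suc k) = X ^\<^sub>m Suc k * X" by simp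
  also have "\<dots> = X * X ^\<^sub>m k * X" using Suc by simp
  also have "\<dots> = X * (X ^\<^sub>m k * X)" using Suc.prems by (intro assoc_mult_mat) auto
  finally show ?case by simp
qed simp

lemma transient_mono:
  assumes U: "transient m U" and V: "V \<in> carrier_mat m m" "0\<^sub>m m m \<le> V" "V \<le> U"
  shows "transient m V"
proof -
  have Uc: "U \<in> carrier_mat m m" "0\<^sub>m m m \<le> U" using U by (auto simp: transient_def)
  have "V ^\<^sub>m n \<le> U ^\<^sub>m n" for n
  proof (induction n)
    case 0 show ?case using V Uc by auto
  next
    case (Suc n)
    then show ?case using V Uc by (simp add: mat_mult_mono[of _ m m _ m] pow_nonneg)
  qed
  then have "V ^\<^sub>m n *\<^sub>v ones m \<le> U ^\<^sub>m n *\<^sub>v ones m" for n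
    using V by (intro mat_vec_mono_left[where nr = m and n = m]) (auto simp: less_eq_vec_def)
  then have le: "(V ^\<^sub>m n *\<^sub>v ones m) $ i \<le> (U ^\<^sub>m n *\<^sub>v ones m) $ i" if "i < m" for n i
    using that Uc by (simp add: less_eq_vec_def)
  from U obtain n where "\<forall>i<m. (U ^\<^sub>m n *\<^sub>v ones m) $ i < 1"
    by (auto simp: transient_def)
  then have "\<forall>i<m. (V ^\<^sub>m n *\<^sub>v ones m) $ i < 1" using le le_less_trans by blast
  then show ?thesis using V by (auto simp: transient_def)
qed

text \<open>
  If \<open>U x \<le> x\<close>, then \<open>U\<^sup>n x \<le> x\<close>; at a negative minimum \<open>s\<close> of \<open>x\<close> this contradicts
  \<open>U\<^sup>n x \<ge> s U\<^sup>n 1 > s\<close>.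
\<close>

lemma transient_nonneg:
  assumes U: "transient m U" and x: "x \<in> carrier_vec m" and le: "U *\<^sub>v x \<le> x"
  shows "0\<^sub>v m \<le> x"
proof (rule ccontr)
  assume neg: "\<not> 0\<^sub>v m \<le> x"
  have Uc: "U \<in> carrier_mat m m" "0\<^sub>m m m \<le> U" using U by (auto simp: transient_def)
  have iter: "U ^\<^sub>m n *\<^sub>v x \<le> x" for n
  proof (induction n)
    case 0 show ?case using x Uc by simp
  next
    case (Suc n)
    have "U ^\<^sub>m Suc n *\<^sub>v x = U ^\<^sub>m n *\<^sub>v (U *\<^sub>v x)"
      using Uc x by (simp add: assoc_mult_mat_vec[of _ m m _ m])
    also have "\<dots> \<le> U ^\<^sub>m n *\<^sub>v x"
      using Uc x le by (intro mat_vec_mono[where nr = m and n = m]) (auto simp: pow_nonneg)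
    finally show ?case using Suc by (rule order_trans)
  qed
  from U obtain n where n: "\<forall>i<m. (U ^\<^sub>m n *\<^sub>v ones m) $ i < 1"
    by (auto simp: transient_def)
  from neg x obtain i0 where i0: "i0 < m" "x $ i0 < 0" by (auto simp: less_eq_vec_def not_le)
  have "finite (($) x ` {..<m})" "($) x ` {..<m} \<noteq> {}" using i0 by auto
  from Min_in[OF this] obtain i where i: "i < m" "x $ i = Min (($) x ` {..<m})" by force
  have mn: "x $ i \<le> x $ j" if "j < m" for j using that i(2) by simp
  have neg_i: "x $ i < 0" using mn[OF i0(1)] i0(2) by linarith
  have "U ^\<^sub>m n *\<^sub>v ((x $ i) \<cdot>\<^sub>v ones m) \<le> U ^\<^sub>m n *\<^sub>v x"
    using Uc x mn by (intro mat_vec_mono[where nr = m and n = m]) (auto simp: pow_nonneg less_eq_vec_def)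
  also have "U ^\<^sub>m n *\<^sub>v ((x $ i) \<cdot>\<^sub>v ones m) = (x $ i) \<cdot>\<^sub>v (U ^\<^sub>m n *\<^sub>v ones m)"
    using Uc by (intro mult_mat_vec[of _ m m]) auto
  also note iter[of n]
  finally have "x $ i * (U ^\<^sub>m n *\<^sub>v ones m) $ i \<le> x $ i"
    using i(1) x Uc unfolding less_eq_vec_def by simp
  moreover have "x $ i * 1 < x $ i * (U ^\<^sub>m n *\<^sub>v ones m) $ i"
    using n i neg_i by (intro mult_strict_left_mono_neg) auto
  ultimately show False by simp
qed

lemma inverse_from_kernel:
  fixes X :: "'a :: field mat"
  assumes X: "X \<in> carrier_mat n n"
    and ker: "\<And>x. x \<in> carrier_vec n \<Longrightarrow> X *\<^sub>v x = 0\<^sub>v n \<Longrightarrow> x = 0\<^sub>v n"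
  obtains Y where "Y \<in> carrier_mat n n" "X * Y = 1\<^sub>m n" "Y * X = 1\<^sub>m n"
proof -
  have "det X \<noteq> 0" using det_0_iff_vec_prod_zero_field[OF X] ker by blast
  from det_non_zero_imp_unit[OF X this, of undefined] that show ?thesis
    by (auto simp: Units_def ring_mat_simps)
qed

text \<open>
  Monotonicity applied to \<open>x\<close> and \<open>- x\<close> makes \<open>I - U\<close> injective; applied to the columns of the inverse
  it makes them nonnegative.
\<close>

lemma transient_inverse:
  assumes U: "transient m U"
  obtains N where "N \<in> carrier_mat m m" "(1\<^sub>m m - U) * N = 1\<^sub>m m" "N * (1\<^sub>m m - U) = 1\<^sub>m m"
    "0\<^sub>m m m \<le> N"
proof -
  have Uc: "U \<in> carrier_mat m m" "0\<^sub>m m m \<le> U" using U by (auto simp: transient_def)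
  have U1: "(1\<^sub>m m - U) *\<^sub>v x = x - U *\<^sub>v x" if "x \<in> carrier_vec m" for x
    using Uc that by (simp add: minus_mult_distrib_mat_vec[of _ m m])
  have ker: "x = 0\<^sub>v m" if x: "x \<in> carrier_vec m" "(1\<^sub>m m - U) *\<^sub>v x = 0\<^sub>v m" for x
  proof -
    have "x - U *\<^sub>v x = 0\<^sub>v m" using x U1 by simp
    then have "(x - U *\<^sub>v x) $ i = 0" if "i < m" for i using that by simp
    then have "U *\<^sub>v x = x" using x Uc by (intro eq_vecI) auto
    moreover have "U *\<^sub>v (- x) = - (U *\<^sub>v x)" using x(1) Uc
      by (intro eq_vecI) (auto simp: mat_vec_entry sum_negf)
    ultimately have "0\<^sub>v m \<le> x" "0\<^sub>v m \<le> - x"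
      using transient_nonneg[OF U, of x] transient_nonneg[OF U, of "- x"] x by auto
    then show ?thesis using x(1) by (intro eq_vecI) (force simp: less_eq_vec_def)+
  qed
  from inverse_from_kernel[of "1\<^sub>m m - U" m] ker Uc obtain N where
    N: "N \<in> carrier_mat m m" "(1\<^sub>m m - U) * N = 1\<^sub>m m" "N * (1\<^sub>m m - U) = 1\<^sub>m m" 
    by (metis minus_carrier_mat)
  have "0\<^sub>v m \<le> col N j" if j: "j < m" for j
  proof (rule transient_nonneg[OF U])
    have "(1\<^sub>m m - U) *\<^sub>v col N j = col ((1\<^sub>m m - U) * N) j" using j N Uc
      by (intro col_mult2[symmetric]) auto
    also have "\<dots> = unit_vec m j" using N j by simp
    finally have "col N j - U *\<^sub>v col N j = unit_vec m j" using N j U1 by auto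
    then have eq: "(col N j - U *\<^sub>v col N j) $ i = unit_vec m j $ i" for i by simp
    have "(col N j) $ i - (U *\<^sub>v col N j) $ i \<ge> 0" if "i < m" for i
      using eq[of i] that Uc N j by (auto simp: unit_vec_def split: if_splits)
    then show "U *\<^sub>v col N j \<le> col N j" using Uc N j by (auto simp: less_eq_vec_def)
  qed (use N in auto)
  then have "0\<^sub>m m m \<le> N" using N(1) by (auto simp: less_eq_vec_def less_eq_mat_def)
  with N that show ?thesis by blast
qed

section \<open>Minimal solutions of quadratic matrix equations\<close>

primrec riccati_iter :: "nat \<Rightarrow> real mat \<Rightarrow> real mat \<Rightarrow> real mat \<Rightarrow> nat \<Rightarrow> real mat" where
  "riccati_iter m Am A0 A1 0 = 0\<^sub>m m m"
| "riccati_iter m Am A0 A1 (Suc n) =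
    Am + A0 * riccati_iter m Am A0 A1 n +
      A1 * (riccati_iter m Am A0 A1 n * riccati_iter m Am A0 A1 n)"

lemma riccati_fixed_point:
  fixes X :: "real mat"
  assumes "Am \<in> carrier_mat m m" "A0 \<in> carrier_mat m m" "A1 \<in> carrier_mat m m" "X \<in> carrier_mat m m"
  shows "Am + (A0 - 1\<^sub>m m) * X + A1 * (X * X) = 0\<^sub>m m m \<longleftrightarrow> Am + A0 * X + A1 * (X * X) = X"
proof -
  have "(A0 - 1\<^sub>m m) * X = A0 * X - X"
    using assms by (simp add: minus_mult_distrib_mat[of _ m m _ _ m])
  then have "Am + (A0 - 1\<^sub>m m) * X + A1 * (X * X) = Am + A0 * X + A1 * (X * X) - X"
    using assms by (intro eq_matI) auto
  moreover have "Y - X = 0\<^sub>m m m \<longleftrightarrow> Y = X" if "Y \<in> carrier_mat m m" for Y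
  proof
    assume "Y - X = 0\<^sub>m m m"
    then have "(Y - X) $$ (i, j) = 0" if "i < m" "j < m" for i j using that by simp
    then show "Y = X" using assms that by (intro eq_matI) auto
  qed (use assms in \<open>auto intro!: eq_matI\<close>)
  ultimately show ?thesis using assms by simp
qed

text \<open>
  The situation is used twice: for \<open>G\<close>, and with \<open>Am\<close> and \<open>A1\<close> exchanged for \<open>Gh\<close>.
\<close>

locale riccati =
  fixes m :: nat and Am A0 A1 G :: "real mat"
  assumes Am[simp]: "Am \<in> carrier_mat m m" and A0[simp]: "A0 \<in> carrier_mat m m"
    and A1[simp]: "A1 \<in> carrier_mat m m"
    and Am_nonneg: "0\<^sub>m m m \<le> Am" and A0_nonneg: "0\<^sub>m m m \<le> A0" and A1_nonneg: "0\<^sub>m m m \<le> A1"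
    and row_sums: "Am *\<^sub>v ones m + A0 *\<^sub>v ones m + A1 *\<^sub>v ones m = ones m"
    and G_min: "minimal_nonneg_solution m (\<lambda>X. Am + (A0 - 1\<^sub>m m) * X + A1 * (X * X)) G"
    and G_ones: "G *\<^sub>v ones m = ones m"
begin

declare carrier_matD[OF Am, simp] carrier_matD[OF A0, simp] carrier_matD[OF A1, simp]

lemmas square_simps =
  add_mult_distrib_mat_vec[of _ m m] mult_add_distrib_mat_vec[of _ m m]
  minus_mult_distrib_mat_vec[of _ m m] mult_minus_distrib_mat_vec[of _ m m]
  assoc_mult_mat_vec[of _ m m _ m] assoc_add_vec[of _ m]

abbreviation U where "U \<equiv> A0 + A1 * G"

lemma G[simp]: "G \<in> carrier_mat m m" and G_nonneg: "0\<^sub>m m m \<le> G"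
  and G_eq: "Am + A0 * G + A1 * (G * G) = G"
  and G_least: "\<And>Y. Y \<in> carrier_mat m m \<Longrightarrow> 0\<^sub>m m m \<le> Y \<Longrightarrow>
    Am + A0 * Y + A1 * (Y * Y) = Y \<Longrightarrow> G \<le> Y"
  using G_min by (auto simp: minimal_nonneg_solution_def riccati_fixed_point)

declare carrier_matD[OF G, simp]

abbreviation "X \<equiv> riccati_iter m Am A0 A1"

lemma X[simp]: "X n \<in> carrier_mat m m"
  by (induction n) auto

lemma X_nonneg: "0\<^sub>m m m \<le> X n"
  by (induction n) (auto intro!: mat_add_nonneg mat_mult_nonneg[where n = m] Am_nonneg A0_nonneg A1_nonneg)

lemma X_step_mono:
  assumes "Y \<in> carrier_mat m m" "Z \<in> carrier_mat m m" "0\<^sub>m m m \<le> Y" "Y \<le> Z"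
  shows "Am + A0 * Y + A1 * (Y * Y) \<le> Am + A0 * Z + A1 * (Z * Z)"
  using assms A0_nonneg A1_nonneg carrier_matD[of _ m m, OF A0] carrier_matD[of _ m m, OF A1]
    carrier_matD[of _ m m, OF Am]
  by (intro mat_add_mono mat_mult_mono[of _ m m _ m]) (auto intro: mat_mult_nonneg)

lemma X_mono: "X n \<le> X (Suc n)"
proof (induction n)
  case 0 show ?case using X_nonneg[of "Suc 0"] by simp
next
  case (Suc n)
  then show ?case using X_step_mono[of "X n" "X (Suc n)"] X_nonneg[of n] X[of n] X[of "Suc n"]
    by simp
qed

lemma X_le_G: "X n \<le> G"
proof (induction n)
  case 0 show ?case using G_nonneg by simp
next
  case (Suc n)
  then show ?case using X_step_mono[of "X n" G] X_nonneg[of n] by (simp add: G_eq)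
qed

text \<open>
  The monotone limit exists, is a solution below \<open>G\<close>, and therefore equals \<open>G\<close> by minimality.
\<close>

lemma X_tendsto:
  assumes ij: "i < m" "j < m"
  shows "(\<lambda>n. X n $$ (i, j)) \<longlonglongrightarrow> G $$ (i, j)"
proof -
  define Y where "Y = mat m m (\<lambda>ij. lim (\<lambda>n. X n $$ ij))"
  have Y[simp]: "Y \<in> carrier_mat m m" by (simp add: Y_def)
  have dim: "dim_row (X n) = m" "dim_col (X n) = m" for n
    by (fact carrier_matD[OF X])+
  have dims: "dim_row Am = m" "dim_col Am = m" "dim_row A0 = m" "dim_col A0 = m"
    "dim_row A1 = m" "dim_col A1 = m" "dim_row G = m" "dim_col G = m" "dim_row Y = m" "dim_col Y = m"
    by (fact carrier_matD[OF Am] carrier_matD[OF A0] carrier_matD[OF A1] carrier_matD[OF G]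
      carrier_matD[OF Y])+
  have lim: "(\<lambda>n. X n $$ (i, j)) \<longlonglongrightarrow> Y $$ (i, j)" if "i < m" "j < m" for i j
  proof -
    have "incseq (\<lambda>n. X n $$ (i, j))"
      using X_mono that dim unfolding less_eq_mat_def by (intro incseq_SucI) auto
    moreover have "X n $$ (i, j) \<le> G $$ (i, j)" for n
      using X_le_G[of n] that dims unfolding less_eq_mat_def by auto
    ultimately have "convergent (\<lambda>n. X n $$ (i, j))"
      using incseq_convergent[of "\<lambda>n. X n $$ (i, j)" "G $$ (i, j)"] by (metis convergentI)
    then show ?thesis using that by (simp add: Y_def convergent_LIMSEQ_iff)
  qed
  have entry: "Y $$ (i, j) = (Am + A0 * Y + A1 * (Y * Y)) $$ (i, j)" if "i < m" "j < m" for i j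
  proof (rule LIMSEQ_unique)
    show "(\<lambda>n. X (Suc n) $$ (i, j)) \<longlonglongrightarrow> Y $$ (i, j)"
      using lim[OF that] by (rule LIMSEQ_Suc)
    show "(\<lambda>n. X (Suc n) $$ (i, j)) \<longlonglongrightarrow> (Am + A0 * Y + A1 * (Y * Y)) $$ (i, j)"
      using that by (simp add: mat_mult_entry dim dims) (intro tendsto_intros lim; simp)
  qed
  have Y_eq: "Am + A0 * Y + A1 * (Y * Y) = Y"
    by (rule eq_matI; (rule entry[symmetric])?) (simp_all add: dims)
  have Y_nonneg: "0 \<le> Y $$ (i, j)" if "i < m" "j < m" for i j
    using X_nonneg that dim by (intro LIMSEQ_le_const[OF lim]) (auto simp: less_eq_mat_def)
  have "Y $$ (i, j) \<le> G $$ (i, j)" if "i < m" "j < m" for i j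
    using X_le_G that dim dims by (intro LIMSEQ_le_const2[OF lim]) (auto simp: less_eq_mat_def)
  moreover have "G \<le> Y" using Y_nonneg dims by (intro G_least Y_eq) (auto simp: less_eq_mat_def)
  then have "G $$ (i, j) \<le> Y $$ (i, j)" using ij dims unfolding less_eq_mat_def by simp
  ultimately have "Y $$ (i, j) = G $$ (i, j)" using ij by (simp add: antisym)
  with lim[OF ij] show ?thesis by simp
qed

lemma U[simp]: "U \<in> carrier_mat m m" and U_nonneg: "0\<^sub>m m m \<le> U"
  by (auto intro!: mat_add_nonneg mat_mult_nonneg A0_nonneg A1_nonneg G_nonneg)

lemma ones_nonneg: "0\<^sub>v m \<le> ones m"
  by (auto simp: less_eq_vec_def)

lemma Am_ones: "Am *\<^sub>v ones m + U *\<^sub>v ones m = ones m"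
proof -
  have "U *\<^sub>v ones m = A0 *\<^sub>v ones m + A1 *\<^sub>v ones m"
    by (simp add: square_simps G_ones)
  then show ?thesis using row_sums by (simp add: square_simps)
qed

text \<open>
  \<open>U\<^sup>n 1\<close> bounds the defect of \<open>X n 1\<close>: with \<open>X n \<le> G\<close> one factor of the quadratic term becomes \<open>G\<close>,
  which turns the nonlinear iteration into the linear one with \<open>U = A0 + A1 G\<close>.
\<close>

lemma X_ones_le: "X n *\<^sub>v ones m + U ^\<^sub>m n *\<^sub>v ones m \<le> ones m"
proof (induction n)
  case 0
  have "0\<^sub>m m m *\<^sub>v ones m = 0\<^sub>v m" by (intro eq_vecI) (auto simp: mat_vec_entry)
  then show ?case using carrier_matD[OF U] by simp
next
  case (Suc n)
  let ?x = "X n *\<^sub>v ones m" and ?y = "U ^\<^sub>m n *\<^sub>v ones m"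
  have c: "?x \<in> carrier_vec m" "?y \<in> carrier_vec m" by (auto intro!: mult_mat_vec_carrier[of _ m m])
  have "X (Suc n) *\<^sub>v ones m = Am *\<^sub>v ones m + (A0 *\<^sub>v ?x + (A1 * X n) *\<^sub>v ?x)"
    by (simp add: square_simps)
  also have "\<dots> \<le> Am *\<^sub>v ones m + (A0 *\<^sub>v ?x + (A1 * G) *\<^sub>v ?x)"
  proof (intro vec_add_mono order_refl mat_vec_mono_left[of _ m m])
    show "A1 * X n \<le> A1 * G"
      by (intro mat_mult_mono[of _ m m _ m] A1_nonneg X_nonneg X_le_G) auto
    have "X n *\<^sub>v 0\<^sub>v m = 0\<^sub>v m" using X[of n]
      by (intro eq_vecI) (auto simp: mat_vec_entry simp del: X)
    then show "0\<^sub>v m \<le> ?x" using mat_vec_mono[of "X n" m m "0\<^sub>v m" "ones m"] X_nonneg ones_nonneg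
      by simp
  qed (use c in auto)
  also have "A0 *\<^sub>v ?x + (A1 * G) *\<^sub>v ?x = U *\<^sub>v ?x"
    by (intro add_mult_distrib_mat_vec[symmetric, of _ m m]) auto
  finally have 1: "X (Suc n) *\<^sub>v ones m \<le> Am *\<^sub>v ones m + U *\<^sub>v ?x" .
  have "U ^\<^sub>m Suc n *\<^sub>v ones m = U *\<^sub>v ?y"
    unfolding pow_mat_Suc_left[OF U] by (intro assoc_mult_mat_vec[of _ m m _ m]) auto
  then have "X (Suc n) *\<^sub>v ones m + U ^\<^sub>m Suc n *\<^sub>v ones m \<le> (Am *\<^sub>v ones m + U *\<^sub>v ?x) + U *\<^sub>v ?y"
    using 1 by (intro vec_add_mono) auto
  also have "\<dots> = Am *\<^sub>v ones m + U *\<^sub>v (?x + ?y)"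
    using c by (simp add: square_simps)
  also have "\<dots> \<le> Am *\<^sub>v ones m + U *\<^sub>v ones m"
    using Suc c by (intro vec_add_mono mat_vec_mono[of _ m m] U_nonneg Am_nonneg) auto
  also have "\<dots> = ones m" by (rule Am_ones)
  finally show ?case .
qed

text \<open>
  \<open>X n 1\<close> converges to \<open>G 1 = 1\<close>, so \<open>U\<^sup>n 1\<close> is eventually less than \<open>1\<close>.
\<close>

lemma U_transient: "transient m U"
proof -
  have dim: "dim_row (X n) = m" "dim_col (X n) = m" for n
    by (fact carrier_matD[OF X])+
  have dims: "dim_row U = m" "dim_col U = m" "dim_row (U ^\<^sub>m n) = m" "dim_col (U ^\<^sub>m n) = m" for n
    using carrier_matD[OF U] carrier_matD[OF pow_carrier_mat[OF U]] by auto
  have "\<forall>i<m. \<forall>\<^sub>F n in sequentially. (X n *\<^sub>v ones m) $ i > 0"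
  proof (intro allI impI)
    fix i assume i: "i < m"
    have "(\<lambda>n. (X n *\<^sub>v ones m) $ i) \<longlonglongrightarrow> (G *\<^sub>v ones m) $ i"
      using i by (auto simp: mat_vec_entry dim carrier_matD[OF G] intro!: tendsto_intros X_tendsto)
    then have "(\<lambda>n. (X n *\<^sub>v ones m) $ i) \<longlonglongrightarrow> 1" using i by (simp add: G_ones)
    then show "\<forall>\<^sub>F n in sequentially. (X n *\<^sub>v ones m) $ i > 0"
      by (rule order_tendstoD) simp
  qed
  then have "\<forall>\<^sub>F n in sequentially. \<forall>i\<in>{..<m}. (X n *\<^sub>v ones m) $ i > 0"
    by (intro eventually_ball_finite) auto
  then obtain n where n: "\<forall>i<m. (X n *\<^sub>v ones m) $ i > 0"
    by (auto simp: eventually_sequentially)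
  have "(U ^\<^sub>m n *\<^sub>v ones m) $ i < 1" if "i < m" for i
  proof -
    have "(X n *\<^sub>v ones m + U ^\<^sub>m n *\<^sub>v ones m) $ i \<le> ones m $ i"
      using X_ones_le[of n] that unfolding less_eq_vec_def by simp
    then show ?thesis using n[rule_format, OF that] that by (simp add: dims)
  qed
  then show ?thesis using U_nonneg by (auto simp: transient_def)
qed

lemma Am_factor: "Am = (1\<^sub>m m - U) * G"
proof -
  have "(1\<^sub>m m - U) * G = G - (A0 * G + A1 * (G * G))"
    by (simp add: minus_mult_distrib_mat[of _ m m _ _ m] add_mult_distrib_mat[of _ m m _ _ m]
        assoc_mult_mat[of _ m m _ m _ m])
  also have "\<dots> = Am + (A0 * G + A1 * (G * G)) - (A0 * G + A1 * (G * G))"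
    using G_eq assoc_add_mat[of Am m m "A0 * G" "A1 * (G * G)"] by simp
  also have "\<dots> = Am" by (intro eq_matI) auto
  finally show ?thesis ..
qed

text \<open>
  Let \<open>N = (I - U)\<^sup>-\<^sup>1 \<ge> 0\<close> and \<open>V = A0 + R Am\<close>.  Then \<open>A1 N\<close> solves the equation of \<open>R\<close>, so \<open>R \<le> A1 N\<close>
  and \<open>V \<le> U\<close>.  In particular \<open>V\<close> is transient, and \<open>(I - V)\<^sup>-\<^sup>1 Am\<close> is a nonnegative solution of the
  equation of \<open>G\<close>.  Minimality of \<open>G\<close> now gives \<open>U \<le> V\<close>.
\<close>

lemma R_factor:
  assumes R_min: "minimal_nonneg_solution m (\<lambda>X. A1 + X * (A0 - 1\<^sub>m m) + X * X * Am) R"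
  shows "R \<in> carrier_mat m m" "A0 + R * Am = U" "A1 = R * (1\<^sub>m m - U)"
proof -
  have R[simp]: "R \<in> carrier_mat m m" and R_nonneg: "0\<^sub>m m m \<le> R"
    and R_eq: "A1 + R * (A0 - 1\<^sub>m m) + R * R * Am = 0\<^sub>m m m"
    and R_least: "\<And>Y. Y \<in> carrier_mat m m \<Longrightarrow> 0\<^sub>m m m \<le> Y \<Longrightarrow>
      A1 + Y * (A0 - 1\<^sub>m m) + Y * Y * Am = 0\<^sub>m m m \<Longrightarrow> R \<le> Y"
    using R_min by (auto simp: minimal_nonneg_solution_def)
  have eq: "Y * (1\<^sub>m m - (A0 + Y * Am)) = A1 \<longleftrightarrow> A1 + Y * (A0 - 1\<^sub>m m) + Y * Y * Am = 0\<^sub>m m m"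
    if Y[simp]: "Y \<in> carrier_mat m m" for Y
  proof -
    have dims: "dim_row Y = m" "dim_col Y = m" by (fact carrier_matD[OF Y])+
    have "A1 + Y * (A0 - 1\<^sub>m m) + Y * Y * Am = A1 - Y * (1\<^sub>m m - (A0 + Y * Am))"
      by (simp add: mult_minus_distrib_mat[of _ m m _ m] mult_add_distrib_mat[of _ m m _ m]
        assoc_mult_mat[of _ m m _ m _ m]) (intro eq_matI; simp add: dims)
    moreover have "A1 - Z = 0\<^sub>m m m \<longleftrightarrow> Z = A1" if "Z \<in> carrier_mat m m" for Z
    proof
      assume "A1 - Z = 0\<^sub>m m m"
      then have "(A1 - Z) $$ (i, j) = 0" if "i < m" "j < m" for i j using that by simp
      then show "Z = A1" using that by (intro eq_matI) auto
    qed auto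
    ultimately show ?thesis by simp
  qed
  obtain N where N[simp]: "N \<in> carrier_mat m m" and N_inv: "(1\<^sub>m m - U) * N = 1\<^sub>m m" "N * (1\<^sub>m m - U) = 1\<^sub>m m"
    and N_nonneg: "0\<^sub>m m m \<le> N"
    using transient_inverse[OF U_transient] .
  have G_N: "N * Am = G"
    using arg_cong[OF Am_factor, of "\<lambda>Z. N * Z"] assoc_mult_mat[of N m m "1\<^sub>m m - U" m G m]
    by (simp add: N_inv)
  have "R \<le> A1 * N"
  proof (rule R_least)
    show "0\<^sub>m m m \<le> A1 * N" by (rule mat_mult_nonneg[of _ m m]) (simp_all add: A1_nonneg N_nonneg)
    have "A1 * N * Am = A1 * G" by (simp add: assoc_mult_mat[of _ m m _ m _ m] G_N)
    then have "A1 * N * (1\<^sub>m m - (A0 + A1 * N * Am)) = A1"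
      by (simp add: assoc_mult_mat[of _ m m _ m _ m] N_inv)
    then show "A1 + A1 * N * (A0 - 1\<^sub>m m) + A1 * N * (A1 * N) * Am = 0\<^sub>m m m"
      by (subst eq[symmetric]) auto
  qed simp
  then have "R * Am \<le> A1 * N * Am"
    by (intro mat_mult_mono[of _ m m _ m] R_nonneg Am_nonneg) auto
  also have "A1 * N * Am = A1 * G" by (simp add: assoc_mult_mat[of _ m m _ m _ m] G_N)
  finally have V_le: "A0 + R * Am \<le> U"
    by (intro mat_add_mono) (auto simp: carrier_matD[OF R])
  define V where "V = A0 + R * Am"
  have V[simp]: "V \<in> carrier_mat m m" by (simp add: V_def)
  have "0\<^sub>m m m \<le> V" unfolding V_def
    by (intro mat_add_nonneg mat_mult_nonneg[of _ m m] A0_nonneg R_nonneg Am_nonneg) auto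
  then have "transient m V" using V_le by (intro transient_mono[OF U_transient]) (auto simp: V_def)
  from transient_inverse[OF this] obtain T where T[simp]: "T \<in> carrier_mat m m"
    and T_inv: "(1\<^sub>m m - V) * T = 1\<^sub>m m" "T * (1\<^sub>m m - V) = 1\<^sub>m m" and T_nonneg: "0\<^sub>m m m \<le> T" .
  have R_V: "R * (1\<^sub>m m - V) = A1" using R_eq eq[OF R] by (simp add: V_def)
  then have R_T: "A1 * T = R" 
    using assoc_mult_mat[of R m m "1\<^sub>m m - V" m T m] 
    by (simp add: T_inv right_mult_one_mat[of _ m m])
  have TAm_nonneg: "0\<^sub>m m m \<le> T * Am" by (rule mat_mult_nonneg[of _ m m]) (simp_all add: T_nonneg Am_nonneg)
  have V_TAm: "V = A0 + A1 * (T * Am)"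
    unfolding V_def R_T[symmetric] by (simp add: assoc_mult_mat[of _ m m _ m _ m])
  have "(1\<^sub>m m - V) * (T * Am) = Am"
    using T_inv by (simp add: assoc_mult_mat[of _ m m _ m _ m, symmetric])
  then have TAm: "T * Am - V * (T * Am) = Am"
    by (simp add: minus_mult_distrib_mat[of _ m m _ _ m] left_mult_one_mat[of _ m m])
  have "Am + A0 * (T * Am) + A1 * (T * Am * (T * Am)) = T * Am"
  proof -
    have "V * (T * Am) = A0 * (T * Am) + A1 * (T * Am * (T * Am))"
      by (subst V_TAm) (simp add: add_mult_distrib_mat[of _ m m _ _ m] assoc_mult_mat[of _ m m _ m _ m])
    then have "Am + A0 * (T * Am) + A1 * (T * Am * (T * Am)) = Am + V * (T * Am)"
      by (simp add: assoc_add_mat[of _ m m])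
    also have "\<dots> = (T * Am - V * (T * Am)) + V * (T * Am)" by (simp only: TAm)
    also have "\<dots> = T * Am" using carrier_matD[OF V] carrier_matD[OF T] by (intro eq_matI) auto
    finally show ?thesis .
  qed
  then have "G \<le> T * Am" using TAm_nonneg by (intro G_least) auto
  then have "A1 * G \<le> A1 * (T * Am)"
    by (intro mat_mult_mono[of _ m m _ m] A1_nonneg G_nonneg) auto
  then have "U \<le> V" unfolding V_TAm by (intro mat_add_mono) (auto simp: carrier_matD[OF T])
  with V_le have "V = U" unfolding V_def by (intro antisym)
  then show "R \<in> carrier_mat m m" "A0 + R * Am = U" "A1 = R * (1\<^sub>m m - U)"
    using R_V by (simp_all add: V_def[symmetric])
qed

end

section \<open>Harmonic functions of the phase process and of the doubly infinite chain\<close>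

locale qbd =
  fixes m :: nat and B Am A0 A1 :: "real mat"
  assumes m: "m \<ge> 1"
    and B[simp]: "B \<in> carrier_mat m m" and Am[simp]: "Am \<in> carrier_mat m m"
    and A0[simp]: "A0 \<in> carrier_mat m m" and A1[simp]: "A1 \<in> carrier_mat m m"
    and B_nonneg: "0\<^sub>m m m \<le> B" and Am_nonneg: "0\<^sub>m m m \<le> Am"
    and A0_nonneg: "0\<^sub>m m m \<le> A0" and A1_nonneg: "0\<^sub>m m m \<le> A1"
    and stochastic: "row_stochastic (qbd_states m) (qbd_kernel m B Am A0 A1)"
    and irreducible_P: "irreducible_on (qbd_states m) (qbd_kernel m B Am A0 A1)"
    and irreducible_A: "irreducible_on {..<m} (\<lambda>a b. (Am + A0 + A1) $$ (a, b))"
    and final: "single_final_class m Am A0 A1"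
begin

declare carrier_matD[OF B, simp] carrier_matD[OF Am, simp]
  carrier_matD[OF A0, simp] carrier_matD[OF A1, simp]

lemma inner_row_sum:
  assumes "a < m"
  shows "(\<Sum>b<m. Am $$ (a, b)) + (\<Sum>b<m. A0 $$ (a, b)) + (\<Sum>b<m. A1 $$ (a, b)) = 1"
proof -
  have "((\<lambda>y. qbd_kernel m B Am A0 A1 (Suc 0, a) y) has_sum 1) (qbd_states m)"
    using stochastic assms unfolding row_stochastic_def qbd_states_def by blast
  with qbd_has_sum_Suc[OF assms, of B Am A0 A1 0 "\<lambda>_. 1 :: real"] show ?thesis
    by (simp add: has_sum_unique)
qed

lemma row_sums: "Am *\<^sub>v ones m + A0 *\<^sub>v ones m + A1 *\<^sub>v ones m = ones m"
  by (intro eq_vecI) (use inner_row_sum in \<open>auto simp: mat_vec_entry\<close>)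

lemma nonneg_entries:
  "a < m \<Longrightarrow> b < m \<Longrightarrow> 0 \<le> B $$ (a, b)" "a < m \<Longrightarrow> b < m \<Longrightarrow> 0 \<le> Am $$ (a, b)"
  "a < m \<Longrightarrow> b < m \<Longrightarrow> 0 \<le> A0 $$ (a, b)" "a < m \<Longrightarrow> b < m \<Longrightarrow> 0 \<le> A1 $$ (a, b)"
  using B_nonneg Am_nonneg A0_nonneg A1_nonneg by (auto simp: less_eq_mat_def)

lemma phase_stochastic: "row_stochastic {..<m} (\<lambda>a b. (Am + A0 + A1) $$ (a, b))"
  unfolding row_stochastic_def
  using nonneg_entries inner_row_sum by (auto simp: has_sum_finite_iff sum.distrib)

lemma subharmonic_const:
  assumes "\<And>a. a < m \<Longrightarrow> f a \<le> (\<Sum>b<m. Am $$ (a, b) * f b) + (\<Sum>b<m. A0 $$ (a, b) * f b)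
      + (\<Sum>b<m. A1 $$ (a, b) * f b)"
    and "a < m" "b < m"
  shows "f a = f b"
proof (rule stochastic_fixed_const[OF phase_stochastic irreducible_A _ assms(2,3)])
  fix a assume "a < m"
  then show "f a \<le> (\<Sum>b<m. (Am + A0 + A1) $$ (a, b) * f b)"
    using assms(1)[of a] by (simp add: distrib_right sum.distrib)
qed

lemma dqbd_stochastic: "row_stochastic (dqbd_states m) (dqbd_kernel Am A0 A1)"
  unfolding row_stochastic_def
proof (intro conjI ballI)
  fix x assume x: "x \<in> dqbd_states m"
  then obtain n a where na: "x = (n, a)" "a < m" by (auto simp: dqbd_states_def)
  show "0 \<le> dqbd_kernel Am A0 A1 x y" if "y \<in> dqbd_states m" for y
    using na that nonneg_entries by (auto simp: dqbd_states_def dqbd_kernel_def)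
  show "(dqbd_kernel Am A0 A1 x has_sum 1) (dqbd_states m)"
    using dqbd_has_sum[OF na(2), of Am A0 A1 n "\<lambda>_. 1 :: real"] inner_row_sum[OF na(2)] na(1)
    by simp
qed

text \<open>
  The final class contains both \<open>(0, a)\<close> and \<open>(1, a)\<close>; this excludes periodic behaviour of the levels.
\<close>

lemma level_translation_reachable:
  obtains a where "a < m"
    "((0, a), (1, a)) \<in> (transition_graph (dqbd_states m) (dqbd_kernel Am A0 A1))\<^sup>*"
proof -
  from final obtain C where C: "C \<subseteq> {..<m}" "C \<noteq> {}"
    "final_class (dqbd_states m) (dqbd_kernel Am A0 A1) (UNIV \<times> C)"
    unfolding single_final_class_def by blast
  then obtain a where a: "a \<in> C" by blast
  with C have "a < m" by auto
  moreover from C(3) a have "((0, a), (1, a)) \<in> (transition_graph (dqbd_states m) (dqbd_kernel Am A0 A1))\<^sup>*"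
    using \<open>a < m\<close> unfolding final_class_def by (auto simp: dqbd_states_def)
  ultimately show ?thesis using that by blast
qed

lemma Re_complex_of_real_mult: "Re (of_real r * z) = r * Re z"
  by simp

text \<open>
  With \<open>l\<close> of modulus \<open>1\<close> the function \<open>f(n, b) = l\<^sup>n x b\<close> is bounded and harmonic on the doubly infinite
  chain, and its modulus is constant because \<open>Am + A0 + A1\<close> is irreducible.  The real part of
  \<open>f\<close> rotated by the conjugate of \<open>f(0, c)\<close> is maximal at \<open>(0, c)\<close>, hence takes the same value at \<open>(1, c)\<close>,
  which forces \<open>Re l = 1\<close>.
\<close>

lemma unimodular_root:
  fixes x :: "nat \<Rightarrow> complex"
  assumes eq: "\<And>a. a < m \<Longrightarrow> (\<Sum>b<m. of_real (Am $$ (a, b)) * x b) + l * (\<Sum>b<m. of_real (A0 $$ (a, b)) * x b)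
      + l\<^sup>2 * (\<Sum>b<m. of_real (A1 $$ (a, b)) * x b) = l * x a"
    and l: "cmod l = 1" and nz: "a < m" "x a \<noteq> 0"
  shows "l = 1"
proof -
  have l0: "l \<noteq> 0" using l by auto
  have "cmod (x a) \<le> (\<Sum>b<m. Am $$ (a, b) * cmod (x b)) + (\<Sum>b<m. A0 $$ (a, b) * cmod (x b))
      + (\<Sum>b<m. A1 $$ (a, b) * cmod (x b))" if a: "a < m" for a
  proof -
    have bd: "cmod (\<Sum>b<m. of_real (D $$ (a, b)) * x b) \<le> (\<Sum>b<m. D $$ (a, b) * cmod (x b))"
      if "\<And>b. b < m \<Longrightarrow> 0 \<le> D $$ (a, b)" for D :: "real mat"
      by (rule order_trans[OF norm_sum]) (use that in \<open>auto intro!: sum_mono simp: norm_mult\<close>)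
    have "cmod (x a) = cmod (l * x a)" using l by (simp add: norm_mult)
    also have "\<dots> \<le> cmod (\<Sum>b<m. of_real (Am $$ (a, b)) * x b) + cmod (\<Sum>b<m. of_real (A0 $$ (a, b)) * x b)
        + cmod (\<Sum>b<m. of_real (A1 $$ (a, b)) * x b)"
      unfolding eq[OF a, symmetric]
      by (rule order_trans[OF norm_triangle_ineq] add_mono order_refl)+
        (simp_all add: norm_mult norm_power l)
    also have "\<dots> \<le> (\<Sum>b<m. Am $$ (a, b) * cmod (x b)) + (\<Sum>b<m. A0 $$ (a, b) * cmod (x b))
      + (\<Sum>b<m. A1 $$ (a, b) * cmod (x b))"
      by (intro add_mono bd nonneg_entries a)
    finally show ?thesis .
  qed
  then have const: "cmod (x b) = cmod (x b')" if "b < m" "b' < m" for b b'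
    using subharmonic_const[of "\<lambda>b. cmod (x b)"] that by blast
  from level_translation_reachable obtain c where c: "c < m"
    "((0, c), (1, c)) \<in> (transition_graph (dqbd_states m) (dqbd_kernel Am A0 A1))\<^sup>*" .
  define h where "h = (\<lambda>(n :: int, b). Re (cnj (x c) * (l powi n * x b)))"
  have "h (1, c) = h (0, c)"
  proof (rule max_principle[where f = h and z = "(0, c)", OF dqbd_stochastic _ _ _ c(2)])
    fix s assume "s \<in> dqbd_states m"
    then obtain n b where s: "s = (n, b)" "b < m" by (auto simp: dqbd_states_def)
    have "h (n, b) \<le> cmod (cnj (x c) * (l powi n * x b))"
      unfolding h_def by (simp only: prod.case complex_Re_le_cmod)
    also have "\<dots> = cmod (x c) * cmod (x b)" by (simp add: norm_mult norm_power_int l)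
    also have "\<dots> = cmod (x c) * cmod (x c)" using const[OF s(2) c(1)] by simp
    also have "\<dots> = h (0, c)"
      by (simp add: h_def cmod_power2 flip: power2_eq_square)
    finally show "h s \<le> h (0, c)" using s by simp
    let ?sum = "\<lambda>D k. \<Sum>d<m. D $$ (b, d) * h (k, d)"
    have Re_sum: "?sum D k = Re (cnj (x c) * l powi k * (\<Sum>d<m. of_real (D $$ (b, d)) * x d))"
      for D :: "real mat" and k
    proof -
      have "cnj (x c) * l powi k * (\<Sum>d<m. of_real (D $$ (b, d)) * x d) =
          (\<Sum>d<m. of_real (D $$ (b, d)) * (cnj (x c) * (l powi k * x d)))"
        by (simp add: sum_distrib_left mult_ac)
      then show ?thesis by (simp only: Re_sum h_def prod.case Re_complex_of_real_mult)
    qed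
    have "h (n, b) = Re (cnj (x c) * l powi (n - 1) * (l * x b))"
      using l0 by (simp add: h_def power_int_diff mult_ac)
    also have "\<dots> = ?sum Am (n - 1) + ?sum A0 n + ?sum A1 (n + 1)"
      unfolding eq[OF s(2), symmetric] Re_sum plus_complex.sel[symmetric]
      using l0 by (intro arg_cong[of _ _ Re]) (simp add: power_int_diff power_int_add field_simps power2_eq_square)
    finally have "h (n, b) = ?sum Am (n - 1) + ?sum A0 n + ?sum A1 (n + 1)" .
    then show "\<exists>t. ((\<lambda>y. dqbd_kernel Am A0 A1 s y * h y) has_sum t) (dqbd_states m) \<and> h s \<le> t"
      using dqbd_has_sum[OF s(2), of Am A0 A1 n h] s(1) by auto
  qed (use c in \<open>auto simp: dqbd_states_def\<close>)
  then have "Re (cnj (x c) * (l powi 1 * x c)) = Re (cnj (x c) * (l powi 0 * x c))"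
    by (simp only: h_def prod.case)
  then have "Re (l * (x c * cnj (x c))) = Re (x c * cnj (x c))"
    by (simp only: power_int_1_right power_int_0_right mult_1_left mult_ac)
  then have "Re (l * complex_of_real ((cmod (x c))\<^sup>2)) = Re (complex_of_real ((cmod (x c))\<^sup>2))"
    by (simp only: complex_norm_square)
  then have "(cmod (x c))\<^sup>2 * Re l = (cmod (x c))\<^sup>2"
    by (simp only: mult.commute[of l] Re_complex_of_real_mult Re_complex_of_real)
  moreover have "cmod (x c) \<noteq> 0" using const[OF c(1) nz(1)] nz(2) by simp
  ultimately have "Re l = 1" by simp
  moreover from this have "Im l = 0" using l by (simp add: cmod_def)
  ultimately show ?thesis by (simp add: complex_eq_iff)
qed

end

section \<open>Stochastic matrices and rank-one matrices\<close>

abbreviation cones :: "nat \<Rightarrow> complex vec" where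
  "cones n \<equiv> vec n (\<lambda>_. 1)"

text \<open>
  Evaluate the eigenvalue equation at an entry of maximal modulus.
\<close>

lemma stochastic_eigenvalue_le:
  fixes X :: "real mat"
  assumes X: "X \<in> carrier_mat m m" "0\<^sub>m m m \<le> X" "X *\<^sub>v ones m = ones m"
    and z: "z \<in> carrier_vec m" "z \<noteq> 0\<^sub>v m" "cmat X *\<^sub>v z = l \<cdot>\<^sub>v z"
  shows "cmod l \<le> 1"
proof -
  have nonneg: "0 \<le> X $$ (a, b)" if "a < m" "b < m" for a b
    using X that by (auto simp: less_eq_mat_def)
  have row: "(\<Sum>b<m. X $$ (a, b)) = 1" if "a < m" for a
    using arg_cong[OF X(3), of "\<lambda>v. v $ a"] that X(1) by (simp add: mat_vec_entry)
  from z obtain a0 where a0: "a0 < m" "z $ a0 \<noteq> 0" by (metis carrier_vecD eq_vecI index_zero_vec)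
  have "finite ((\<lambda>a. cmod (z $ a)) ` {..<m})" "(\<lambda>a. cmod (z $ a)) ` {..<m} \<noteq> {}" using a0 by auto
  from Max_in[OF this] obtain a where a: "a < m" "cmod (z $ a) = Max ((\<lambda>a. cmod (z $ a)) ` {..<m})" by force
  have mx: "cmod (z $ b) \<le> cmod (z $ a)" if "b < m" for b using that a(2) by simp
  have pos: "0 < cmod (z $ a)" using mx[OF a0(1)] a0(2) by (meson le_less_trans less_le_trans zero_less_norm_iff)
  have "cmod l * cmod (z $ a) = cmod ((cmat X *\<^sub>v z) $ a)" using z a by (simp add: norm_mult)
  also have "\<dots> \<le> (\<Sum>b<m. X $$ (a, b) * cmod (z $ b))"
    using X(1) z(1) a(1) by (auto simp: mat_vec_entry norm_mult nonneg intro!: order_trans[OF norm_sum] sum_mono)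
  also have "\<dots> \<le> (\<Sum>b<m. X $$ (a, b) * cmod (z $ a))"
    by (intro sum_mono mult_left_mono) (auto simp: mx nonneg a)
  also have "\<dots> = cmod (z $ a)" using row[OF a(1)] by (simp add: sum_distrib_right[symmetric])
  finally show ?thesis using pos by simp
qed

lemma stochastic_drift_le:
  fixes f :: "nat \<Rightarrow> real"
  assumes m: "0 < m" and nonneg: "\<And>a b. a < m \<Longrightarrow> b < m \<Longrightarrow> 0 \<le> X $$ (a, b)"
    and row: "\<And>a. a < m \<Longrightarrow> (\<Sum>b<m. X $$ (a, b)) = 1"
    and f: "\<And>a. a < m \<Longrightarrow> (\<Sum>b<m. X $$ (a, b) * f b) = f a + d"
  shows "d \<le> 0"
proof -
  have "finite (f ` {..<m})" "f ` {..<m} \<noteq> {}" using m by auto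
  from Max_in[OF this] obtain a where a: "a < m" "f a = Max (f ` {..<m})" by force
  have mx: "f b \<le> f a" if "b < m" for b using that a(2) by simp
  have "f a + d \<le> (\<Sum>b<m. X $$ (a, b) * f a)"
    unfolding f[OF a(1), symmetric] by (intro sum_mono mult_left_mono) (auto simp: mx nonneg a)
  also have "\<dots> = f a" using row[OF a(1)] by (simp add: sum_distrib_right[symmetric])
  finally show ?thesis by simp
qed

text \<open>
  There is no Jordan chain above the all-ones vector: a real solution of \<open>X f = f + d 1\<close> shows
  \<open>d \<le> 0\<close> at its maximum and \<open>d \<ge> 0\<close> at its minimum.
\<close>

lemma stochastic_no_drift:
  fixes X :: "real mat"
  assumes m: "0 < m" and X: "X \<in> carrier_mat m m" "0\<^sub>m m m \<le> X" "X *\<^sub>v ones m = ones m"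
    and z: "z \<in> carrier_vec m" "cmat X *\<^sub>v z = z + d \<cdot>\<^sub>v cones m"
  shows "d = 0"
proof -
  have nonneg: "0 \<le> X $$ (a, b)" if "a < m" "b < m" for a b
    using X that by (auto simp: less_eq_mat_def)
  have row: "(\<Sum>b<m. X $$ (a, b)) = 1" if "a < m" for a
    using arg_cong[OF X(3), of "\<lambda>v. v $ a"] that X(1) by (simp add: mat_vec_entry)
  have eq: "(\<Sum>b<m. of_real (X $$ (a, b)) * z $ b) = z $ a + d" if "a < m" for a
    using arg_cong[OF z(2), of "\<lambda>v. v $ a"] that X(1) z(1) by (simp add: mat_vec_entry)
  have re: "(\<Sum>b<m. X $$ (a, b) * Re (z $ b)) = Re (z $ a) + Re d" if "a < m" for a
    using arg_cong[OF eq[OF that], of Re] by simp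
  have im: "(\<Sum>b<m. X $$ (a, b) * Im (z $ b)) = Im (z $ a) + Im d" if "a < m" for a
    using arg_cong[OF eq[OF that], of Im] by simp
  have "Re d \<le> 0" by (rule stochastic_drift_le[OF m nonneg row re])
  moreover have "- Re d \<le> 0"
    by (rule stochastic_drift_le[OF m nonneg row, where f = "\<lambda>b. - Re (z $ b)"]) (simp_all add: sum_negf re)
  moreover have "Im d \<le> 0" by (rule stochastic_drift_le[OF m nonneg row im])
  moreover have "- Im d \<le> 0"
    by (rule stochastic_drift_le[OF m nonneg row, where f = "\<lambda>b. - Im (z $ b)"]) (simp_all add: sum_negf im)
  ultimately show ?thesis by (simp add: complex_eq_iff)
qed

lemma outer_prod_carrier [simp]:
  "outer_prod x y \<in> carrier_mat (dim_vec x) (dim_vec y)"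
  by (simp add: outer_prod_def)

lemma outer_prod_mult_vec:
  fixes x y z :: "'a :: comm_semiring_0 vec"
  assumes "y \<in> carrier_vec n" "z \<in> carrier_vec n"
  shows "outer_prod x y *\<^sub>v z = (y \<bullet> z) \<cdot>\<^sub>v x"
  using assms by (intro eq_vecI)
    (auto simp: outer_prod_def mat_vec_entry scalar_prod_def atLeast0LessThan sum_distrib_left mult_ac)

lemma cmat_outer_prod: "cmat (outer_prod x y) = outer_prod (cvec x) (cvec y)"
  by (intro eq_matI) (auto simp: outer_prod_def)

lemma mat_inv_inverse:
  fixes X :: "'a :: field mat"
  assumes X: "X \<in> carrier_mat n n" and Y: "Y \<in> carrier_mat n n" "X * Y = 1\<^sub>m n"
  shows "mat_inv X = Y"
proof -
  have "Y * X = 1\<^sub>m n" by (rule mat_mult_left_right_inverse[OF X Y])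
  then have "X \<in> Units (ring_mat TYPE('a) n ())"
    using X Y by (auto simp: Units_def ring_mat_simps)
  then obtain Z where Z: "mat_inverse X = Some Z" using mat_inverse(1)[OF X, where b = "()"] by (cases "mat_inverse X") auto
  from mat_inverse(2)[OF X Z] have "Z * X = 1\<^sub>m n" "Z \<in> carrier_mat n n" by auto
  then have "Z = Y" using assoc_mult_mat[of Z n n X n Y n] X Y by simp
  then show ?thesis using Z by (simp add: mat_inv_def)
qed

context qbd
begin

lemma harmonic_vec_const:
  assumes z: "z \<in> carrier_vec m" and eq: "Am *\<^sub>v z + A0 *\<^sub>v z + A1 *\<^sub>v z = z"
  shows "z = (z $ 0) \<cdot>\<^sub>v ones m"
proof (rule eq_vecI)
  fix a assume "a < dim_vec ((z $ 0) \<cdot>\<^sub>v ones m)"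
  then have a: "a < m" by simp
  have "z $ a = z $ 0"
  proof (rule subharmonic_const[OF _ a])
    fix a assume a: "a < m"
    then show "z $ a \<le> (\<Sum>b<m. Am $$ (a, b) * z $ b) + (\<Sum>b<m. A0 $$ (a, b) * z $ b)
      + (\<Sum>b<m. A1 $$ (a, b) * z $ b)"
      using arg_cong[OF eq, of "\<lambda>v. v $ a"] z by (simp add: mat_vec_entry)
  qed (use m in simp)
  then show "z $ a = ((z $ 0) \<cdot>\<^sub>v ones m) $ a" using a by simp
qed (use z in simp)

lemma complex_harmonic_vec_const:
  assumes z: "z \<in> carrier_vec m" and eq: "cmat Am *\<^sub>v z + cmat A0 *\<^sub>v z + cmat A1 *\<^sub>v z = z"
  shows "z = (z $ 0) \<cdot>\<^sub>v cones m"
proof (rule eq_vecI)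
  fix a assume "a < dim_vec ((z $ 0) \<cdot>\<^sub>v cones m)"
  then have a: "a < m" by simp
  have ent: "(\<Sum>b<m. of_real (Am $$ (a, b)) * z $ b) + (\<Sum>b<m. of_real (A0 $$ (a, b)) * z $ b)
      + (\<Sum>b<m. of_real (A1 $$ (a, b)) * z $ b) = z $ a" if "a < m" for a
    using arg_cong[OF eq, of "\<lambda>v. v $ a"] z that by (simp add: mat_vec_entry)
  have "Re (z $ a) = Re (z $ 0)"
    by (rule subharmonic_const[OF _ a, where f = "\<lambda>a. Re (z $ a)"])
      (use m arg_cong[OF ent, of _ Re] in auto)
  moreover have "Im (z $ a) = Im (z $ 0)"
    by (rule subharmonic_const[OF _ a, where f = "\<lambda>a. Im (z $ a)"])
      (use m arg_cong[OF ent, of _ Im] in auto)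
  ultimately show "z $ a = ((z $ 0) \<cdot>\<^sub>v cones m) $ a" using a by (simp add: complex_eq_iff)
qed (use z in simp)

end

section \<open>The right shift\<close>

lemma neg_inverse:
  fixes X Y :: "'a :: field mat"
  assumes "X \<in> carrier_mat n n" "Y \<in> carrier_mat n n" "(1\<^sub>m n - X) * Y = 1\<^sub>m n"
  shows "(X - 1\<^sub>m n) * - Y = 1\<^sub>m n"
proof -
  have "(X - 1\<^sub>m n) * - Y = (1\<^sub>m n - X) * Y"
    using assms(1,2) by (simp add: minus_mult_distrib_mat[of _ n n _ _ n]) (intro eq_matI; auto)
  with assms(3) show ?thesis by simp
qed

lemma add3_swap:
  fixes x y z :: "'a :: ab_group_add vec"
  assumes "x \<in> carrier_vec n" "y \<in> carrier_vec n" "z \<in> carrier_vec n"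
  shows "x + y + z = z + y + x"
  using assms by (intro eq_vecI) auto

text \<open>
  In the null recurrent case both \<open>G\<close> and \<open>Gh\<close> are stochastic; this enters through the
  eigenvectors \<open>wG\<close> and \<open>vGh\<close> for the eigenvalue \<open>1\<close>.
\<close>

locale shifted_qbd = qbd +
  fixes G Gh R Rh U Hh Q Gt Gdd :: "real mat" and wG vGh wRh :: "real vec"
  assumes G_min: "minimal_nonneg_solution m (\<lambda>X. Am + (A0 - 1\<^sub>m m) * X + A1 * (X * X)) G"
    and Gh_min: "minimal_nonneg_solution m (\<lambda>X. A1 + (A0 - 1\<^sub>m m) * X + Am * (X * X)) Gh"
    and R_min: "minimal_nonneg_solution m (\<lambda>X. A1 + X * (A0 - 1\<^sub>m m) + X * X * Am) R"
    and Rh_min: "minimal_nonneg_solution m (\<lambda>X. Am + X * (A0 - 1\<^sub>m m) + X * X * A1) Rh"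
    and U_R: "U = A0 + R * Am"
    and Hh: "Hh = A0 - 1\<^sub>m m + Am * Gh"
    and wG_ev: "eigenvector G wG 1"
    and vGh_ev: "eigenvector (transpose_mat Gh) vGh 1"
    and wRh_ev: "eigenvector Rh wRh 1"
    and normalization: "vGh \<bullet> wG = 1" "vGh \<bullet> (mat_inv Hh *\<^sub>v wRh) = -1"
    and Q: "Q = outer_prod wG vGh"
    and Gt: "Gt = G - Q"
    and Gdd: "Gdd = Gh + outer_prod (wG + mat_inv Hh *\<^sub>v wRh) vGh"
begin

lemmas square_simps =
  add_mult_distrib_mat_vec[of _ m m] mult_add_distrib_mat_vec[of _ m m]
  minus_mult_distrib_mat_vec[of _ m m] mult_minus_distrib_mat_vec[of _ m m]
  assoc_mult_mat_vec[of _ m m _ m] mult_mat_vec[of _ m m]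

lemma G[simp]: "G \<in> carrier_mat m m" and G_eq: "Am + A0 * G + A1 * (G * G) = G"
  using G_min by (auto simp: minimal_nonneg_solution_def riccati_fixed_point)

lemma Gh[simp]: "Gh \<in> carrier_mat m m" and Gh_eq: "A1 + A0 * Gh + Am * (Gh * Gh) = Gh"
  using Gh_min by (auto simp: minimal_nonneg_solution_def riccati_fixed_point)

lemma wG[simp]: "wG \<in> carrier_vec m" and G_wG: "G *\<^sub>v wG = wG" and wG_nz: "wG \<noteq> 0\<^sub>v m"
  using wG_ev carrier_matD[OF G] by (auto simp: eigenvector_def)

lemma vGh[simp]: "vGh \<in> carrier_vec m" and Gh_vGh: "transpose_mat Gh *\<^sub>v vGh = vGh"
  using vGh_ev carrier_matD[OF Gh] by (auto simp: eigenvector_def)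

lemma solution_vec: "z \<in> carrier_vec m \<Longrightarrow> X \<in> carrier_mat m m \<Longrightarrow> D \<in> carrier_mat m m \<Longrightarrow> E \<in> carrier_mat m m
    \<Longrightarrow> F \<in> carrier_mat m m \<Longrightarrow> D + E * X + F * (X * X) = X \<Longrightarrow>
    D *\<^sub>v z + E *\<^sub>v (X *\<^sub>v z) + F *\<^sub>v (X *\<^sub>v (X *\<^sub>v z)) = X *\<^sub>v z"
  by (drule arg_cong[of _ _ "\<lambda>Y. Y *\<^sub>v z"]) (simp add: square_simps assoc_add_vec[of _ m])

text \<open>
  Both \<open>G\<close> and \<open>Gh\<close> have row sums \<open>1\<close>: a fixed vector of either is harmonic for the irreducible phase
  process by the quadratic equation, hence constant.
\<close>

lemma ones_from_eigenvector:
  assumes X: "X \<in> carrier_mat m m" and z: "z \<in> carrier_vec m" "z \<noteq> 0\<^sub>v m" "X *\<^sub>v z = z"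
    and eq: "Am *\<^sub>v z + A0 *\<^sub>v z + A1 *\<^sub>v z = z"
  shows "X *\<^sub>v ones m = ones m"
proof -
  have zc: "z = (z $ 0) \<cdot>\<^sub>v ones m" by (rule harmonic_vec_const[OF z(1) eq])
  have nz: "z $ 0 \<noteq> 0"
  proof
    assume "z $ 0 = 0"
    with zc have "z = 0 \<cdot>\<^sub>v ones m" by simp
    also have "\<dots> = 0\<^sub>v m" by (intro eq_vecI) auto
    finally show False using z(2) by simp
  qed
  have "ones m = inverse (z $ 0) \<cdot>\<^sub>v z" using nz by (subst zc) (intro eq_vecI; simp)
  then show ?thesis using X z by (simp add: mult_mat_vec[of _ m m])
qed

lemma harmonic_wG: "Am *\<^sub>v wG + A0 *\<^sub>v wG + A1 *\<^sub>v wG = wG"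
  using solution_vec[OF wG G Am A0 A1 G_eq] by (simp add: G_wG)

lemma wG_const: "wG = (wG $ 0) \<cdot>\<^sub>v ones m"
  by (rule harmonic_vec_const[OF wG harmonic_wG])

lemma G_ones: "G *\<^sub>v ones m = ones m"
  by (rule ones_from_eigenvector[OF G wG wG_nz G_wG harmonic_wG])

lemma Gh_ones: "Gh *\<^sub>v ones m = ones m"
proof -
  have "eigenvalue (transpose_mat Gh) 1" using vGh_ev by (auto simp: eigenvalue_def)
  then have "eigenvalue Gh 1"
    using eigenvalue_root_char_poly[of Gh m] eigenvalue_root_char_poly[of "transpose_mat Gh" m]
      char_poly_transpose_mat[OF Gh] by simp
  then obtain z where z: "z \<in> carrier_vec m" "z \<noteq> 0\<^sub>v m" "Gh *\<^sub>v z = z"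
    using carrier_matD[OF Gh] by (auto simp: eigenvalue_def eigenvector_def)
  have "A1 *\<^sub>v z + A0 *\<^sub>v z + Am *\<^sub>v z = z"
    using solution_vec[OF z(1) Gh A1 A0 Am Gh_eq] by (simp add: z)
  then have "Am *\<^sub>v z + A0 *\<^sub>v z + A1 *\<^sub>v z = z"
    using add3_swap[of "Am *\<^sub>v z" m "A0 *\<^sub>v z" "A1 *\<^sub>v z"] by simp
  from ones_from_eigenvector[OF Gh z this] show ?thesis .
qed

lemma Gh_wG: "Gh *\<^sub>v wG = wG"
  by (subst (1 2) wG_const) (simp add: mult_mat_vec[of _ m m] Gh_ones)

sublocale down: riccati m Am A0 A1 G
  by unfold_locales (auto simp: Am_nonneg A0_nonneg A1_nonneg row_sums G_min G_ones)

sublocale up: riccati m A1 A0 Am Gh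
proof
  show "A1 *\<^sub>v ones m + A0 *\<^sub>v ones m + Am *\<^sub>v ones m = ones m"
    using row_sums add3_swap[of "Am *\<^sub>v ones m" m "A0 *\<^sub>v ones m" "A1 *\<^sub>v ones m"] by simp
qed (auto simp: Am_nonneg A0_nonneg A1_nonneg Gh_min Gh_ones)

abbreviation H where "H \<equiv> U - 1\<^sub>m m"
abbreviation Hi where "Hi \<equiv> mat_inv (U - 1\<^sub>m m)"
abbreviation Hhi where "Hhi \<equiv> mat_inv Hh"

lemma R[simp]: "R \<in> carrier_mat m m" and U_G: "U = A0 + A1 * G" and A1_R: "A1 = R * (1\<^sub>m m - U)"
    and U[simp]: "U \<in> carrier_mat m m"
  using down.R_factor[OF R_min] by (auto simp: U_R[symmetric])

lemma Rh[simp]: "Rh \<in> carrier_mat m m" and Am_Rh: "Am = Rh * (1\<^sub>m m - (A0 + Am * Gh))"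
  using up.R_factor[OF Rh_min] by auto

lemma Hh_alt: "Hh = (A0 + Am * Gh) - 1\<^sub>m m"
  unfolding Hh by (intro eq_matI) (auto simp: carrier_matD[OF Gh])

lemma Hh_c[simp]: "Hh \<in> carrier_mat m m"
  unfolding Hh_alt by simp

lemma Hi[simp]: "Hi \<in> carrier_mat m m" and H_Hi: "H * Hi = 1\<^sub>m m" and Hi_H: "Hi * H = 1\<^sub>m m"
proof -
  obtain N where N: "N \<in> carrier_mat m m" "(1\<^sub>m m - U) * N = 1\<^sub>m m"
    using transient_inverse[OF down.U_transient] unfolding U_G[symmetric] .
  have "H * - N = 1\<^sub>m m" by (rule neg_inverse) (use N in auto)
  moreover from this have "Hi = - N" by (intro mat_inv_inverse[of _ m]) (use N in auto)
  ultimately show H1: "Hi \<in> carrier_mat m m" "H * Hi = 1\<^sub>m m"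
    using N by auto
  then show "Hi * H = 1\<^sub>m m"
    by (intro mat_mult_left_right_inverse[of H m]) auto
qed

lemma Hhi[simp]: "Hhi \<in> carrier_mat m m" and Hh_Hhi: "Hh * Hhi = 1\<^sub>m m"
proof -
  obtain N where N: "N \<in> carrier_mat m m" "(1\<^sub>m m - (A0 + Am * Gh)) * N = 1\<^sub>m m"
    using transient_inverse[OF up.U_transient] .
  have 1: "Hh * - N = 1\<^sub>m m" unfolding Hh_alt by (rule neg_inverse) (use N in auto)
  then have "Hhi = - N" by (intro mat_inv_inverse[of _ m]) (use N in auto)
  then show "Hhi \<in> carrier_mat m m" "Hh * Hhi = 1\<^sub>m m" using N 1 by auto
qed

declare carrier_matD[OF G, simp] carrier_matD[OF Gh, simp] carrier_matD[OF R, simp]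
  carrier_matD[OF Rh, simp] carrier_matD[OF U, simp] carrier_matD[OF Hh_c, simp]
  carrier_matD[OF Hi, simp] carrier_matD[OF Hhi, simp]
  carrier_vecD[OF wG, simp] carrier_vecD[OF vGh, simp]

lemma wRh[simp]: "wRh \<in> carrier_vec m" and Rh_wRh: "Rh *\<^sub>v wRh = wRh"
  using wRh_ev by (auto simp: eigenvector_def)

declare carrier_vecD[OF wRh, simp]

lemma H_G_vec: "z \<in> carrier_vec m \<Longrightarrow> H *\<^sub>v (G *\<^sub>v z) = - (Am *\<^sub>v z)"
  using arg_cong[OF down.Am_factor, of "\<lambda>X. X *\<^sub>v z"]
  by (intro eq_vecI) (auto simp: square_simps U_G[symmetric])

lemma R_H_vec: "z \<in> carrier_vec m \<Longrightarrow> R *\<^sub>v (H *\<^sub>v z) = - (A1 *\<^sub>v z)"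
  using arg_cong[OF A1_R, of "\<lambda>X. X *\<^sub>v z"]
  by (intro eq_vecI) (auto simp: square_simps)

lemma Rh_Hh_vec: "z \<in> carrier_vec m \<Longrightarrow> Rh *\<^sub>v (Hh *\<^sub>v z) = - (Am *\<^sub>v z)"
  using arg_cong[OF Am_Rh, of "\<lambda>X. X *\<^sub>v z"]
  by (intro eq_vecI) (auto simp: square_simps Hh_alt)

lemma Q_c[simp]: "Q \<in> carrier_mat m m"
  unfolding Q using outer_prod_carrier[of wG vGh] by simp

lemma Gt_c[simp]: "Gt \<in> carrier_mat m m"
  unfolding Gt by simp

text \<open>
  The rank-one correction in \<open>Gdd\<close> is \<open>t vGh\<^sup>T\<close>; the two normalizations say that \<open>vGh\<^sup>T t = 0\<close>, which makes
  \<open>vGh\<close> a left eigenvector of \<open>Gdd\<close> for the eigenvalue \<open>1\<close> as well.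
\<close>

definition t where "t = wG + Hhi *\<^sub>v wRh"

lemma t[simp]: "t \<in> carrier_vec m"
  by (simp add: t_def)

declare carrier_vecD[OF t, simp]

lemma Gdd_c[simp]: "Gdd \<in> carrier_mat m m"
  unfolding Gdd using outer_prod_carrier[of t vGh] by (simp add: t_def)

declare carrier_matD[OF Q_c, simp] carrier_matD[OF Gt_c, simp] carrier_matD[OF Gdd_c, simp]

lemma Q_vec: "z \<in> carrier_vec m \<Longrightarrow> Q *\<^sub>v z = (vGh \<bullet> z) \<cdot>\<^sub>v wG"
  unfolding Q by (rule outer_prod_mult_vec[OF vGh])

lemma Gdd_vec: "z \<in> carrier_vec m \<Longrightarrow> Gdd *\<^sub>v z = Gh *\<^sub>v z + (vGh \<bullet> z) \<cdot>\<^sub>v t"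
  using outer_prod_carrier[of t vGh]
  by (simp add: Gdd t_def[symmetric] square_simps outer_prod_mult_vec[OF vGh])

lemma vGh_t: "vGh \<bullet> t = 0"
  unfolding t_def using normalization by (subst scalar_prod_add_distrib[of _ m]) auto

lemma vGh_Gh: "z \<in> carrier_vec m \<Longrightarrow> vGh \<bullet> (Gh *\<^sub>v z) = vGh \<bullet> z"
  using transpose_vec_mult_scalar[of Gh m m z vGh] by (simp add: Gh_vGh)

lemma vGh_Gdd: "z \<in> carrier_vec m \<Longrightarrow> vGh \<bullet> (Gdd *\<^sub>v z) = vGh \<bullet> z"
  by (simp add: Gdd_vec scalar_prod_add_distrib[of _ m] vGh_Gh vGh_t)

end

lemma spectral_radius_cases:
  assumes "X \<in> carrier_mat n n" "0 < n"
  obtains l z where "z \<in> carrier_vec n" "z \<noteq> 0\<^sub>v n" "X *\<^sub>v z = l \<cdot>\<^sub>v z" "spectral_radius X = cmod l"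
  using spectral_radius_mem_max(1)[OF assms] assms(1)
  by (auto simp: spectrum_def eigenvalue_def eigenvector_def)

lemma mat_vec_uminus:
  fixes X :: "'a :: ring mat"
  assumes "X \<in> carrier_mat nr nc" "z \<in> carrier_vec nc"
  shows "X *\<^sub>v (- z) = - (X *\<^sub>v z)"
  using assms by (intro eq_vecI) (auto simp: mat_vec_entry sum_negf)

context shifted_qbd
begin

abbreviation S where "S \<equiv> H * (1\<^sub>m m - Gt * Gdd)"

lemma S[simp]: "S \<in> carrier_mat m m" by simp

text \<open>
  \<open>Gdd\<close> solves the shifted equation.  Beyond the equation of \<open>Gh\<close> there remains the multiple \<open>vGh\<^sup>T z\<close> of
  one vector, \<open>(Hh + Am) t + (A1 - Am) wG\<close>; it vanishes because \<open>Am = - Rh Hh\<close>, \<open>Rh wRh = wRh\<close> and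
  \<open>Gh wG = wG\<close>.
\<close>

lemma shifted_eq:
  assumes z: "z \<in> carrier_vec m"
  shows "A1 *\<^sub>v z + (A0 *\<^sub>v (Gdd *\<^sub>v z) - Gdd *\<^sub>v z + A1 *\<^sub>v (Q *\<^sub>v (Gdd *\<^sub>v z)))
    + (Am *\<^sub>v (Gdd *\<^sub>v (Gdd *\<^sub>v z)) - Am *\<^sub>v (Q *\<^sub>v (Gdd *\<^sub>v (Gdd *\<^sub>v z)))) = 0\<^sub>v m"
proof -
  let ?c = "vGh \<bullet> z"
  let ?y = "Gdd *\<^sub>v z"
  have y: "?y = Gh *\<^sub>v z + ?c \<cdot>\<^sub>v t" using z by (rule Gdd_vec)
  have Gy: "Gdd *\<^sub>v ?y = Gh *\<^sub>v (Gh *\<^sub>v z) + ?c \<cdot>\<^sub>v (Gh *\<^sub>v t) + ?c \<cdot>\<^sub>v t"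
    using z by (simp add: Gdd_vec[of ?y] vGh_Gdd) (simp add: y square_simps)
  have Qy: "Q *\<^sub>v ?y = ?c \<cdot>\<^sub>v wG" "Q *\<^sub>v (Gdd *\<^sub>v ?y) = ?c \<cdot>\<^sub>v wG"
    using z by (simp_all add: Q_vec vGh_Gdd)
  have Gheq: "A1 *\<^sub>v z + A0 *\<^sub>v (Gh *\<^sub>v z) + Am *\<^sub>v (Gh *\<^sub>v (Gh *\<^sub>v z)) = Gh *\<^sub>v z"
    by (rule solution_vec[OF z Gh A1 A0 Am Gh_eq])
  have a: "Hh *\<^sub>v t = Hh *\<^sub>v wG + wRh"
    using arg_cong[OF Hh_Hhi, of "\<lambda>X. X *\<^sub>v wRh"] by (simp add: t_def square_simps)
  have "Rh *\<^sub>v (Hh *\<^sub>v t) = Rh *\<^sub>v (Hh *\<^sub>v wG) + wRh" by (simp add: a square_simps Rh_wRh)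
  then have b: "- (Am *\<^sub>v t) = - (Am *\<^sub>v wG) + wRh" by (simp add: Rh_Hh_vec)
  have Hvec: "Hh *\<^sub>v x = A0 *\<^sub>v x - x + Am *\<^sub>v (Gh *\<^sub>v x)" if "x \<in> carrier_vec m" for x
    using that by (simp add: Hh square_simps)
  have k: "A0 *\<^sub>v t - t + Am *\<^sub>v (Gh *\<^sub>v t) + A1 *\<^sub>v wG + Am *\<^sub>v t - Am *\<^sub>v wG = 0\<^sub>v m"
  proof (rule eq_vecI)
    fix i assume "i < dim_vec (0\<^sub>v m :: real vec)"
    then have i: "i < m" by simp
    note e = arg_cong[of _ _ "\<lambda>v. v $ i"]
    have "(A0 *\<^sub>v t) $ i - t $ i + (Am *\<^sub>v (Gh *\<^sub>v t)) $ i = (Hh *\<^sub>v wG) $ i + wRh $ i"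
      using e[OF a] e[OF Hvec[OF t]] i by simp
    moreover have "- (Am *\<^sub>v t) $ i = - (Am *\<^sub>v wG) $ i + wRh $ i"
      using e[OF b] i by simp
    moreover have "(Hh *\<^sub>v wG) $ i = (A0 *\<^sub>v wG) $ i - wG $ i + (Am *\<^sub>v wG) $ i"
      using e[OF Hvec[OF wG]] i by (simp add: Gh_wG)
    moreover have "(Am *\<^sub>v wG) $ i + (A0 *\<^sub>v wG) $ i + (A1 *\<^sub>v wG) $ i = wG $ i"
      using e[OF harmonic_wG] i by simp
    ultimately show "(A0 *\<^sub>v t - t + Am *\<^sub>v (Gh *\<^sub>v t) + A1 *\<^sub>v wG + Am *\<^sub>v t - Am *\<^sub>v wG) $ i = 0\<^sub>v m $ i"
      using i by simp
  qed simp
  show ?thesis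
  proof (rule eq_vecI)
    fix i assume "i < dim_vec (0\<^sub>v m :: real vec)"
    then have i: "i < m" by simp
    note e = arg_cong[of _ _ "\<lambda>v. v $ i"]
    have "?c * ((A0 *\<^sub>v t) $ i - t $ i + (Am *\<^sub>v (Gh *\<^sub>v t)) $ i + (A1 *\<^sub>v wG) $ i + (Am *\<^sub>v t) $ i - (Am *\<^sub>v wG) $ i) = 0"
      using e[OF k] i by simp
    moreover have "(A1 *\<^sub>v z) $ i + (A0 *\<^sub>v (Gh *\<^sub>v z)) $ i + (Am *\<^sub>v (Gh *\<^sub>v (Gh *\<^sub>v z))) $ i = (Gh *\<^sub>v z) $ i"
      using e[OF Gheq] i by simp
    ultimately show "(A1 *\<^sub>v z + (A0 *\<^sub>v ?y - ?y + A1 *\<^sub>v (Q *\<^sub>v ?y))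
      + (Am *\<^sub>v (Gdd *\<^sub>v ?y) - Am *\<^sub>v (Q *\<^sub>v (Gdd *\<^sub>v ?y)))) $ i = 0\<^sub>v m $ i"
      unfolding Qy unfolding Gy unfolding y using i z
      by (simp add: square_simps algebra_simps)
  qed simp
qed

lemma G_Q_vec: "z \<in> carrier_vec m \<Longrightarrow> G *\<^sub>v (Q *\<^sub>v z) = Q *\<^sub>v z"
  by (simp add: Q_vec square_simps G_wG)

lemma H_Gt_vec: "z \<in> carrier_vec m \<Longrightarrow> H *\<^sub>v (Gt *\<^sub>v z) = - (Am *\<^sub>v z - Am *\<^sub>v (Q *\<^sub>v z))"
proof -
  assume z: "z \<in> carrier_vec m"
  have "H *\<^sub>v (Gt *\<^sub>v z) = H *\<^sub>v (G *\<^sub>v z) - H *\<^sub>v (G *\<^sub>v (Q *\<^sub>v z))"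
    using z by (simp only: G_Q_vec) (simp add: Gt mult_minus_distrib_mat_vec[of _ m m] minus_mult_distrib_mat_vec[of G m m])
  also have "\<dots> = - (Am *\<^sub>v z - Am *\<^sub>v (Q *\<^sub>v z))"
    using z by (simp only: H_G_vec square_mult_vec_carrier[OF Q_c]) (intro eq_vecI; simp)
  finally show ?thesis .
qed

lemma H_vec: "z \<in> carrier_vec m \<Longrightarrow> H *\<^sub>v z = A0 *\<^sub>v z + A1 *\<^sub>v (G *\<^sub>v z) - z"
  by (simp add: U_G square_simps)

lemma S_vec: "z \<in> carrier_vec m \<Longrightarrow> S *\<^sub>v z = H *\<^sub>v (z - Gt *\<^sub>v (Gdd *\<^sub>v z))"
  by (simp add: assoc_mult_mat_vec[of _ m m _ m] minus_mult_distrib_mat_vec[of _ m m])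

text \<open>
  Inserting the factorization into the shifted equation of \<open>Gdd\<close> gives
  \<open>H (I - Gt Gdd) Gdd = R H (I - Gt Gdd)\<close>.
\<close>

lemma S_Gdd: "S * Gdd = R * S"
proof (rule mat_eqI_vec[of _ m m])
  fix z :: "real vec" assume z: "z \<in> carrier_vec m"
  let ?y = "Gdd *\<^sub>v z"
  have y: "?y \<in> carrier_vec m" by simp
  have "(S * Gdd) *\<^sub>v z = H *\<^sub>v (?y - Gt *\<^sub>v (Gdd *\<^sub>v ?y))"
    using S_vec[OF y] z by (simp add: assoc_mult_mat_vec[of S m m _ m])
  also have "\<dots> = H *\<^sub>v ?y - H *\<^sub>v (Gt *\<^sub>v (Gdd *\<^sub>v ?y))"
    by (simp add: mult_minus_distrib_mat_vec[of H m m])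
  finally have 1: "(S * Gdd) *\<^sub>v z = H *\<^sub>v ?y + (Am *\<^sub>v (Gdd *\<^sub>v ?y) - Am *\<^sub>v (Q *\<^sub>v (Gdd *\<^sub>v ?y)))"
    by (simp only: H_Gt_vec square_mult_vec_carrier[OF Gdd_c]) (intro eq_vecI; simp)
  have "(R * S) *\<^sub>v z = R *\<^sub>v (H *\<^sub>v (z - Gt *\<^sub>v ?y))"
    using S_vec[OF z] z by (simp add: assoc_mult_mat_vec[of R m m _ m])
  also have "\<dots> = - (A1 *\<^sub>v (z - Gt *\<^sub>v ?y))" using z by (intro R_H_vec) auto
  also have "\<dots> = - (A1 *\<^sub>v z) + A1 *\<^sub>v (G *\<^sub>v ?y) - A1 *\<^sub>v (Q *\<^sub>v ?y)"
    using z by (simp add: Gt mult_minus_distrib_mat_vec[of _ m m] minus_mult_distrib_mat_vec[of G m m])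
      (intro eq_vecI; simp)
  finally have 2: "(R * S) *\<^sub>v z = - (A1 *\<^sub>v z) + A1 *\<^sub>v (G *\<^sub>v ?y) - A1 *\<^sub>v (Q *\<^sub>v ?y)" .
  show "(S * Gdd) *\<^sub>v z = (R * S) *\<^sub>v z"
    unfolding 1 2 H_vec[OF y]
  proof (rule eq_vecI)
    fix i assume "i < dim_vec (- (A1 *\<^sub>v z) + A1 *\<^sub>v (G *\<^sub>v ?y) - A1 *\<^sub>v (Q *\<^sub>v ?y))"
    then have i: "i < m" by simp
    show "(A0 *\<^sub>v ?y + A1 *\<^sub>v (G *\<^sub>v ?y) - ?y + (Am *\<^sub>v (Gdd *\<^sub>v ?y) - Am *\<^sub>v (Q *\<^sub>v (Gdd *\<^sub>v ?y)))) $ i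
      = (- (A1 *\<^sub>v z) + A1 *\<^sub>v (G *\<^sub>v ?y) - A1 *\<^sub>v (Q *\<^sub>v ?y)) $ i"
      using arg_cong[OF shifted_eq[OF z], of "\<lambda>v. v $ i"] i by simp
  qed simp
qed auto

end

section \<open>Spectral radii\<close>

lemma smult_mat_pow:
  fixes X :: "'a :: comm_ring_1 mat"
  assumes "X \<in> carrier_mat n n"
  shows "(k \<cdot>\<^sub>m X) ^\<^sub>m i = k ^ i \<cdot>\<^sub>m X ^\<^sub>m i"
proof (induction i)
  case 0
  show ?case using assms by (intro eq_matI) auto
next
  case (Suc i)
  then show ?case using assms
    by (simp add: mult_smult_assoc_mat[of _ n n _ n] mult_smult_distrib[of _ n n _ n])
      (intro eq_matI; simp)
qed

text \<open>
  Rescaling by \<open>1 / s\<close> turns boundedness of the powers for spectral radius less than \<open>1\<close> into a geometric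
  bound.
\<close>

lemma spectral_radius_pow_bound:
  fixes X :: "complex mat"
  assumes X: "X \<in> carrier_mat n n" and n: "0 < n" and s: "spectral_radius X < s"
  shows "\<exists>c. \<forall>k. norm_bound (X ^\<^sub>m k) (c * s ^ k)"
proof -
  obtain l z where "spectral_radius X = cmod l" by (rule spectral_radius_cases[OF X n])
  then have s0: "0 < s" using s by (metis le_less_trans norm_ge_zero)
  define Y where "Y = complex_of_real (inverse s) \<cdot>\<^sub>m X"
  have Y: "Y \<in> carrier_mat n n" using X by (simp add: Y_def)
  have X_Y: "X = complex_of_real s \<cdot>\<^sub>m Y" using s0 by (intro eq_matI) (auto simp: Y_def)
  obtain l z where lz: "z \<in> carrier_vec n" "z \<noteq> 0\<^sub>v n" "Y *\<^sub>v z = l \<cdot>\<^sub>v z" "spectral_radius Y = cmod l"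
    by (rule spectral_radius_cases[OF Y n])
  have "X *\<^sub>v z = of_real s \<cdot>\<^sub>v (Y *\<^sub>v z)"
    using Y lz(1) by (subst X_Y) (intro eq_vecI; simp add: mat_vec_entry sum_distrib_left mult_ac)
  then have "X *\<^sub>v z = (of_real s * l) \<cdot>\<^sub>v z" by (simp add: lz(3) smult_smult_assoc)
  then have "eigenvalue X (of_real s * l)"
    using lz X by (auto simp: eigenvalue_def eigenvector_def)
  then have "cmod (of_real s * l) \<le> spectral_radius X"
    by (intro spectral_radius_mem_max(2)[OF X n]) (auto simp: spectrum_def)
  then have "s * cmod l \<le> spectral_radius X" using s0 by (simp add: norm_mult)
  with s have "s * cmod l < s * 1" by linarith
  then have "spectral_radius Y < 1" using lz(4) s0 by simp
  from spectral_radius_jnf_norm_bound_less_1_upper_triangular[OF Y this]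
  obtain c where c: "\<And>k. norm_bound (Y ^\<^sub>m k) c" by blast
  have "norm_bound (X ^\<^sub>m k) (c * s ^ k)" for k
  proof -
    have "X ^\<^sub>m k = complex_of_real s ^ k \<cdot>\<^sub>m Y ^\<^sub>m k"
      by (subst X_Y) (rule smult_mat_pow[OF Y])
    then show ?thesis
      using c[of k] s0 by (auto simp: norm_bound_def norm_mult norm_power mult.commute[of _ "s ^ k"])
  qed
  then show ?thesis by blast
qed

text \<open>
  If the powers of \<open>X\<close> decay like \<open>s\<^sup>k\<close> with \<open>s < 1\<close>, the powers of \<open>Y\<close> grow at most like
  \<open>(1 / sqrt s)\<^sup>k\<close>.
\<close>

lemma pow_product_tendsto_0:
  fixes X Y :: "complex mat"
  assumes X: "X \<in> carrier_mat n n" and Y: "Y \<in> carrier_mat n n"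
    and Xs: "spectral_radius X < 1" and Ys: "spectral_radius Y \<le> 1" and ij: "i < n" "j < n"
  shows "(\<lambda>k. (X ^\<^sub>m k * Y ^\<^sub>m k) $$ (i, j)) \<longlonglongrightarrow> 0"
proof -
  have n: "0 < n" using ij by simp
  obtain s where s: "spectral_radius X < s" "s < 1" using dense[OF Xs] by blast
  obtain l z where "spectral_radius X = cmod l" by (rule spectral_radius_cases[OF X n])
  then have s0: "0 < s" using s by (metis le_less_trans norm_ge_zero)
  define q where "q = inverse (sqrt s)"
  have "1 < q" using s s0 by (simp add: q_def one_less_inverse_iff)
  then have "spectral_radius Y < q" using Ys by simp
  from spectral_radius_pow_bound[OF Y n this] obtain d where d: "\<And>k. norm_bound (Y ^\<^sub>m k) (d * q ^ k)" by blast
  from spectral_radius_pow_bound[OF X n s(1)] obtain c where c: "\<And>k. norm_bound (X ^\<^sub>m k) (c * s ^ k)" by blast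
  have sq: "s * q = sqrt s" using s0 by (simp add: q_def divide_inverse[symmetric] real_div_sqrt)
  have bound: "cmod ((X ^\<^sub>m k * Y ^\<^sub>m k) $$ (i, j)) \<le> (of_nat n * c * d) * sqrt s ^ k" for k
  proof -
    have "norm_bound (X ^\<^sub>m k * Y ^\<^sub>m k) ((c * s ^ k) * (d * q ^ k) * of_nat n)"
      using X Y by (intro norm_bound_mult[of _ n n _ n] c d) auto
    also have "(c * s ^ k) * (d * q ^ k) * of_nat n = (of_nat n * c * d) * (s * q) ^ k"
      by (simp add: power_mult_distrib)
    finally show ?thesis using X Y ij by (simp add: norm_bound_def sq)
  qed
  show ?thesis
  proof (rule tendsto_0_le[where K = 1])
    show "(\<lambda>k. (of_nat n * c * d) * sqrt s ^ k) \<longlonglongrightarrow> 0"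
      using s s0 by (intro tendsto_mult_right_zero LIMSEQ_power_zero) simp
    show "\<forall>\<^sub>F k in sequentially. cmod ((X ^\<^sub>m k * Y ^\<^sub>m k) $$ (i, j))
        \<le> norm ((of_nat n * c * d) * sqrt s ^ k) * 1"
      unfolding mult_1_right real_norm_def
      by (intro always_eventually allI order_trans[OF bound abs_ge_self])
  qed
qed

context shifted_qbd
begin

lemma cmat_simps:
  "X \<in> carrier_mat m m \<Longrightarrow> Y \<in> carrier_mat m m \<Longrightarrow> cmat (X + Y) = cmat X + cmat Y"
  "X \<in> carrier_mat m m \<Longrightarrow> Y \<in> carrier_mat m m \<Longrightarrow> cmat (X - Y) = cmat X - cmat Y"
  "X \<in> carrier_mat m m \<Longrightarrow> Y \<in> carrier_mat m m \<Longrightarrow> cmat (X * Y) = cmat X * cmat Y"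
  "cmat (1\<^sub>m m) = 1\<^sub>m m"
  by (auto intro!: eq_matI of_real_hom.mat_hom_mult)

lemma complex_solution_vec:
  assumes z: "z \<in> carrier_vec m"
  shows "cmat Am *\<^sub>v z + cmat A0 *\<^sub>v (cmat G *\<^sub>v z) + cmat A1 *\<^sub>v (cmat G *\<^sub>v (cmat G *\<^sub>v z)) = cmat G *\<^sub>v z"
proof -
  have "cmat Am + cmat A0 * cmat G + cmat A1 * (cmat G * cmat G) = cmat G"
    using arg_cong[OF G_eq, of cmat] by (simp add: cmat_simps)
  from arg_cong[OF this, of "\<lambda>Y. Y *\<^sub>v z"] z show ?thesis
    by (simp add: square_simps assoc_add_vec[of _ m])
qed

lemma G_eigenvalue:
  assumes z: "z \<in> carrier_vec m" "z \<noteq> 0\<^sub>v m" and Gz: "cmat G *\<^sub>v z = l \<cdot>\<^sub>v z"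
    and l: "1 \<le> cmod l"
  shows "l = 1"
proof -
  have l1: "cmod l = 1"
    using stochastic_eigenvalue_le[OF G down.G_nonneg G_ones z Gz] l by simp
  have eq: "cmat Am *\<^sub>v z + l \<cdot>\<^sub>v (cmat A0 *\<^sub>v z) + (l * l) \<cdot>\<^sub>v (cmat A1 *\<^sub>v z) = l \<cdot>\<^sub>v z"
    using complex_solution_vec[OF z(1)] z(1) by (simp add: Gz square_simps smult_smult_assoc)
  from z obtain a where a: "a < m" "z $ a \<noteq> 0" by (metis carrier_vecD eq_vecI index_zero_vec)
  show ?thesis
  proof (rule unimodular_root[where x = "\<lambda>b. z $ b", OF _ l1 a])
    fix a assume "a < m"
    then show "(\<Sum>b<m. of_real (Am $$ (a, b)) * z $ b) + l * (\<Sum>b<m. of_real (A0 $$ (a, b)) * z $ b)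
      + l\<^sup>2 * (\<Sum>b<m. of_real (A1 $$ (a, b)) * z $ b) = l * z $ a"
      using arg_cong[OF eq, of "\<lambda>v. v $ a"] z(1) by (simp add: mat_vec_entry power2_eq_square)
  qed
qed

lemma G_fixed_const:
  assumes z: "z \<in> carrier_vec m" and Gz: "cmat G *\<^sub>v z = z"
  shows "z = (z $ 0) \<cdot>\<^sub>v cones m"
  using complex_solution_vec[OF z] Gz by (intro complex_harmonic_vec_const[OF z]) simp

lemma cmat_G_cones: "cmat G *\<^sub>v cones m = cones m"
proof (rule eq_vecI)
  fix i assume "i < dim_vec (cones m)"
  then have i: "i < m" by simp
  have "(\<Sum>b<m. G $$ (i, b)) = 1"
    using arg_cong[OF G_ones, of "\<lambda>v. v $ i"] i by (simp add: mat_vec_entry)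
  then show "(cmat G *\<^sub>v cones m) $ i = cones m $ i"
    using i by (simp add: mat_vec_entry flip: of_real_sum)
qed simp

lemma cvec_wG: "cvec wG = of_real (wG $ 0) \<cdot>\<^sub>v cones m"
  by (subst wG_const) (intro eq_vecI; simp)

lemma vGh_cones: "of_real (wG $ 0) * (cvec vGh \<bullet> cones m) = 1"
proof -
  have "(wG $ 0) * (\<Sum>i<m. vGh $ i) = 1"
    using normalization(1) by (subst (asm) wG_const)
      (simp add: scalar_prod_def atLeast0LessThan sum_distrib_right[symmetric] mult.commute)
  then have "complex_of_real ((wG $ 0) * (\<Sum>i<m. vGh $ i)) = 1" by simp
  then show ?thesis by (simp add: scalar_prod_def atLeast0LessThan)
qed

text \<open>
  Let \<open>Gt z = l z\<close> with \<open>l\<close> of modulus at least \<open>1\<close>.  Adding a multiple of the constant vector to \<open>z\<close> turns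
  it into an eigenvector of \<open>G\<close> unless \<open>l = 1\<close>, and for \<open>l = 1\<close> there is no drift; in each case \<open>z\<close> is
  constant, but \<open>Gt\<close> maps the constant vectors to \<open>0\<close>.
\<close>

lemma spectral_radius_Gt: "spectral_radius (cmat Gt) < 1"
proof (rule ccontr)
  assume neg: "\<not> spectral_radius (cmat Gt) < 1"
  have c: "cmat Gt \<in> carrier_mat m m" by simp
  obtain l z where z: "z \<in> carrier_vec m" "z \<noteq> 0\<^sub>v m" and lz: "cmat Gt *\<^sub>v z = l \<cdot>\<^sub>v z"
    and "spectral_radius (cmat Gt) = cmod l"
    by (rule spectral_radius_cases[OF c]) (use m in simp)
  then have l: "1 \<le> cmod l" using neg by simp
  define w0 where "w0 = complex_of_real (wG $ 0)"
  define \<alpha> where "\<alpha> = (cvec vGh \<bullet> z) * w0"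
  have v1: "w0 * (cvec vGh \<bullet> cones m) = 1" using vGh_cones by (simp add: w0_def)
  have "cmat Q *\<^sub>v z = \<alpha> \<cdot>\<^sub>v cones m"
    using z by (simp add: Q cmat_outer_prod outer_prod_mult_vec[of _ m] cvec_wG smult_smult_assoc \<alpha>_def w0_def)
  then have "cmat G *\<^sub>v z - \<alpha> \<cdot>\<^sub>v cones m = l \<cdot>\<^sub>v z"
    using lz z by (simp add: Gt cmat_simps square_simps)
  then have ent: "(cmat G *\<^sub>v z - \<alpha> \<cdot>\<^sub>v cones m) $ i = (l \<cdot>\<^sub>v z) $ i" for i by simp
  have Gz: "cmat G *\<^sub>v z = l \<cdot>\<^sub>v z + \<alpha> \<cdot>\<^sub>v cones m"
  proof (rule eq_vecI)
    fix i assume "i < dim_vec (l \<cdot>\<^sub>v z + \<alpha> \<cdot>\<^sub>v cones m)"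
    then show "(cmat G *\<^sub>v z) $ i = (l \<cdot>\<^sub>v z + \<alpha> \<cdot>\<^sub>v cones m) $ i"
      using ent[of i] z(1) by (simp add: algebra_simps)
  qed simp
  show False
  proof (cases "l = 1")
    case True
    then have "\<alpha> = 0"
      using stochastic_no_drift[OF _ G down.G_nonneg G_ones z(1), of \<alpha>] Gz m by auto
    then have "cmat G *\<^sub>v z = z" using Gz z True by (intro eq_vecI) auto
    then have zc: "z = (z $ 0) \<cdot>\<^sub>v cones m" by (rule G_fixed_const[OF z(1)])
    have "\<alpha> = z $ 0 * (w0 * (cvec vGh \<bullet> cones m))"
      unfolding \<alpha>_def by (subst zc) (simp add: mult_ac)
    then have "z $ 0 = 0" using v1 \<open>\<alpha> = 0\<close> by simp
    with zc have "z = 0 \<cdot>\<^sub>v cones m" by simp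
    then have "z = 0\<^sub>v m" by (intro eq_vecI) auto
    then show False using z(2) by simp
  next
    case False
    \<comment> \<open>chosen so that \<open>z + \<beta> 1\<close> is an eigenvector of \<open>G\<close>\<close>
    define \<beta> where "\<beta> = \<alpha> / (l - 1)"
    have \<beta>: "l * \<beta> = \<alpha> + \<beta>" using False by (simp add: \<beta>_def field_simps)
    define z' where "z' = z + \<beta> \<cdot>\<^sub>v cones m"
    have "cmat G *\<^sub>v z' = cmat G *\<^sub>v z + \<beta> \<cdot>\<^sub>v (cmat G *\<^sub>v cones m)"
      using z(1) by (simp add: z'_def square_simps)
    also have "\<dots> = l \<cdot>\<^sub>v z'"
      unfolding Gz cmat_G_cones using z(1) \<beta> by (intro eq_vecI) (auto simp: z'_def algebra_simps)
    finally have "z' = 0\<^sub>v m"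
      using G_eigenvalue[of z' l] z(1) l False by (auto simp: z'_def)
    then have "z' $ i = 0" if "i < m" for i using that by simp
    then have zc: "z = (- \<beta>) \<cdot>\<^sub>v cones m"
      using z(1) by (intro eq_vecI) (auto simp: z'_def add_eq_0_iff2)
    have "\<alpha> = - \<beta> * (w0 * (cvec vGh \<bullet> cones m))"
      unfolding \<alpha>_def by (subst zc) (simp add: mult_ac)
    then have "\<alpha> = - \<beta>" using v1 by simp
    then have "l * \<beta> = 0" using \<beta> by simp
    then have "\<beta> = 0" using l by auto
    then have "z = 0 \<cdot>\<^sub>v cones m" using zc by simp
    then have "z = 0\<^sub>v m" by (intro eq_vecI) auto
    then show False using z(2) by simp
  qed
qed

text \<open>
  As \<open>vGh\<close> is a left eigenvector for \<open>1\<close>, an eigenvector for another eigenvalue is orthogonal to it and so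
  is an eigenvector of the stochastic matrix \<open>Gh\<close>.
\<close>

lemma spectral_radius_Gdd: "spectral_radius (cmat Gdd) \<le> 1"
proof -
  have c: "cmat Gdd \<in> carrier_mat m m" by simp
  obtain l z where z: "z \<in> carrier_vec m" "z \<noteq> 0\<^sub>v m" and lz: "cmat Gdd *\<^sub>v z = l \<cdot>\<^sub>v z"
    and r: "spectral_radius (cmat Gdd) = cmod l"
    by (rule spectral_radius_cases[OF c]) (use m in simp)
  have Gddz: "cmat Gdd *\<^sub>v z = cmat Gh *\<^sub>v z + (cvec vGh \<bullet> z) \<cdot>\<^sub>v cvec t"
    using z(1) outer_prod_carrier[of t vGh] outer_prod_carrier[of "cvec t" "cvec vGh"]
    by (simp add: Gdd t_def[symmetric] cmat_simps square_simps cmat_outer_prod outer_prod_mult_vec[of _ m])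
  have vt: "cvec vGh \<bullet> cvec t = 0"
    using arg_cong[OF vGh_t, of complex_of_real] by (simp add: scalar_prod_def)
  have "cvec vGh \<bullet> (cmat Gh *\<^sub>v z) = (transpose_mat (cmat Gh) *\<^sub>v cvec vGh) \<bullet> z"
    using z(1) by (intro transpose_vec_mult_scalar[of _ m m, symmetric]) auto
  also have "transpose_mat (cmat Gh) *\<^sub>v cvec vGh = cvec (transpose_mat Gh *\<^sub>v vGh)"
    by (intro eq_vecI) (auto simp: mat_vec_entry)
  finally have vGhz: "cvec vGh \<bullet> (cmat Gh *\<^sub>v z) = cvec vGh \<bullet> z" by (simp add: Gh_vGh)
  show ?thesis
  proof (cases "cvec vGh \<bullet> z = 0")
    case True
    then have ent: "(cmat Gh *\<^sub>v z + 0 \<cdot>\<^sub>v cvec t) $ i = (l \<cdot>\<^sub>v z) $ i" for i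
      using Gddz lz by simp
    have "cmat Gh *\<^sub>v z = l \<cdot>\<^sub>v z"
    proof (rule eq_vecI)
      fix i assume "i < dim_vec (l \<cdot>\<^sub>v z)"
      then show "(cmat Gh *\<^sub>v z) $ i = (l \<cdot>\<^sub>v z) $ i"
        using ent[of i] z(1) by simp
    qed (use z(1) in simp)
    then show ?thesis
      using stochastic_eigenvalue_le[OF Gh up.G_nonneg Gh_ones z] r by simp
  next
    case False
    have "l * (cvec vGh \<bullet> z) = cvec vGh \<bullet> (cmat Gdd *\<^sub>v z)" using z(1) by (simp add: lz)
    also have "\<dots> = cvec vGh \<bullet> z"
      unfolding Gddz using z(1) by (simp add: scalar_prod_add_distrib[of _ m] vGhz vt)
    finally show ?thesis using False r by simp
  qed
qed

end

section \<open>The inverse of the shifted factor\<close>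

context shifted_qbd
begin

lemma cmat_pow: "X \<in> carrier_mat m m \<Longrightarrow> cmat (X ^\<^sub>m k) = cmat X ^\<^sub>m k"
  by (rule of_real_hom.mat_hom_pow)

lemma Gt_Gdd_pow_tendsto_0:
  assumes "i < m" "j < m"
  shows "(\<lambda>n. (Gt ^\<^sub>m n * Gdd ^\<^sub>m n) $$ (i, j)) \<longlonglongrightarrow> 0"
proof -
  have eq: "complex_of_real ((Gt ^\<^sub>m n * Gdd ^\<^sub>m n) $$ (i, j)) = (cmat Gt ^\<^sub>m n * cmat Gdd ^\<^sub>m n) $$ (i, j)" for n
  proof -
    have "cmat (Gt ^\<^sub>m n * Gdd ^\<^sub>m n) $$ (i, j) = complex_of_real ((Gt ^\<^sub>m n * Gdd ^\<^sub>m n) $$ (i, j))"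
      using assms carrier_matD[OF pow_carrier_mat[OF Gt_c, of n]] carrier_matD[OF pow_carrier_mat[OF Gdd_c, of n]]
      by simp
    then show ?thesis by (simp add: cmat_simps cmat_pow)
  qed
  have "(\<lambda>n. (cmat Gt ^\<^sub>m n * cmat Gdd ^\<^sub>m n) $$ (i, j)) \<longlonglongrightarrow> 0"
    by (rule pow_product_tendsto_0[of _ m])
      (use assms spectral_radius_Gt spectral_radius_Gdd in auto)
  then have "(\<lambda>n. complex_of_real ((Gt ^\<^sub>m n * Gdd ^\<^sub>m n) $$ (i, j))) \<longlonglongrightarrow> complex_of_real 0"
    unfolding eq by simp
  then show ?thesis by (simp only: tendsto_of_real_iff)
qed

text \<open>
  The kernel is invariant under \<open>Gdd\<close> because \<open>S Gdd = R S\<close>, and \<open>Gt Gdd\<close> fixes its vectors; by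
  induction \<open>Gt\<^sup>n Gdd\<^sup>n z = z\<close> for all \<open>n\<close>.
\<close>

lemma S_kernel:
  assumes z: "z \<in> carrier_vec m" "S *\<^sub>v z = 0\<^sub>v m"
  shows "z = 0\<^sub>v m"
proof -
  have zero: "X *\<^sub>v 0\<^sub>v m = 0\<^sub>v m" if "X \<in> carrier_mat m m" for X :: "real mat"
    using that by (intro eq_vecI) (auto simp: mat_vec_entry)
  have fix_pt: "Gt *\<^sub>v (Gdd *\<^sub>v y) = y" if y: "y \<in> carrier_vec m" "S *\<^sub>v y = 0\<^sub>v m" for y
  proof -
    have "y - Gt *\<^sub>v (Gdd *\<^sub>v y) = (Hi * H) *\<^sub>v (y - Gt *\<^sub>v (Gdd *\<^sub>v y))" using y by (simp add: Hi_H)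
    also have "\<dots> = Hi *\<^sub>v (S *\<^sub>v y)"
      using y(1) by (simp only: S_vec) (rule assoc_mult_mat_vec[of _ m m _ m]; simp)
    finally have "y - Gt *\<^sub>v (Gdd *\<^sub>v y) = 0\<^sub>v m" by (simp add: y(2) zero)
    then have e: "(y - Gt *\<^sub>v (Gdd *\<^sub>v y)) $ i = 0" if "i < m" for i using that by simp
    show ?thesis
    proof (rule eq_vecI)
      fix i assume "i < dim_vec y"
      then show "(Gt *\<^sub>v (Gdd *\<^sub>v y)) $ i = y $ i" using e[of i] y(1) by simp
    qed (use y in simp)
  qed
  have "(Gt ^\<^sub>m n) *\<^sub>v ((Gdd ^\<^sub>m n) *\<^sub>v y) = y" if "y \<in> carrier_vec m" "S *\<^sub>v y = 0\<^sub>v m" for n y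
    using that
  proof (induction n arbitrary: y)
    case 0
    then show ?case by simp
  next
    case (Suc n)
    have Gy: "Gdd *\<^sub>v y \<in> carrier_vec m" by simp
    have "S *\<^sub>v (Gdd *\<^sub>v y) = (S * Gdd) *\<^sub>v y"
      using Suc.prems by (intro assoc_mult_mat_vec[of _ m m _ m, symmetric]) auto
    also have "\<dots> = R *\<^sub>v (S *\<^sub>v y)"
      unfolding S_Gdd using Suc.prems by (intro assoc_mult_mat_vec[of _ m m _ m]) auto
    finally have SGy: "S *\<^sub>v (Gdd *\<^sub>v y) = 0\<^sub>v m" by (simp add: Suc.prems zero)
    have "Gt ^\<^sub>m Suc n *\<^sub>v (Gdd ^\<^sub>m Suc n *\<^sub>v y) = Gt *\<^sub>v (Gt ^\<^sub>m n *\<^sub>v (Gdd ^\<^sub>m n *\<^sub>v (Gdd *\<^sub>v y)))"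
      unfolding pow_mat_Suc_left[OF Gt_c] using Suc.prems(1)
      by (simp add: assoc_mult_mat_vec[of _ m m _ m])
    also have "\<dots> = y" by (simp add: Suc.IH[OF Gy SGy] fix_pt[OF Suc.prems])
    finally show ?case .
  qed
  from this[OF z] have pow: "(Gt ^\<^sub>m n * Gdd ^\<^sub>m n) *\<^sub>v z = z" for n
    using z(1) by (simp add: assoc_mult_mat_vec[of _ m m _ m])
  show ?thesis
  proof (rule eq_vecI)
    fix i assume "i < dim_vec (0\<^sub>v m :: real vec)"
    then have i: "i < m" by simp
    have dims: "dim_row (Gt ^\<^sub>m n) = m" "dim_col (Gdd ^\<^sub>m n) = m" for n
      using carrier_matD[OF pow_carrier_mat[OF Gt_c, of n]] carrier_matD[OF pow_carrier_mat[OF Gdd_c, of n]] by auto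
    have "(\<lambda>n. \<Sum>j<m. (Gt ^\<^sub>m n * Gdd ^\<^sub>m n) $$ (i, j) * z $ j) \<longlonglongrightarrow> (\<Sum>j<m. 0 * z $ j)"
      by (intro tendsto_intros Gt_Gdd_pow_tendsto_0 i) auto
    moreover have "(\<Sum>j<m. (Gt ^\<^sub>m n * Gdd ^\<^sub>m n) $$ (i, j) * z $ j) = z $ i" for n
      using arg_cong[OF pow[of n], of "\<lambda>v. v $ i"] i z(1) by (simp add: mat_vec_entry dims del: pow_mat_dim)
    ultimately have "(\<lambda>n :: nat. z $ i) \<longlonglongrightarrow> 0" by simp
    then show "z $ i = 0\<^sub>v m $ i" using i by (simp add: LIMSEQ_const_iff)
  qed (use z in simp)
qed

text \<open>
  Let \<open>V\<close> be the inverse of \<open>S\<close>.  Then \<open>V - Gt V R = H\<^sup>-\<^sup>1\<close>, so the series telescopes, with remainder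
  \<open>Gt\<^sup>n V R\<^sup>n = Gt\<^sup>n Gdd\<^sup>n V\<close>.
\<close>

lemma W_inverse:
  assumes W: "W = mat_suminf m m (\<lambda>i. Gt ^\<^sub>m i * Hi * R ^\<^sub>m i)"
  shows "W \<in> carrier_mat m m" "S * W = 1\<^sub>m m" "W * S = 1\<^sub>m m"
proof -
  obtain V where V: "V \<in> carrier_mat m m" and SV: "S * V = 1\<^sub>m m" and VS: "V * S = 1\<^sub>m m"
    using inverse_from_kernel[OF S S_kernel] by blast
  have dims: "dim_row V = m" "dim_col V = m" using V by auto
  have pows: "dim_row (X ^\<^sub>m n) = m" "dim_col (X ^\<^sub>m n) = m" if "X \<in> carrier_mat m m" for n and X :: "real mat"
    using carrier_matD[OF pow_carrier_mat[OF that]] by auto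
  have GV: "Gdd * V = V * R"
  proof -
    have "Gdd * V = (V * S) * Gdd * V" using V by (simp add: VS)
    also have "\<dots> = V * (S * Gdd) * V" using V by (simp add: assoc_mult_mat[of _ m m _ m _ m])
    also have "\<dots> = V * R * (S * V)" unfolding S_Gdd using V by (simp add: assoc_mult_mat[of _ m m _ m _ m])
    also have "\<dots> = V * R" using V by (simp only: SV) simp
    finally show ?thesis .
  qed
  have GVn: "Gdd ^\<^sub>m n * V = V * R ^\<^sub>m n" for n
  proof (induction n)
    case 0
    then show ?case using V by simp
  next
    case (Suc n)
    have "Gdd ^\<^sub>m Suc n * V = Gdd ^\<^sub>m n * (Gdd * V)" using V by (simp add: assoc_mult_mat[of _ m m _ m _ m])
    also have "\<dots> = V * R ^\<^sub>m n * R" using V Suc by (simp add: GV assoc_mult_mat[of _ m m _ m _ m, symmetric])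
    also have "\<dots> = V * R ^\<^sub>m Suc n" using V by (simp add: assoc_mult_mat[of _ m m _ m _ m])
    finally show ?case .
  qed
  have VHi: "V - Gt * V * R = Hi"
  proof -
    have "Hi = Hi * (S * V)" by (simp add: SV)
    also have "\<dots> = (Hi * H) * ((1\<^sub>m m - Gt * Gdd) * V)" using V by (simp add: assoc_mult_mat[of _ m m _ m _ m])
    also have "\<dots> = V - Gt * (Gdd * V)"
      using V by (simp add: Hi_H minus_mult_distrib_mat[of _ m m _ _ m] assoc_mult_mat[of _ m m _ m _ m])
    also have "\<dots> = V - Gt * V * R" using V by (simp add: GV assoc_mult_mat[of _ m m _ m _ m])
    finally show ?thesis by simp
  qed
  have step: "Gt ^\<^sub>m n * Hi * R ^\<^sub>m n = Gt ^\<^sub>m n * V * R ^\<^sub>m n - Gt ^\<^sub>m Suc n * V * R ^\<^sub>m Suc n" for n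
  proof -
    have "Gt ^\<^sub>m n * Hi * R ^\<^sub>m n = (Gt ^\<^sub>m n * V - Gt ^\<^sub>m n * (Gt * V * R)) * R ^\<^sub>m n"
      unfolding VHi[symmetric] using V by (simp add: mult_minus_distrib_mat[of _ m m _ m])
    also have "\<dots> = Gt ^\<^sub>m n * V * R ^\<^sub>m n - (Gt ^\<^sub>m n * (Gt * V * R)) * R ^\<^sub>m n"
      using V by (intro minus_mult_distrib_mat[of _ m m _ _ m]) auto
    also have "(Gt ^\<^sub>m n * (Gt * V * R)) * R ^\<^sub>m n = Gt ^\<^sub>m Suc n * V * R ^\<^sub>m Suc n"
      unfolding pow_mat_Suc_left[OF R] using V by (simp add: assoc_mult_mat[of _ m m _ m _ m])
    finally show ?thesis .
  qed
  have sums: "(\<lambda>n. (Gt ^\<^sub>m n * Hi * R ^\<^sub>m n) $$ (i, j)) sums V $$ (i, j)" if ij: "i < m" "j < m" for i j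
  proof -
    let ?f = "\<lambda>n. (Gt ^\<^sub>m n * V * R ^\<^sub>m n) $$ (i, j)"
    have "?f \<longlonglongrightarrow> 0"
    proof -
      have "Gt ^\<^sub>m n * V * R ^\<^sub>m n = (Gt ^\<^sub>m n * Gdd ^\<^sub>m n) * V" for n
        using V by (simp add: assoc_mult_mat[of _ m m _ m _ m] GVn)
      then have "?f n = (\<Sum>k<m. (Gt ^\<^sub>m n * Gdd ^\<^sub>m n) $$ (i, k) * V $$ (k, j))" for n
        using ij by (simp only:) (subst mat_mult_entry, simp_all add: pows dims)
      moreover have "(\<lambda>n. \<Sum>k<m. (Gt ^\<^sub>m n * Gdd ^\<^sub>m n) $$ (i, k) * V $$ (k, j)) \<longlonglongrightarrow> (\<Sum>k<m. 0 * V $$ (k, j))"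
        by (intro tendsto_intros Gt_Gdd_pow_tendsto_0 ij) auto
      ultimately show ?thesis by simp
    qed
    from telescope_sums'[OF this] have "(\<lambda>n. ?f n - ?f (Suc n)) sums (?f 0 - 0)" .
    moreover have "?f n - ?f (Suc n) = (Gt ^\<^sub>m n * Hi * R ^\<^sub>m n) $$ (i, j)" for n
      unfolding step using ij by (simp add: pows dims del: pow_mat.simps)
    moreover have "?f 0 = V $$ (i, j)" using V by simp
    ultimately show ?thesis by simp
  qed
  have "W = V"
    unfolding W mat_suminf_def using sums_unique[OF sums] by (intro eq_matI) (auto simp: dims)
  with V SV VS show "W \<in> carrier_mat m m" "S * W = 1\<^sub>m m" "W * S = 1\<^sub>m m" by auto
qed

end

section \<open>Solving a split recursion\<close>

lemma vec_sum_entries: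
  "finite A \<Longrightarrow> \<forall>k\<in>A. f k \<in> carrier_vec n \<Longrightarrow> vec_sum n f A = vec n (\<lambda>i. \<Sum>k\<in>A. f k $ i)"
  by (intro eq_vecI) (auto simp: index_finsum_vec finsum_vec_closed[THEN carrier_vecD])

lemma vec_sum_carrier:
  "(\<And>k. k \<in> A \<Longrightarrow> f k \<in> carrier_vec n) \<Longrightarrow> vec_sum n f A \<in> carrier_vec n"
  by (rule finsum_vec_closed) auto

lemma vec_sum_cong:
  assumes "finite A" "\<And>k. k \<in> A \<Longrightarrow> f k = f' k" "\<And>k. k \<in> A \<Longrightarrow> f' k \<in> carrier_vec n"
  shows "vec_sum n f A = vec_sum n f' A"
  using assms by (simp add: vec_sum_entries)

lemma mat_mult_vec_sum:
  assumes "X \<in> carrier_mat nr n" "finite A" "\<And>k. k \<in> A \<Longrightarrow> f k \<in> carrier_vec n"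
  shows "X *\<^sub>v vec_sum n f A = vec_sum nr (\<lambda>k. X *\<^sub>v f k) A"
proof -
  have "(\<Sum>j<n. X $$ (i, j) * (\<Sum>k\<in>A. f k $ j)) = (\<Sum>k\<in>A. (X *\<^sub>v f k) $ i)" if "i < nr" for i
  proof -
    have "(\<Sum>k\<in>A. (X *\<^sub>v f k) $ i) = (\<Sum>k\<in>A. \<Sum>j<n. X $$ (i, j) * f k $ j)"
      using assms that by (intro sum.cong refl) (simp add: mat_vec_entry carrier_vecD)
    also have "\<dots> = (\<Sum>j<n. \<Sum>k\<in>A. X $$ (i, j) * f k $ j)" by (rule sum.swap)
    finally show ?thesis by (simp add: sum_distrib_left)
  qed
  moreover have "X *\<^sub>v f k \<in> carrier_vec nr" if "k \<in> A" for k
    using assms that by (intro mult_mat_vec_carrier[of _ _ n]) auto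
  ultimately show ?thesis
    using assms by (intro eq_vecI) (simp_all add: vec_sum_entries mat_vec_entry)
qed

lemma vec_sum_Suc:
  assumes "\<And>k. k \<le> Suc r \<Longrightarrow> f k \<in> carrier_vec n"
  shows "vec_sum n f {1..Suc r} = vec_sum n f {1..r} + f (Suc r)"
  by (intro eq_vecI) (use assms in \<open>auto simp: vec_sum_entries carrier_vecD[OF assms]\<close>)

lemma vec_sum_lessThan_Suc:
  assumes "\<And>k. k \<le> r \<Longrightarrow> f k \<in> carrier_vec n"
  shows "vec_sum n f {..<Suc r} = vec_sum n f {..<r} + f r"
  by (intro eq_vecI) (use assms in \<open>auto simp: vec_sum_entries carrier_vecD[OF assms]\<close>)

lemma vec_sum_empty [simp]: "vec_sum n f {} = 0\<^sub>v n"
  by (intro eq_vecI) (auto simp: vec_sum_entries)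

text \<open>
  Variation of constants: these sums solve \<open>s (r + 1) = X s r + f (r + 1)\<close> from \<open>s 0 = 0\<close>.
\<close>

lemma vec_sum_convolution:
  fixes X :: "complex mat"
  assumes X: "X \<in> carrier_mat n n" and f: "\<And>k. f k \<in> carrier_vec n"
  shows "vec_sum n (\<lambda>k. X ^\<^sub>m (Suc r - k) *\<^sub>v f k) {1..Suc r} =
    X *\<^sub>v vec_sum n (\<lambda>k. X ^\<^sub>m (r - k) *\<^sub>v f k) {1..r} + f (Suc r)"
proof -
  have c: "X ^\<^sub>m i *\<^sub>v f k \<in> carrier_vec n" for i k using X by simp
  have "X *\<^sub>v vec_sum n (\<lambda>k. X ^\<^sub>m (r - k) *\<^sub>v f k) {1..r} =
      vec_sum n (\<lambda>k. X *\<^sub>v (X ^\<^sub>m (r - k) *\<^sub>v f k)) {1..r}"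
    by (intro mat_mult_vec_sum X c) simp
  also have "\<dots> = vec_sum n (\<lambda>k. X ^\<^sub>m (Suc r - k) *\<^sub>v f k) {1..r}"
  proof (intro vec_sum_cong c)
    fix k assume "k \<in> {1..r}"
    then have "X ^\<^sub>m (Suc r - k) = X * X ^\<^sub>m (r - k)"
      using pow_mat_Suc_left[OF X, of "r - k"] by (simp add: Suc_diff_le del: pow_mat.simps)
    then show "X *\<^sub>v (X ^\<^sub>m (r - k) *\<^sub>v f k) = X ^\<^sub>m (Suc r - k) *\<^sub>v f k"
      using X f[of k] by (simp add: assoc_mult_mat_vec[of _ n n _ n])
  qed simp
  moreover have "vec_sum n (\<lambda>k. X ^\<^sub>m (Suc r - k) *\<^sub>v f k) {1..Suc r} =
      vec_sum n (\<lambda>k. X ^\<^sub>m (Suc r - k) *\<^sub>v f k) {1..r} + f (Suc r)"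
    using X f by (subst vec_sum_Suc[OF c]) simp
  ultimately show ?thesis by simp
qed

lemma sum_shift_1:
  fixes T :: "nat \<Rightarrow> complex"
  shows "(\<Sum>j=1..n. T (Suc j)) + T 1 = (\<Sum>j=1..n. T j) + T (Suc n)"
  by (induction n) (auto simp: algebra_simps)

text \<open>
  Pure linear algebra: \<open>Gdd\<close> is split into an invertible and a nilpotent block, and \<open>h\<close> is a forcing
  term.  The system consists of a backward recursion \<open>Gdd d (r + 1) = d r + h (r + 1)\<close> and a forward recursion
  \<open>u (r + 1) = d r + Gt (u r - Gdd d r)\<close>.
\<close>

locale split_recursion =
  fixes m p k \<nu> :: nat and Gt Gdd V1 V1i V0 L K E F :: "complex mat"
    and h \<sigma> :: "nat \<Rightarrow> complex vec" and ut :: "complex vec \<Rightarrow> complex vec \<Rightarrow> nat \<Rightarrow> complex vec"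
  assumes Gt[simp]: "Gt \<in> carrier_mat m m" and Gdd[simp]: "Gdd \<in> carrier_mat m m"
    and V1[simp]: "V1 \<in> carrier_mat p p" and V1i[simp]: "V1i \<in> carrier_mat p p"
    and V0[simp]: "V0 \<in> carrier_mat k k"
    and L[simp]: "L \<in> carrier_mat m p" and K[simp]: "K \<in> carrier_mat m k"
    and E[simp]: "E \<in> carrier_mat p m" and F[simp]: "F \<in> carrier_mat k m"
    and V1_V1i: "V1 * V1i = 1\<^sub>m p" and V1i_V1: "V1i * V1 = 1\<^sub>m p"
    and \<nu>: "0 < \<nu>" and V0_nil: "V0 ^\<^sub>m \<nu> = 0\<^sub>m k k"
    and EL: "E * L = 1\<^sub>m p" and EK: "E * K = 0\<^sub>m p k" and FL: "F * L = 0\<^sub>m k p" and FK: "F * K = 1\<^sub>m k"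
    and LE_KF: "L * E + K * F = 1\<^sub>m m"
    and Gdd_L: "Gdd * L = L * V1" and Gdd_K: "Gdd * K = K * V0"
    and h[simp]: "\<And>r. h r \<in> carrier_vec m"
    and \<sigma>: "\<And>r. \<sigma> r =
      - vec_sum m (\<lambda>k. (Gt ^\<^sub>m (r - k) - L * V1i ^\<^sub>m (r - k) * E) *\<^sub>v h k) {1..r}
      - vec_sum m (\<lambda>j. (K * V0 ^\<^sub>m j * F) *\<^sub>v h (j + r)) {1..\<nu> - 1}"
    and ut: "\<And>x y r. ut x y r = Gt ^\<^sub>m r *\<^sub>v x + (L * V1i ^\<^sub>m r) *\<^sub>v y + \<sigma> r"
begin

lemma rect_carriers[simp]:
  "L *\<^sub>v x \<in> carrier_vec m" "K *\<^sub>v x \<in> carrier_vec m" "E *\<^sub>v x \<in> carrier_vec p" "F *\<^sub>v x \<in> carrier_vec k"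
  unfolding carrier_vec_def
  using carrier_matD[OF L] carrier_matD[OF K] carrier_matD[OF E] carrier_matD[OF F] by simp_all

declare carrier_matD[OF Gt, simp] carrier_matD[OF Gdd, simp] carrier_matD[OF V1, simp]
  carrier_matD[OF V1i, simp] carrier_matD[OF V0, simp] carrier_matD[OF L, simp] carrier_matD[OF K, simp]
  carrier_matD[OF E, simp] carrier_matD[OF F, simp] carrier_vecD[OF h, simp]

lemma zero_mult[simp]:
  "L *\<^sub>v 0\<^sub>v p = 0\<^sub>v m" "K *\<^sub>v 0\<^sub>v k = 0\<^sub>v m" "V1i *\<^sub>v 0\<^sub>v p = 0\<^sub>v p" "V0 *\<^sub>v 0\<^sub>v k = 0\<^sub>v k"
  by (auto intro!: eq_vecI simp: mat_vec_entry)

lemma decompose: "z \<in> carrier_vec m \<Longrightarrow> L *\<^sub>v (E *\<^sub>v z) + K *\<^sub>v (F *\<^sub>v z) = z"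
  using arg_cong[OF LE_KF, of "\<lambda>X. X *\<^sub>v z"]
  by (simp add: add_mult_distrib_mat_vec[of _ m m] mult_carrier_mat[OF L E] mult_carrier_mat[OF K F]
      assoc_mult_mat_vec[OF L E] assoc_mult_mat_vec[OF K F])

lemma Gdd_L_vec: "x \<in> carrier_vec p \<Longrightarrow> Gdd *\<^sub>v (L *\<^sub>v x) = L *\<^sub>v (V1 *\<^sub>v x)"
  using arg_cong[OF Gdd_L, of "\<lambda>X. X *\<^sub>v x"]
  by (simp add: assoc_mult_mat_vec[OF Gdd L] assoc_mult_mat_vec[OF L V1])

lemma Gdd_K_vec: "x \<in> carrier_vec k \<Longrightarrow> Gdd *\<^sub>v (K *\<^sub>v x) = K *\<^sub>v (V0 *\<^sub>v x)"
  using arg_cong[OF Gdd_K, of "\<lambda>X. X *\<^sub>v x"]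
  by (simp add: assoc_mult_mat_vec[OF Gdd K] assoc_mult_mat_vec[OF K V0])

lemma coordinates:
  assumes "x \<in> carrier_vec p" "y \<in> carrier_vec k"
  shows "E *\<^sub>v (L *\<^sub>v x + K *\<^sub>v y) = x" "F *\<^sub>v (L *\<^sub>v x + K *\<^sub>v y) = y"
proof -
  have "0\<^sub>m p k *\<^sub>v y = 0\<^sub>v p" "0\<^sub>m k p *\<^sub>v x = 0\<^sub>v k"
    using assms by (auto intro!: eq_vecI simp: mat_vec_entry)
  then show "E *\<^sub>v (L *\<^sub>v x + K *\<^sub>v y) = x" "F *\<^sub>v (L *\<^sub>v x + K *\<^sub>v y) = y"
    using assms by (simp_all add: mult_add_distrib_mat_vec[OF E] mult_add_distrib_mat_vec[OF F] EL EK FL FK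
        assoc_mult_mat_vec[OF E L, symmetric] assoc_mult_mat_vec[OF E K, symmetric]
        assoc_mult_mat_vec[OF F L, symmetric] assoc_mult_mat_vec[OF F K, symmetric])
qed

lemma E_F_Gdd:
  assumes z: "z \<in> carrier_vec m"
  shows "E *\<^sub>v (Gdd *\<^sub>v z) = V1 *\<^sub>v (E *\<^sub>v z)" "F *\<^sub>v (Gdd *\<^sub>v z) = V0 *\<^sub>v (F *\<^sub>v z)"
proof -
  have "Gdd *\<^sub>v z = Gdd *\<^sub>v (L *\<^sub>v (E *\<^sub>v z) + K *\<^sub>v (F *\<^sub>v z))" using decompose[OF z] by simp
  also have "\<dots> = L *\<^sub>v (V1 *\<^sub>v (E *\<^sub>v z)) + K *\<^sub>v (V0 *\<^sub>v (F *\<^sub>v z))"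
    by (simp add: mult_add_distrib_mat_vec[OF Gdd] Gdd_L_vec Gdd_K_vec)
  finally show "E *\<^sub>v (Gdd *\<^sub>v z) = V1 *\<^sub>v (E *\<^sub>v z)" "F *\<^sub>v (Gdd *\<^sub>v z) = V0 *\<^sub>v (F *\<^sub>v z)"
    by (simp_all add: coordinates)
qed

lemma V1_cancel: "x \<in> carrier_vec p \<Longrightarrow> V1 *\<^sub>v (V1i *\<^sub>v x) = x" "x \<in> carrier_vec p \<Longrightarrow> V1i *\<^sub>v (V1 *\<^sub>v x) = x"
  by (simp_all add: assoc_mult_mat_vec[OF V1 V1i, symmetric] assoc_mult_mat_vec[OF V1i V1, symmetric] V1_V1i V1i_V1)

text \<open>
  The three sums in \<open>\<sigma>\<close>, in the coordinates of the respective block.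
\<close>

definition conv_Gt where "conv_Gt r = vec_sum m (\<lambda>k. Gt ^\<^sub>m (r - k) *\<^sub>v h k) {1..r}"
definition conv_V1i where "conv_V1i r = vec_sum p (\<lambda>k. V1i ^\<^sub>m (r - k) *\<^sub>v (E *\<^sub>v h k)) {1..r}"
definition sum_V0 where "sum_V0 r = vec_sum k (\<lambda>j. V0 ^\<^sub>m j *\<^sub>v (F *\<^sub>v h (j + r))) {1..\<nu> - 1}"

lemma s_carriers[simp]: "conv_Gt r \<in> carrier_vec m" "conv_V1i r \<in> carrier_vec p" "sum_V0 r \<in> carrier_vec k"
  unfolding conv_Gt_def conv_V1i_def sum_V0_def by (intro vec_sum_carrier; simp)+

declare s_carriers[THEN carrier_vecD, simp]

lemma conv_Gt_rec: "conv_Gt 0 = 0\<^sub>v m" "conv_Gt (Suc r) = Gt *\<^sub>v conv_Gt r + h (Suc r)"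
  using vec_sum_convolution[OF Gt h] by (auto simp: conv_Gt_def)

lemma conv_V1i_rec: "conv_V1i 0 = 0\<^sub>v p" "conv_V1i (Suc r) = V1i *\<^sub>v conv_V1i r + E *\<^sub>v h (Suc r)"
  using vec_sum_convolution[OF V1i rect_carriers(3)] by (auto simp: conv_V1i_def)

text \<open>
  Multiplication by \<open>V0\<close> shifts the sum; the term that leaves its range contains \<open>V0\<^sup>\<nu> = 0\<close>.
\<close>

lemma sum_V0_rec: "V0 *\<^sub>v (sum_V0 (Suc r) + F *\<^sub>v h (Suc r)) = sum_V0 r"
proof -
  obtain n where n: "\<nu> = Suc n" using \<nu> by (cases \<nu>) auto
  define T where "T j = V0 ^\<^sub>m j *\<^sub>v (F *\<^sub>v h (j + r))" for j
  have T[simp]: "T j \<in> carrier_vec k" for j by (simp add: T_def)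
  have VT: "V0 *\<^sub>v (V0 ^\<^sub>m j *\<^sub>v (F *\<^sub>v h (j + Suc r))) = T (Suc j)" for j
    unfolding T_def pow_mat_Suc_left[OF V0] by (simp add: assoc_mult_mat_vec[of _ k k _ k])
  have sum_V0_n: "sum_V0 i = vec_sum k (\<lambda>j. V0 ^\<^sub>m j *\<^sub>v (F *\<^sub>v h (j + i))) {1..n}" for i
    unfolding sum_V0_def using n by simp
  have "V0 *\<^sub>v sum_V0 (Suc r) = vec_sum k (\<lambda>j. T (Suc j)) {1..n}"
    unfolding sum_V0_n VT[symmetric] by (subst mat_mult_vec_sum[OF V0]) simp_all
  moreover have "V0 *\<^sub>v (F *\<^sub>v h (Suc r)) = T 1"
    using VT[of 0] by simp
  moreover have "sum_V0 r = vec_sum k T {1..n}"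
    unfolding sum_V0_n T_def[abs_def] by (rule refl)
  moreover have "T (Suc n) = 0\<^sub>v k"
    unfolding T_def using V0_nil by (intro eq_vecI) (auto simp: n mat_vec_entry simp del: pow_mat.simps)
  moreover have "vec_sum k (\<lambda>j. T (Suc j)) {1..n} + T 1 = vec_sum k T {1..n} + T (Suc n)"
    using sum_shift_1[of "\<lambda>j. T j $ i" n for i] by (intro eq_vecI) (simp_all add: vec_sum_entries T[THEN carrier_vecD])
  moreover have "vec_sum k T {1..n} \<in> carrier_vec k" by (rule vec_sum_carrier) simp
  ultimately show ?thesis
    by (simp add: mult_add_distrib_mat_vec[OF V0])
qed

lemma \<sigma>_split: "\<sigma> r = L *\<^sub>v conv_V1i r - conv_Gt r - K *\<^sub>v sum_V0 r"
proof -
  have 1: "(Gt ^\<^sub>m i - L * V1i ^\<^sub>m i * E) *\<^sub>v h j = Gt ^\<^sub>m i *\<^sub>v h j - L *\<^sub>v (V1i ^\<^sub>m i *\<^sub>v (E *\<^sub>v h j))" for i j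
  proof -
    have c: "L * V1i ^\<^sub>m i \<in> carrier_mat m p" by (rule mult_carrier_mat[OF L]) simp
    then have "L * V1i ^\<^sub>m i * E \<in> carrier_mat m m" by (rule mult_carrier_mat[OF _ E])
    then show ?thesis
      by (simp add: minus_mult_distrib_mat_vec[of _ m m] assoc_mult_mat_vec[OF c E] assoc_mult_mat_vec[OF L, of _ p])
  qed
  have 2: "(K * V0 ^\<^sub>m i * F) *\<^sub>v h j = K *\<^sub>v (V0 ^\<^sub>m i *\<^sub>v (F *\<^sub>v h j))" for i j
  proof -
    have c: "K * V0 ^\<^sub>m i \<in> carrier_mat m k" by (rule mult_carrier_mat[OF K]) simp
    then show ?thesis
      by (simp add: assoc_mult_mat_vec[OF c F] assoc_mult_mat_vec[OF K, of _ k])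
  qed
  have K_sum_V0: "K *\<^sub>v sum_V0 r = vec_sum m (\<lambda>j. K *\<^sub>v (V0 ^\<^sub>m j *\<^sub>v (F *\<^sub>v h (j + r)))) {1..\<nu> - 1}"
    unfolding sum_V0_def by (rule mat_mult_vec_sum[OF K]) simp_all
  have L_conv_V1i: "L *\<^sub>v conv_V1i r = vec_sum m (\<lambda>k. L *\<^sub>v (V1i ^\<^sub>m (r - k) *\<^sub>v (E *\<^sub>v h k))) {1..r}"
    unfolding conv_V1i_def by (rule mat_mult_vec_sum[OF L]) simp_all
  have c: "Gt ^\<^sub>m i *\<^sub>v h j - L *\<^sub>v (V1i ^\<^sub>m i *\<^sub>v (E *\<^sub>v h j)) \<in> carrier_vec m"
    "Gt ^\<^sub>m i *\<^sub>v h j \<in> carrier_vec m" for i j by simp_all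
  have "vec_sum m (\<lambda>k. Gt ^\<^sub>m (r - k) *\<^sub>v h k - L *\<^sub>v (V1i ^\<^sub>m (r - k) *\<^sub>v (E *\<^sub>v h k))) {1..r} =
      conv_Gt r - L *\<^sub>v conv_V1i r"
    unfolding L_conv_V1i conv_Gt_def by (intro eq_vecI) (simp_all add: vec_sum_entries sum_subtractf)
  then show ?thesis unfolding \<sigma> 1 2 K_sum_V0[symmetric] by (intro eq_vecI) simp_all
qed

text \<open>
  \<open>backward y\<close> solves the backward recursion: its component in the invertible block, up to one factor
  \<open>V1\<^sup>-\<^sup>1\<close>, starts at \<open>y\<close>, and its component in the nilpotent block does not depend on \<open>y\<close>.  \<open>forward x\<close> is
  \<open>ut x y - Gdd (backward y)\<close>, which obeys the forward recursion \<open>w (r + 1) = Gt w r - h (r + 1)\<close>.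
\<close>

definition free_part where "free_part y r = V1i ^\<^sub>m r *\<^sub>v y + conv_V1i r"
definition backward where "backward y r = L *\<^sub>v (V1i *\<^sub>v free_part y r) - K *\<^sub>v (sum_V0 (Suc r) + F *\<^sub>v h (Suc r))"
definition forward where "forward x r = Gt ^\<^sub>m r *\<^sub>v x - conv_Gt r"

lemma free_part_carrier[simp]: "free_part y r \<in> carrier_vec p"
  by (simp add: free_part_def)

lemma backward_carrier[simp]: "backward y r \<in> carrier_vec m"
  by (simp add: backward_def)

declare carrier_vecD[OF free_part_carrier, simp] carrier_vecD[OF backward_carrier, simp]

lemma free_part_rec:
  assumes "y \<in> carrier_vec p"
  shows "free_part y 0 = y" "free_part y (Suc r) = V1i *\<^sub>v free_part y r + E *\<^sub>v h (Suc r)"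
  using assms unfolding free_part_def pow_mat_Suc_left[OF V1i]
  by (simp_all add: conv_V1i_rec assoc_mult_mat_vec[of _ p p _ p] mult_add_distrib_mat_vec[OF V1i] assoc_add_vec[of _ p])

lemma forward_rec:
  assumes "x \<in> carrier_vec m"
  shows "forward x 0 = x" "forward x (Suc r) = Gt *\<^sub>v forward x r - h (Suc r)"
proof -
  show "forward x 0 = x" using assms by (simp add: forward_def conv_Gt_rec)
  show "forward x (Suc r) = Gt *\<^sub>v forward x r - h (Suc r)"
    using assms unfolding forward_def pow_mat_Suc_left[OF Gt]
    by (simp add: conv_Gt_rec assoc_mult_mat_vec[of _ m m _ m] mult_minus_distrib_mat_vec[OF Gt]) (intro eq_vecI; simp)
qed

lemma Gdd_backward: "Gdd *\<^sub>v backward y r = L *\<^sub>v free_part y r - K *\<^sub>v sum_V0 r"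
  by (simp add: backward_def mult_minus_distrib_mat_vec[OF Gdd] Gdd_L_vec Gdd_K_vec V1_cancel sum_V0_rec)

lemma backward_rec:
  assumes y: "y \<in> carrier_vec p"
  shows "Gdd *\<^sub>v backward y (Suc r) = backward y r + h (Suc r)"
proof -
  have "Gdd *\<^sub>v backward y (Suc r) = L *\<^sub>v (V1i *\<^sub>v free_part y r) + L *\<^sub>v (E *\<^sub>v h (Suc r)) - K *\<^sub>v sum_V0 (Suc r)"
    by (simp add: Gdd_backward free_part_rec[OF y] mult_add_distrib_mat_vec[OF L])
  also have "\<dots> = backward y r + (L *\<^sub>v (E *\<^sub>v h (Suc r)) + K *\<^sub>v (F *\<^sub>v h (Suc r)))"
    by (simp add: backward_def mult_add_distrib_mat_vec[OF K]) (intro eq_vecI; simp)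
  finally show ?thesis by (simp add: decompose)
qed

lemma ut_split:
  assumes "x \<in> carrier_vec m" "y \<in> carrier_vec p"
  shows "ut x y r = forward x r + Gdd *\<^sub>v backward y r"
  unfolding ut \<sigma>_split Gdd_backward free_part_def forward_def using assms
  by (simp add: assoc_mult_mat_vec[OF L, of _ p] mult_add_distrib_mat_vec[OF L]) (intro eq_vecI; simp)

lemma ut_rec:
  assumes "x \<in> carrier_vec m" "y \<in> carrier_vec p"
  shows "ut x y 0 = x + Gdd *\<^sub>v backward y 0" "ut x y (Suc r) = backward y r + Gt *\<^sub>v (ut x y r - Gdd *\<^sub>v backward y r)"
proof -
  have qc: "forward x r \<in> carrier_vec m" for r by (simp add: forward_def)
  note [simp] = qc carrier_vecD[OF qc]
  show "ut x y 0 = x + Gdd *\<^sub>v backward y 0" using assms by (simp add: ut_split forward_rec)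
  have "ut x y r - Gdd *\<^sub>v backward y r = forward x r" using assms by (simp add: ut_split) (intro eq_vecI; simp)
  then show "ut x y (Suc r) = backward y r + Gt *\<^sub>v (ut x y r - Gdd *\<^sub>v backward y r)"
    using assms by (simp add: ut_split forward_rec backward_rec) (intro eq_vecI; simp)
qed

lemma ut_carrier: "x \<in> carrier_vec m \<Longrightarrow> y \<in> carrier_vec p \<Longrightarrow> ut x y r \<in> carrier_vec m"
  by (cases r) (simp_all add: ut_rec)

text \<open>
  The component in the invertible block is determined by its initial value, and the component in the
  nilpotent block by pulling it back \<open>\<nu>\<close> steps.
\<close>

lemma backward_unique:
  assumes d: "\<And>r. d r \<in> carrier_vec m" and rec: "\<And>r. Gdd *\<^sub>v d (Suc r) = d r" and E0: "E *\<^sub>v d 0 = 0\<^sub>v p"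
  shows "d r = 0\<^sub>v m"
proof -
  have "E *\<^sub>v d r = 0\<^sub>v p"
  proof (induction r)
    case (Suc r)
    have "V1 *\<^sub>v (E *\<^sub>v d (Suc r)) = 0\<^sub>v p"
      using Suc d by (simp add: E_F_Gdd[symmetric] rec)
    then have "V1i *\<^sub>v (V1 *\<^sub>v (E *\<^sub>v d (Suc r))) = 0\<^sub>v p" by simp
    then show ?case by (simp add: V1_cancel)
  qed (rule E0)
  moreover have "F *\<^sub>v d r = V0 ^\<^sub>m n *\<^sub>v (F *\<^sub>v d (n + r))" for n r
  proof (induction n arbitrary: r)
    case 0
    then show ?case by simp
  next
    case (Suc n)
    have "F *\<^sub>v d r = V0 *\<^sub>v (F *\<^sub>v d (Suc r))" using d by (simp add: E_F_Gdd[symmetric] rec)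
    also have "\<dots> = V0 ^\<^sub>m Suc n *\<^sub>v (F *\<^sub>v d (Suc n + r))"
      unfolding Suc[of "Suc r"] pow_mat_Suc_left[OF V0] by (simp add: assoc_mult_mat_vec[of _ k k _ k])
    finally show ?case .
  qed
  then have "F *\<^sub>v d r = 0\<^sub>m k k *\<^sub>v (F *\<^sub>v d (\<nu> + r))"
    using V0_nil by metis
  then have "F *\<^sub>v d r = 0\<^sub>v k"
    using V0_nil by (intro eq_vecI) (simp_all add: mat_vec_entry)
  ultimately show ?thesis using decompose[OF d[of r]] by simp
qed

text \<open>
  A solution \<open>(u, d)\<close> determines \<open>y = V1 (E d 0)\<close> and \<open>x = u 0 - Gdd d 0\<close>.  The predicate \<open>P\<close> carries the
  boundary condition along, which involves \<open>x\<close> and \<open>d 0\<close> only.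
\<close>

lemma recursion_solutions:
  assumes u: "\<And>r. u r \<in> carrier_vec m"
  shows "(\<exists>d. (\<forall>r. d r \<in> carrier_vec m \<and> Gdd *\<^sub>v d (Suc r) = d r + h (Suc r) \<and>
      u (Suc r) = d r + Gt *\<^sub>v (u r - Gdd *\<^sub>v d r)) \<and> P (u 0 - Gdd *\<^sub>v d 0) (d 0)) \<longleftrightarrow>
    (\<exists>x\<in>carrier_vec m. \<exists>y\<in>carrier_vec p. (\<forall>r. u r = ut x y r) \<and> P x (backward y 0))"
proof
  assume "\<exists>d. (\<forall>r. d r \<in> carrier_vec m \<and> Gdd *\<^sub>v d (Suc r) = d r + h (Suc r) \<and>
      u (Suc r) = d r + Gt *\<^sub>v (u r - Gdd *\<^sub>v d r)) \<and> P (u 0 - Gdd *\<^sub>v d 0) (d 0)"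
  then obtain d where d: "\<And>r. d r \<in> carrier_vec m" and rec: "\<And>r. Gdd *\<^sub>v d (Suc r) = d r + h (Suc r)"
    and ur: "\<And>r. u (Suc r) = d r + Gt *\<^sub>v (u r - Gdd *\<^sub>v d r)" and P: "P (u 0 - Gdd *\<^sub>v d 0) (d 0)" by blast
  define y where "y = V1 *\<^sub>v (E *\<^sub>v d 0)"
  have y: "y \<in> carrier_vec p" by (simp add: y_def)
  have dim: "dim_vec (d r) = m" "dim_vec (u r) = m" for r using d[of r] u[of r] by auto
  have diff: "d r - backward y r = 0\<^sub>v m" for r
  proof (rule backward_unique)
    show "Gdd *\<^sub>v (d (Suc r) - backward y (Suc r)) = d r - backward y r" for r
      using d by (simp add: mult_minus_distrib_mat_vec[OF Gdd] rec backward_rec[OF y])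
        (intro eq_vecI; simp add: dim)
    have "E *\<^sub>v backward y 0 = V1i *\<^sub>v y"
    proof -
      have "backward y 0 = L *\<^sub>v (V1i *\<^sub>v free_part y 0) + K *\<^sub>v (- (sum_V0 (Suc 0) + F *\<^sub>v h (Suc 0)))"
        unfolding backward_def by (subst mat_vec_uminus[OF K]) (simp_all add: minus_add_uminus_vec[of _ m])
      then show ?thesis by (simp add: coordinates free_part_rec[OF y])
    qed
    also have "\<dots> = E *\<^sub>v d 0" by (simp add: y_def V1_cancel)
    finally show "E *\<^sub>v (d 0 - backward y 0) = 0\<^sub>v p" using d by (simp add: mult_minus_distrib_mat_vec[OF E])
  qed (use d in simp)
  have de: "d r = backward y r" for r
  proof (rule eq_vecI)
    fix i assume "i < dim_vec (backward y r)"
    then show "d r $ i = backward y r $ i" using arg_cong[OF diff[of r], of "\<lambda>v. v $ i"] by simp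
  qed (simp add: dim)
  define x where "x = u 0 - Gdd *\<^sub>v d 0"
  have x: "x \<in> carrier_vec m" using u by (simp add: x_def)
  have "u r = ut x y r" for r
  proof (induction r)
    case 0
    show ?case unfolding ut_rec(1)[OF x y] unfolding de[symmetric] x_def by (intro eq_vecI) (simp_all add: dim)
  next
    case (Suc r)
    then show ?case by (simp add: ut_rec[OF x y] ur de)
  qed
  moreover have "P x (backward y 0)" using P unfolding x_def[symmetric] unfolding de[of 0] .
  ultimately show "\<exists>x\<in>carrier_vec m. \<exists>y\<in>carrier_vec p. (\<forall>r. u r = ut x y r) \<and> P x (backward y 0)"
    using x y by (intro bexI[of _ x] bexI[of _ y]) auto
next
  assume "\<exists>x\<in>carrier_vec m. \<exists>y\<in>carrier_vec p. (\<forall>r. u r = ut x y r) \<and> P x (backward y 0)"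
  then obtain x y where x: "x \<in> carrier_vec m" and y: "y \<in> carrier_vec p"
    and u': "\<And>r. u r = ut x y r" and P: "P x (backward y 0)" by blast
  have "u 0 - Gdd *\<^sub>v backward y 0 = x"
    unfolding u' ut_rec[OF x y] using x by (intro eq_vecI) simp_all
  with P have P': "P (u 0 - Gdd *\<^sub>v backward y 0) (backward y 0)" by simp
  have "backward y r \<in> carrier_vec m \<and> Gdd *\<^sub>v backward y (Suc r) = backward y r + h (Suc r) \<and>
      u (Suc r) = backward y r + Gt *\<^sub>v (u r - Gdd *\<^sub>v backward y r)" for r
    unfolding u' using backward_rec[OF y] ut_rec(2)[OF x y] by simp
  with P' show "\<exists>d. (\<forall>r. d r \<in> carrier_vec m \<and> Gdd *\<^sub>v d (Suc r) = d r + h (Suc r) \<and>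
      u (Suc r) = d r + Gt *\<^sub>v (u r - Gdd *\<^sub>v d r)) \<and> P (u 0 - Gdd *\<^sub>v d 0) (d 0)"
    by (intro exI[of _ "backward y"] conjI allI) auto
qed

end

section \<open>Block matrices, nilpotent matrices and series of vectors\<close>

lemma mat_inv_invertible:
  fixes X :: "'a :: field mat"
  assumes X: "X \<in> carrier_mat n n" and inv: "invertible_mat X"
  shows "mat_inv X \<in> carrier_mat n n" "X * mat_inv X = 1\<^sub>m n" "mat_inv X * X = 1\<^sub>m n"
proof -
  from inv obtain Y where Y: "X * Y = 1\<^sub>m (dim_row X)" "Y * X = 1\<^sub>m (dim_row Y)"
    by (auto simp: invertible_mat_def inverts_mat_def)
  have "dim_col Y = n" using arg_cong[OF Y(1), of dim_col] X by simp
  moreover have "dim_row Y = n" using arg_cong[OF Y(2), of dim_col] X by simp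
  ultimately have Yc: "Y \<in> carrier_mat n n" by (intro carrier_matI)
  have "mat_inv X = Y" using X Yc Y by (intro mat_inv_inverse) auto
  then show "mat_inv X \<in> carrier_mat n n" "X * mat_inv X = 1\<^sub>m n" "mat_inv X * X = 1\<^sub>m n"
    using Yc X Y by auto
qed

lemma four_block_mat_inject:
  assumes c: "A \<in> carrier_mat nr1 nc1" "B \<in> carrier_mat nr1 nc2" "C \<in> carrier_mat nr2 nc1" "D \<in> carrier_mat nr2 nc2"
    "A' \<in> carrier_mat nr1 nc1" "B' \<in> carrier_mat nr1 nc2" "C' \<in> carrier_mat nr2 nc1" "D' \<in> carrier_mat nr2 nc2"
    and eq: "four_block_mat A B C D = four_block_mat A' B' C' D'"
  shows "A = A'" "B = B'" "C = C'" "D = D'"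
proof -
  have e: "four_block_mat A B C D $$ (i, j) = four_block_mat A' B' C' D' $$ (i, j)" for i j using eq by simp
  show "A = A'"
  proof (rule eq_matI)
    fix i j assume "i < dim_row A'" "j < dim_col A'"
    then show "A $$ (i, j) = A' $$ (i, j)" using e[of i j] c by simp
  qed (use c in auto)
  show "B = B'"
  proof (rule eq_matI)
    fix i j assume "i < dim_row B'" "j < dim_col B'"
    then show "B $$ (i, j) = B' $$ (i, j)" using e[of i "nc1 + j"] c by simp
  qed (use c in auto)
  show "C = C'"
  proof (rule eq_matI)
    fix i j assume "i < dim_row C'" "j < dim_col C'"
    then show "C $$ (i, j) = C' $$ (i, j)" using e[of "nr1 + i" j] c by simp
  qed (use c in auto)
  show "D = D'"
  proof (rule eq_matI)
    fix i j assume "i < dim_row D'" "j < dim_col D'"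
    then show "D $$ (i, j) = D' $$ (i, j)" using e[of "nr1 + i" "nc1 + j"] c by simp
  qed (use c in auto)
qed

text \<open>
  Compare the blocks in \<open>[E; F] [L | K] = I\<close> and \<open>[L | K] [E; F] = I\<close>.
\<close>

lemma block_inverse:
  fixes L K E F :: "'a :: comm_ring_1 mat"
  assumes L: "L \<in> carrier_mat m p" and K: "K \<in> carrier_mat m k" and E: "E \<in> carrier_mat p m" and F: "F \<in> carrier_mat k m"
    and m: "m = p + k" and inv: "block_row L K * (E @\<^sub>r F) = 1\<^sub>m m" "(E @\<^sub>r F) * block_row L K = 1\<^sub>m m"
  shows "E * L = 1\<^sub>m p" "E * K = 0\<^sub>m p k" "F * L = 0\<^sub>m k p" "F * K = 1\<^sub>m k" "L * E + K * F = 1\<^sub>m m"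
proof -
  have c: "E * L \<in> carrier_mat p p" "E * K \<in> carrier_mat p k" "F * L \<in> carrier_mat k p" "F * K \<in> carrier_mat k k"
    "L * E \<in> carrier_mat m m" "K * F \<in> carrier_mat m m"
    using L K E F by auto
  have z: "(0\<^sub>m a 0 :: 'a mat) * 0\<^sub>m 0 b = 0\<^sub>m a b" for a b by (intro eq_matI) (auto simp: mat_mult_entry)
  have "(E @\<^sub>r F) * block_row L K = four_block_mat (E * L + 0\<^sub>m p 0 * 0\<^sub>m 0 p) (E * K + 0\<^sub>m p 0 * 0\<^sub>m 0 k)
      (F * L + 0\<^sub>m k 0 * 0\<^sub>m 0 p) (F * K + 0\<^sub>m k 0 * 0\<^sub>m 0 k)"
    unfolding block_row_def append_rows_def
    using L K E F by (subst mult_four_block_mat[of _ p m _ 0 _ k _ _ p _ k]) auto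
  also have "\<dots> = four_block_mat (E * L) (E * K) (F * L) (F * K)"
    using c by (simp add: z)
  finally have "four_block_mat (E * L) (E * K) (F * L) (F * K) = four_block_mat (1\<^sub>m p) (0\<^sub>m p k) (0\<^sub>m k p) (1\<^sub>m k)"
    using inv(2) m by simp
  from four_block_mat_inject[OF c(1-4) _ _ _ _ this]
  show "E * L = 1\<^sub>m p" "E * K = 0\<^sub>m p k" "F * L = 0\<^sub>m k p" "F * K = 1\<^sub>m k" by auto
  have "block_row L K * (E @\<^sub>r F) = four_block_mat (L * E + K * F) (L * 0\<^sub>m p 0 + K * 0\<^sub>m k 0)
      (0\<^sub>m 0 p * E + 0\<^sub>m 0 k * F) (0\<^sub>m 0 p * 0\<^sub>m p 0 + 0\<^sub>m 0 k * 0\<^sub>m k 0)"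
    unfolding block_row_def append_rows_def
    using L K E F by (subst mult_four_block_mat[of _ m p _ k _ 0 _ _ m _ 0]) auto
  then have "1\<^sub>m m $$ (i, j) = (L * E + K * F) $$ (i, j)" if "i < m" "j < m" for i j
    using that L K E F unfolding inv(1) by simp
  then show "L * E + K * F = 1\<^sub>m m" using c by (intro eq_matI) auto
qed

lemma block_diagonalization:
  fixes L K X :: "'a :: comm_ring_1 mat"
  assumes L: "L \<in> carrier_mat m p" and K: "K \<in> carrier_mat m k" and X: "X \<in> carrier_mat m m"
    and V: "V1 \<in> carrier_mat p p" "V0 \<in> carrier_mat k k"
    and eq: "X * block_row L K = block_row L K * diag_block_mat [V1, V0]"
  shows "X * L = L * V1" "X * K = K * V0"
proof -
  have c: "X * L \<in> carrier_mat m p" "X * K \<in> carrier_mat m k" "L * V1 \<in> carrier_mat m p" "K * V0 \<in> carrier_mat m k"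
    using L K X V by auto
  have X4: "X = four_block_mat X (0\<^sub>m m 0) (0\<^sub>m 0 m) (0\<^sub>m 0 0)" using X by (intro eq_matI) auto
  have z: "(0\<^sub>m a 0 :: 'a mat) * 0\<^sub>m 0 b = 0\<^sub>m a b" for a b by (intro eq_matI) (auto simp: mat_mult_entry)
  have 1: "X * block_row L K = four_block_mat (X * L) (X * K) (0\<^sub>m 0 p) (0\<^sub>m 0 k)"
    unfolding block_row_def using L K X c
    by (subst X4, subst mult_four_block_mat[of _ m m _ 0 _ 0 _ _ p _ k]) (auto simp: z)
  have "diag_block_mat [V1, V0] = four_block_mat V1 (0\<^sub>m p k) (0\<^sub>m k p) V0"
    using carrier_matD[OF V(1)] carrier_matD[OF V(2)]
    unfolding diag_block_mat.simps(2)[of V1 "[V0]"] Let_def diag_block_mat_singleton by simp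
  then have "block_row L K * diag_block_mat [V1, V0] =
      four_block_mat L K (0\<^sub>m 0 p) (0\<^sub>m 0 k) * four_block_mat V1 (0\<^sub>m p k) (0\<^sub>m k p) V0"
    unfolding block_row_def using carrier_matD[OF L] carrier_matD[OF K] by simp
  also have "\<dots> = four_block_mat (L * V1 + K * 0\<^sub>m k p) (L * 0\<^sub>m p k + K * V0)
      (0\<^sub>m 0 p * V1 + 0\<^sub>m 0 k * 0\<^sub>m k p) (0\<^sub>m 0 p * 0\<^sub>m p k + 0\<^sub>m 0 k * V0)"
    by (rule mult_four_block_mat[OF L K zero_carrier_mat zero_carrier_mat V(1) _ _ V(2)]) simp_all
  also have "\<dots> = four_block_mat (L * V1) (K * V0) (0\<^sub>m 0 p) (0\<^sub>m 0 k)"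
    using L K V c(3,4) by (intro cong_four_block_mat) simp_all
  finally have 2: "block_row L K * diag_block_mat [V1, V0] = four_block_mat (L * V1) (K * V0) (0\<^sub>m 0 p) (0\<^sub>m 0 k)" .
  from four_block_mat_inject[OF c(1,2) zero_carrier_mat zero_carrier_mat c(3,4) zero_carrier_mat
      zero_carrier_mat eq[unfolded 1 2]]
  show "X * L = L * V1" "X * K = K * V0" by auto
qed

lemma diag_block_mat_zero:
  "(\<And>X. X \<in> set Xs \<Longrightarrow> X = 0\<^sub>m (dim_row X) (dim_col X)) \<Longrightarrow>
    diag_block_mat Xs = 0\<^sub>m (dim_row (diag_block_mat Xs)) (dim_col (diag_block_mat Xs))"
proof (induction Xs)
  case (Cons X Xs)
  have "X = 0\<^sub>m (dim_row X) (dim_col X)" by (rule Cons.prems) simp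
  then obtain a b where X: "X = 0\<^sub>m a b" by blast
  have "diag_block_mat Xs = 0\<^sub>m (dim_row (diag_block_mat Xs)) (dim_col (diag_block_mat Xs))"
    by (rule Cons.IH, rule Cons.prems) simp
  then obtain c d where D: "diag_block_mat Xs = 0\<^sub>m c d" by blast
  show ?case by (simp add: Let_def X D)
qed simp

text \<open>
  All Jordan blocks belong to the eigenvalue \<open>0\<close>, so a power beyond the sum of their sizes vanishes.
\<close>

lemma spectral_radius_0_nilpotent:
  fixes X :: "complex mat"
  assumes X: "X \<in> carrier_mat n n" and rad: "0 < n \<Longrightarrow> spectral_radius X = 0"
  shows "\<exists>k>0. X ^\<^sub>m k = 0\<^sub>m n n"
proof -
  obtain as where "char_poly X = (\<Prod>a\<leftarrow>as. [:- a, 1:])" using char_poly_factorized[OF X] by blast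
  then obtain js where js: "jordan_nf X js" using jordan_nf_exists[OF X] by blast
  have zero: "a = 0" if ja: "(j, a) \<in> set js" for j a
  proof -
    have "j \<noteq> 0" using js ja by (force simp: jordan_nf_def)
    have "[:- a, 1:] ^ j dvd char_poly X"
      unfolding jordan_nf_char_poly[OF js] by (rule prod_list_dvd) (use ja in force)
    then have "poly (char_poly X) a = 0"
      using \<open>j \<noteq> 0\<close> by (auto elim!: dvdE)
    then have ev: "eigenvalue X a" using eigenvalue_root_char_poly[OF X] by simp
    then have n: "0 < n" by (rule eigenvalue_imp_nonzero_dim[OF X])
    have "cmod a \<le> spectral_radius X"
      using ev by (intro spectral_radius_mem_max(2)[OF X n]) (auto simp: spectrum_def)
    then show ?thesis using rad n by simp
  qed
  define k where "k = Suc (sum_list (map fst js))"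
  have "jordan_matrix js ^\<^sub>m k = 0\<^sub>m (dim_row (jordan_matrix js ^\<^sub>m k)) (dim_col (jordan_matrix js ^\<^sub>m k))"
    unfolding jordan_matrix_pow
  proof (rule diag_block_mat_zero)
    fix Y assume "Y \<in> set (map (\<lambda>(n, a). jordan_block n a ^\<^sub>m k) js)"
    then obtain j a where ja: "(j, a) \<in> set js" "Y = jordan_block j a ^\<^sub>m k" by auto
    have "j \<le> sum_list (map fst js)" using ja(1) by (intro member_le_sum_list) force+
    then show "Y = 0\<^sub>m (dim_row Y) (dim_col Y)"
      unfolding ja(2) zero[OF ja(1)] jordan_block_zero_pow by (intro eq_matI) (auto simp: k_def)
  qed
  moreover obtain P Q where wit: "similar_mat_wit X (jordan_matrix js) P Q"
    using js by (auto simp: jordan_nf_def similar_mat_def)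
  moreover have "n = dim_row X" using X by simp
  note wit_c = similar_mat_witD(5-7)[OF this wit]
  ultimately have J: "jordan_matrix js ^\<^sub>m k = 0\<^sub>m n n"
    using carrier_matD[OF pow_carrier_mat[OF wit_c(1), of k]] by (simp del: pow_mat_dim)
  have "X ^\<^sub>m k = P * jordan_matrix js ^\<^sub>m k * Q" by (rule similar_mat_wit_pow_id[OF wit])
  also have "\<dots> = 0\<^sub>m n n" unfolding J using wit_c by simp
  finally show ?thesis by (auto simp: k_def)
qed

lemma vec_suminf_carrier[simp]: "vec_suminf n f \<in> carrier_vec n"
  by (simp add: vec_suminf_def)

lemma vec_sums_mult:
  assumes X: "X \<in> carrier_mat nr n" and f: "\<And>k. f k \<in> carrier_vec n" and sums: "vec_summable n f"
  shows "vec_summable nr (\<lambda>k. X *\<^sub>v f k)" "vec_suminf nr (\<lambda>k. X *\<^sub>v f k) = X *\<^sub>v vec_suminf n f"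
proof -
  have s: "(\<lambda>k. (X *\<^sub>v f k) $ i) sums (X *\<^sub>v vec_suminf n f) $ i" if "i < nr" for i
  proof -
    have "(\<lambda>k. \<Sum>j<n. X $$ (i, j) * f k $ j) sums (\<Sum>j<n. X $$ (i, j) * (\<Sum>k. f k $ j))"
      using sums by (intro sums_sum sums_mult) (auto simp: vec_summable_def summable_sums)
    then show ?thesis
      using X that f by (simp add: mat_vec_entry carrier_vecD[OF f] vec_suminf_def)
  qed
  show "vec_summable nr (\<lambda>k. X *\<^sub>v f k)"
    using s by (auto simp: vec_summable_def sums_iff)
  show "vec_suminf nr (\<lambda>k. X *\<^sub>v f k) = X *\<^sub>v vec_suminf n f"
    using s X by (intro eq_vecI) (auto simp: vec_suminf_def sums_iff)
qed

lemma vec_sums_Suc: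
  assumes f: "\<And>k. f k \<in> carrier_vec n" and sums: "vec_summable n f"
  shows "vec_summable n (\<lambda>k. f (Suc k))" "vec_suminf n f = f 0 + vec_suminf n (\<lambda>k. f (Suc k))"
proof -
  show "vec_summable n (\<lambda>k. f (Suc k))"
    using sums by (simp add: vec_summable_def summable_Suc_iff[of "\<lambda>k. f k $ i" for i])
  show "vec_suminf n f = f 0 + vec_suminf n (\<lambda>k. f (Suc k))"
  proof (rule eq_vecI)
    fix i assume "i < dim_vec (f 0 + vec_suminf n (\<lambda>k. f (Suc k)))"
    then have i: "i < n" by (simp add: vec_suminf_def)
    then have "summable (\<lambda>k. f k $ i)" using sums by (simp add: vec_summable_def)
    from suminf_split_head[OF this] show "vec_suminf n f $ i = (f 0 + vec_suminf n (\<lambda>k. f (Suc k))) $ i"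
      using i by (simp add: vec_suminf_def)
  qed (simp add: vec_suminf_def)
qed

lemma vec_suminf_finite:
  assumes f: "\<And>k. f k \<in> carrier_vec n" and zero: "\<And>k. r \<le> k \<Longrightarrow> f (Suc k) = 0\<^sub>v n"
  shows "vec_suminf n (\<lambda>k. f (Suc k)) = vec_sum n f {1..r}"
proof (rule eq_vecI)
  have c: "vec_sum n f {1..r} \<in> carrier_vec n" by (intro vec_sum_carrier f)
  then show "dim_vec (vec_suminf n (\<lambda>k. f (Suc k))) = dim_vec (vec_sum n f {1..r})"
    using carrier_vecD[OF c] by (simp add: vec_suminf_def)
  fix i assume "i < dim_vec (vec_sum n f {1..r})"
  then have i: "i < n" using carrier_vecD[OF c] by simp
  have "(\<Sum>k. f (Suc k) $ i) = (\<Sum>k<r. f (Suc k) $ i)"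
    using zero i by (intro suminf_finite) (auto simp: not_less)
  also have "\<dots> = (\<Sum>k=1..r. f k $ i)"
    by (rule sum.reindex_bij_witness[of _ "\<lambda>k. k - 1" Suc]) auto
  finally show "vec_suminf n (\<lambda>k. f (Suc k)) $ i = vec_sum n f {1..r} $ i"
    using i f by (simp add: vec_suminf_def vec_sum_entries)
qed

section \<open>The shift of the Poisson equation\<close>

context qbd
begin

lemma poisson_levels:
  fixes u g :: "nat \<Rightarrow> complex vec"
  assumes u: "\<And>r. u r \<in> carrier_vec m" and g: "\<And>r. g r \<in> carrier_vec m"
  shows "poisson_equation (qbd_states m) (qbd_kernel m B Am A0 A1) (\<lambda>(r, a). u r $ a) (\<lambda>(r, a). g r $ a) \<longleftrightarrow>
    u 0 - cmat B *\<^sub>v u 0 - cmat A1 *\<^sub>v u 1 = g 0 \<and>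
    (\<forall>r. u (Suc r) - cmat Am *\<^sub>v u r - cmat A0 *\<^sub>v u (Suc r) - cmat A1 *\<^sub>v u (Suc (Suc r)) = g (Suc r))"
proof -
  let ?h = "\<lambda>(r, a). u r $ a"
  have dim[simp]: "dim_vec (u r) = m" "dim_vec (g r) = m" for r using u[of r] g[of r] by auto
  have level_0: "(\<Sum>\<^sub>\<infinity>y\<in>qbd_states m. complex_of_real (qbd_kernel m B Am A0 A1 (0, a) y) * ?h y) =
      (cmat B *\<^sub>v u 0) $ a + (cmat A1 *\<^sub>v u 1) $ a" if "a < m" for a
    using infsumI[OF qbd_has_sum_0[OF that, of B Am A0 A1 ?h]] that by (simp add: mat_vec_entry)
  have level_Suc: "(\<Sum>\<^sub>\<infinity>y\<in>qbd_states m. complex_of_real (qbd_kernel m B Am A0 A1 (Suc r, a) y) * ?h y) =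
      (cmat Am *\<^sub>v u r) $ a + (cmat A0 *\<^sub>v u (Suc r)) $ a + (cmat A1 *\<^sub>v u (Suc (Suc r))) $ a"
    if "a < m" for a r
    using infsumI[OF qbd_has_sum_Suc[OF that, of B Am A0 A1 r ?h]] that by (simp add: mat_vec_entry)
  have ball_qbd_states: "(\<forall>x\<in>qbd_states m. P x) \<longleftrightarrow> (\<forall>r. \<forall>a<m. P (r, a))" for P
    by (auto simp: qbd_states_def)
  have veq: "x = y \<longleftrightarrow> (\<forall>a<m. x $ a = y $ a)" if "dim_vec x = m" "dim_vec y = m" for x y :: "complex vec"
    using that by (auto intro: eq_vecI)
  have "poisson_equation (qbd_states m) (qbd_kernel m B Am A0 A1) ?h (\<lambda>(r, a). g r $ a) \<longleftrightarrow>
     (\<forall>r. \<forall>a<m. u r $ a - (\<Sum>\<^sub>\<infinity>y\<in>qbd_states m. complex_of_real (qbd_kernel m B Am A0 A1 (r, a) y) * ?h y) = g r $ a)"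
    unfolding poisson_equation_def by (simp add: split_paired_all ball_qbd_states)
  also have "\<dots> \<longleftrightarrow> (\<forall>a<m. u 0 $ a - ((cmat B *\<^sub>v u 0) $ a + (cmat A1 *\<^sub>v u 1) $ a) = g 0 $ a) \<and>
     (\<forall>r. \<forall>a<m. u (Suc r) $ a - ((cmat Am *\<^sub>v u r) $ a + (cmat A0 *\<^sub>v u (Suc r)) $ a + (cmat A1 *\<^sub>v u (Suc (Suc r))) $ a) = g (Suc r) $ a)"
    (is "?l \<longleftrightarrow> ?r")
  proof
    assume l: ?l
    show ?r
    proof (intro conjI allI impI)
      fix a assume a: "a < m"
      show "u 0 $ a - ((cmat B *\<^sub>v u 0) $ a + (cmat A1 *\<^sub>v u 1) $ a) = g 0 $ a"
        using l[rule_format, OF a, of 0] unfolding level_0[OF a] .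
    next
      fix r a assume a: "a < m"
      show "u (Suc r) $ a - ((cmat Am *\<^sub>v u r) $ a + (cmat A0 *\<^sub>v u (Suc r)) $ a + (cmat A1 *\<^sub>v u (Suc (Suc r))) $ a) = g (Suc r) $ a"
        using l[rule_format, OF a, of "Suc r"] unfolding level_Suc[OF a] .
    qed
  next
    assume r: ?r
    show ?l
    proof (intro allI impI)
      fix r a assume a: "a < m"
      show "u r $ a - (\<Sum>\<^sub>\<infinity>y\<in>qbd_states m. complex_of_real (qbd_kernel m B Am A0 A1 (r, a) y) * ?h y) = g r $ a"
      proof (cases r)
        case 0
        show ?thesis unfolding 0 level_0[OF a] using r a by blast
      next
        case (Suc k)
        show ?thesis unfolding Suc level_Suc[OF a] using r a by blast
      qed
    qed
  qed
  finally show ?thesis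
    by (simp add: veq diff_diff_eq)
qed

end

lemma cmat_eq_vec: "X = Y \<Longrightarrow> cmat X *\<^sub>v z = cmat Y *\<^sub>v z"
  by simp

context shifted_qbd
begin

text \<open>
  The real matrix identities of the factorization and the shift, carried over to complex vectors.
\<close>

lemma complex_identities:
  assumes z: "z \<in> carrier_vec m"
  shows cH: "cmat H *\<^sub>v z = cmat A0 *\<^sub>v z + cmat A1 *\<^sub>v (cmat G *\<^sub>v z) - z"
    and cR_H: "cmat R *\<^sub>v (cmat H *\<^sub>v z) = - (cmat A1 *\<^sub>v z)"
    and cH_Gt: "cmat H *\<^sub>v (cmat Gt *\<^sub>v z) = - (cmat Am *\<^sub>v z - cmat Am *\<^sub>v (cmat Q *\<^sub>v z))"
    and cGt: "cmat Gt *\<^sub>v z = cmat G *\<^sub>v z - cmat Q *\<^sub>v z"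
    and cQQ: "cmat Q *\<^sub>v (cmat Q *\<^sub>v z) = cmat Q *\<^sub>v z"
    and cAQ: "cmat Am *\<^sub>v (cmat Q *\<^sub>v z) + cmat A0 *\<^sub>v (cmat Q *\<^sub>v z) + cmat A1 *\<^sub>v (cmat Q *\<^sub>v z) = cmat Q *\<^sub>v z"
    and cS: "cmat S *\<^sub>v z = cmat H *\<^sub>v (z - cmat Gt *\<^sub>v (cmat Gdd *\<^sub>v z))"
    and cS_Gdd: "cmat S *\<^sub>v (cmat Gdd *\<^sub>v z) = cmat R *\<^sub>v (cmat S *\<^sub>v z)"
proof -
  have neg: "cmat (- X) = - cmat X" if "X \<in> carrier_mat m m" for X using that by (auto intro!: eq_matI)
  note simps = cmat_simps square_simps neg
  have "H = A0 + A1 * G - 1\<^sub>m m" by (simp add: U_G)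
  from cmat_eq_vec[OF this, of z] z show "cmat H *\<^sub>v z = cmat A0 *\<^sub>v z + cmat A1 *\<^sub>v (cmat G *\<^sub>v z) - z"
    by (simp add: simps)
  have "R * H = - A1"
    by (rule mat_eqI_vec[of _ m m]) (use R_H_vec in \<open>auto simp: assoc_mult_mat_vec[of R m m H m]\<close>)
  from cmat_eq_vec[OF this, of z] z show "cmat R *\<^sub>v (cmat H *\<^sub>v z) = - (cmat A1 *\<^sub>v z)"
    by (simp add: simps)
  have "H * Gt = - (Am - Am * Q)"
  proof (rule mat_eqI_vec[of _ m m])
    fix x :: "real vec" assume x: "x \<in> carrier_vec m"
    have "(- (Am - Am * Q)) *\<^sub>v x = - ((Am - Am * Q) *\<^sub>v x)" using x by simp
    then show "(H * Gt) *\<^sub>v x = (- (Am - Am * Q)) *\<^sub>v x"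
      using H_Gt_vec[OF x] x by (simp add: assoc_mult_mat_vec[of H m m Gt m] minus_mult_distrib_mat_vec[of Am m m]
          assoc_mult_mat_vec[of Am m m Q m])
  qed auto
  from cmat_eq_vec[OF this, of z] z
  show "cmat H *\<^sub>v (cmat Gt *\<^sub>v z) = - (cmat Am *\<^sub>v z - cmat Am *\<^sub>v (cmat Q *\<^sub>v z))"
    by (simp add: simps)
  from cmat_eq_vec[OF Gt, of z] z show "cmat Gt *\<^sub>v z = cmat G *\<^sub>v z - cmat Q *\<^sub>v z"
    by (simp add: simps)
  have "Q * Q = Q"
    by (rule mat_eqI_vec[of _ m m]) (use normalization(1) in \<open>auto simp: square_simps Q_vec\<close>)
  from cmat_eq_vec[OF this, of z] z show "cmat Q *\<^sub>v (cmat Q *\<^sub>v z) = cmat Q *\<^sub>v z"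
    by (simp add: simps)
  have "Am * Q + A0 * Q + A1 * Q = Q"
  proof (rule mat_eqI_vec[of _ m m])
    fix x :: "real vec" assume x: "x \<in> carrier_vec m"
    let ?c = "vGh \<bullet> x"
    have "(Am * Q + A0 * Q + A1 * Q) *\<^sub>v x = ?c \<cdot>\<^sub>v (Am *\<^sub>v wG) + ?c \<cdot>\<^sub>v (A0 *\<^sub>v wG) + ?c \<cdot>\<^sub>v (A1 *\<^sub>v wG)"
      using x by (simp add: square_simps Q_vec)
    also have "\<dots> = ?c \<cdot>\<^sub>v (Am *\<^sub>v wG + A0 *\<^sub>v wG + A1 *\<^sub>v wG)"
      by (intro eq_vecI) (simp_all add: algebra_simps)
    finally show "(Am * Q + A0 * Q + A1 * Q) *\<^sub>v x = Q *\<^sub>v x" using x by (simp add: harmonic_wG Q_vec)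
  qed auto
  from cmat_eq_vec[OF this, of z] z
  show "cmat Am *\<^sub>v (cmat Q *\<^sub>v z) + cmat A0 *\<^sub>v (cmat Q *\<^sub>v z) + cmat A1 *\<^sub>v (cmat Q *\<^sub>v z) = cmat Q *\<^sub>v z"
    by (simp add: simps)
  show "cmat S *\<^sub>v z = cmat H *\<^sub>v (z - cmat Gt *\<^sub>v (cmat Gdd *\<^sub>v z))"
  proof -
    have "cmat S = cmat H * (1\<^sub>m m - cmat Gt * cmat Gdd)" by (simp add: cmat_simps)
    then show ?thesis
      using z by (simp add: assoc_mult_mat_vec[of "cmat H" m m _ m] minus_mult_distrib_mat_vec[of "1\<^sub>m m" m m]
          assoc_mult_mat_vec[of "cmat Gt" m m _ m])
  qed
  have "cmat S * cmat Gdd = cmat R * cmat S"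
    using arg_cong[OF S_Gdd, of cmat] cmat_simps(3)[OF S Gdd_c] cmat_simps(3)[OF R S] by simp
  from arg_cong[OF this, of "\<lambda>X. X *\<^sub>v z"] z
  show "cmat S *\<^sub>v (cmat Gdd *\<^sub>v z) = cmat R *\<^sub>v (cmat S *\<^sub>v z)"
    by (simp add: assoc_mult_mat_vec[of "cmat S" m m _ m] assoc_mult_mat_vec[of "cmat R" m m _ m] del: of_real_hom.hom_mult)
qed

text \<open>
  The sequence from which \<open>u\<close> arises by adding \<open>Q\<close> times the sum of the preceding terms.
\<close>

definition shift_seq :: "(nat \<Rightarrow> complex vec) \<Rightarrow> nat \<Rightarrow> complex vec" where
  "shift_seq u r = (case r of 0 \<Rightarrow> u 0 | Suc k \<Rightarrow> u (Suc k) - cmat Q *\<^sub>v u k)"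

lemma shift_seq_simps[simp]:
  "shift_seq u 0 = u 0" "shift_seq u (Suc k) = u (Suc k) - cmat Q *\<^sub>v u k"
  by (simp_all add: shift_seq_def)

lemma shift_seq_carrier: "(\<And>r. u r \<in> carrier_vec m) \<Longrightarrow> shift_seq u r \<in> carrier_vec m"
  by (cases r) simp_all

text \<open>
  As \<open>Q\<close> is a projection, \<open>u k = s k + Q (s 0 + ... + s (k - 1))\<close> implies \<open>Q u k = Q (s 0 + ... + s k)\<close>; so the partial
  sums can be replaced by the preceding term of \<open>u\<close>.
\<close>

lemma shift_seq_iff:
  assumes u: "\<And>r. u r \<in> carrier_vec m" and s: "\<And>r. s r \<in> carrier_vec m"
  shows "u 0 = s 0 \<and> (\<forall>k\<ge>1. u k = s k + cmat Q *\<^sub>v vec_sum m s {..<k}) \<longleftrightarrow> (\<forall>r. shift_seq u r = s r)"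
    (is "?l \<longleftrightarrow> ?r")
proof
  have dim[simp]: "dim_vec (u r) = m" "dim_vec (s r) = m" for r using u[of r] s[of r] by auto
  have sum_c: "vec_sum m s {..<k} \<in> carrier_vec m" for k by (intro vec_sum_carrier s)
  have sum_Suc: "vec_sum m s {..<Suc k} = vec_sum m s {..<k} + s k" for k by (intro vec_sum_lessThan_Suc s)
  note [simp] = sum_c sum_c[THEN carrier_vecD]
  {
    assume l: ?l
    have Qu: "cmat Q *\<^sub>v u k = cmat Q *\<^sub>v vec_sum m s {..<Suc k}" for k
    proof (cases k)
      case 0
      then show ?thesis using l s by (simp add: sum_Suc[of 0])
    next
      case (Suc n)
      have "cmat Q *\<^sub>v u k = cmat Q *\<^sub>v (s k + cmat Q *\<^sub>v vec_sum m s {..<k})" using l Suc by simp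
      also have "\<dots> = cmat Q *\<^sub>v s k + cmat Q *\<^sub>v vec_sum m s {..<k}"
        using s by (simp add: mult_add_distrib_mat_vec[of _ m m] cQQ)
      also have "\<dots> = cmat Q *\<^sub>v vec_sum m s {..<Suc k}"
        using s by (simp add: sum_Suc mult_add_distrib_mat_vec[of _ m m] comm_add_vec[of _ m])
      finally show ?thesis .
    qed
    show ?r
    proof
      fix r
      show "shift_seq u r = s r"
      proof (cases r)
        case 0
        then show ?thesis using l by simp
      next
        case (Suc k)
        have "u (Suc k) = s (Suc k) + cmat Q *\<^sub>v u k" using l Qu by simp
        then have e: "u (Suc k) $ i = (s (Suc k) + cmat Q *\<^sub>v u k) $ i" for i by simp
        show ?thesis unfolding Suc shift_seq_simps by (intro eq_vecI) (simp_all add: e)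
      qed
    qed
  }
  {
    assume r: ?r
    have step: "u (Suc k) = s (Suc k) + cmat Q *\<^sub>v u k" for k
    proof (rule eq_vecI)
      fix i assume "i < dim_vec (s (Suc k) + cmat Q *\<^sub>v u k)"
      then show "u (Suc k) $ i = (s (Suc k) + cmat Q *\<^sub>v u k) $ i"
        using arg_cong[OF r[rule_format, of "Suc k"], of "\<lambda>v. v $ i"] by (simp add: diff_eq_eq)
    qed simp
    have Qu: "cmat Q *\<^sub>v u k = cmat Q *\<^sub>v vec_sum m s {..<Suc k}" for k
    proof (induction k)
      case 0
      then show ?case using r[rule_format, of 0] s by (simp add: sum_Suc[of 0])
    next
      case (Suc k)
      have "cmat Q *\<^sub>v u (Suc k) = cmat Q *\<^sub>v s (Suc k) + cmat Q *\<^sub>v u k"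
        using s u by (simp add: step mult_add_distrib_mat_vec[of _ m m] cQQ)
      also have "\<dots> = cmat Q *\<^sub>v vec_sum m s {..<Suc (Suc k)}"
        unfolding Suc sum_Suc[of "Suc k"] using s by (simp add: mult_add_distrib_mat_vec[of _ m m] comm_add_vec[of _ m])
      finally show ?case .
    qed
    show ?l
    proof (intro conjI allI impI)
      show "u 0 = s 0" using r[rule_format, of 0] by simp
      fix k :: nat assume "k \<ge> 1"
      then obtain n where n: "k = Suc n" by (cases k) auto
      show "u k = s k + cmat Q *\<^sub>v vec_sum m s {..<k}" unfolding n Qu[symmetric] by (rule step)
    qed
  }
qed

text \<open>
  The shifted recursion differs from the original one by \<open>(Am + A0 + A1 - I) Q u r = 0\<close>, and its coefficients
  factor through \<open>R\<close>, \<open>H\<close> and \<open>Gt\<close>.  The case \<open>r = 0\<close> is covered because \<open>Am (I - Q)\<close> does not see the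
  difference between \<open>u\<close> and its shift.
\<close>

lemma shift_seq_level:
  assumes u: "\<And>r. u r \<in> carrier_vec m"
  defines "v \<equiv> shift_seq u"
  shows "u (Suc r) - cmat Am *\<^sub>v u r - cmat A0 *\<^sub>v u (Suc r) - cmat A1 *\<^sub>v u (Suc (Suc r)) =
    cmat R *\<^sub>v (cmat H *\<^sub>v (v (Suc (Suc r)) - cmat Gt *\<^sub>v v (Suc r))) - cmat H *\<^sub>v (v (Suc r) - cmat Gt *\<^sub>v v r)"
proof -
  have vc: "v r \<in> carrier_vec m" for r unfolding v_def by (rule shift_seq_carrier[OF u])
  have dim[simp]: "dim_vec (u r) = m" "dim_vec (v r) = m" for r using u[of r] vc[of r] by auto
  have proj: "cmat Am *\<^sub>v v r - cmat Am *\<^sub>v (cmat Q *\<^sub>v v r) = cmat Am *\<^sub>v u r - cmat Am *\<^sub>v (cmat Q *\<^sub>v u r)"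
  proof (cases r)
    case 0
    then show ?thesis by (simp add: v_def)
  next
    case (Suc k)
    show ?thesis unfolding Suc v_def shift_seq_simps using u
      by (simp add: mult_minus_distrib_mat_vec[of _ m m] cQQ) (intro eq_vecI; simp)
  qed
  have lhs: "cmat R *\<^sub>v (cmat H *\<^sub>v (v (Suc (Suc r)) - cmat Gt *\<^sub>v v (Suc r))) =
      - (cmat A1 *\<^sub>v v (Suc (Suc r))) + (cmat A1 *\<^sub>v (cmat G *\<^sub>v v (Suc r)) - cmat A1 *\<^sub>v (cmat Q *\<^sub>v v (Suc r)))"
    using vc by (simp add: cR_H cGt mult_minus_distrib_mat_vec[of _ m m]) (intro eq_vecI; simp)
  have rhs: "cmat H *\<^sub>v (v (Suc r) - cmat Gt *\<^sub>v v r) =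
      cmat A0 *\<^sub>v v (Suc r) + cmat A1 *\<^sub>v (cmat G *\<^sub>v v (Suc r)) - v (Suc r)
      + (cmat Am *\<^sub>v u r - cmat Am *\<^sub>v (cmat Q *\<^sub>v u r))"
    unfolding proj[symmetric]
    using vc by (simp add: mult_minus_distrib_mat_vec[of "cmat H" m m] cH_Gt) (simp add: cH, intro eq_vecI; simp)
  show ?thesis unfolding lhs rhs
  proof (rule eq_vecI)
    let ?R = "- (cmat A1 *\<^sub>v v (Suc (Suc r))) + (cmat A1 *\<^sub>v (cmat G *\<^sub>v v (Suc r)) - cmat A1 *\<^sub>v (cmat Q *\<^sub>v v (Suc r)))
      - (cmat A0 *\<^sub>v v (Suc r) + cmat A1 *\<^sub>v (cmat G *\<^sub>v v (Suc r)) - v (Suc r)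
      + (cmat Am *\<^sub>v u r - cmat Am *\<^sub>v (cmat Q *\<^sub>v u r)))"
    show "dim_vec (u (Suc r) - cmat Am *\<^sub>v u r - cmat A0 *\<^sub>v u (Suc r) - cmat A1 *\<^sub>v u (Suc (Suc r))) = dim_vec ?R"
      by simp
    fix i assume "i < dim_vec ?R"
    then have i: "i < m" by simp
    have "(cmat Q *\<^sub>v u r) $ i = (cmat Am *\<^sub>v (cmat Q *\<^sub>v u r)) $ i +
        (cmat A0 *\<^sub>v (cmat Q *\<^sub>v u r)) $ i + (cmat A1 *\<^sub>v (cmat Q *\<^sub>v u r)) $ i"
      using arg_cong[OF cAQ[OF u[of r]], of "\<lambda>v. v $ i"] i by simp
    moreover have "(cmat A1 *\<^sub>v (cmat Q *\<^sub>v v (Suc r))) $ i = (cmat A1 *\<^sub>v (cmat Q *\<^sub>v u (Suc r))) $ i - (cmat A1 *\<^sub>v (cmat Q *\<^sub>v u r)) $ i"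
      unfolding v_def shift_seq_simps using u i by (simp add: mult_minus_distrib_mat_vec[of _ m m] cQQ)
    moreover have "(cmat A1 *\<^sub>v v (Suc (Suc r))) $ i = (cmat A1 *\<^sub>v u (Suc (Suc r))) $ i - (cmat A1 *\<^sub>v (cmat Q *\<^sub>v u (Suc r))) $ i"
      unfolding v_def shift_seq_simps using u i by (simp add: mult_minus_distrib_mat_vec[of _ m m])
    moreover have "(cmat A0 *\<^sub>v v (Suc r)) $ i = (cmat A0 *\<^sub>v u (Suc r)) $ i - (cmat A0 *\<^sub>v (cmat Q *\<^sub>v u r)) $ i"
      unfolding v_def shift_seq_simps using u i by (simp add: mult_minus_distrib_mat_vec[of _ m m])
    moreover have "v (Suc r) $ i = u (Suc r) $ i - (cmat Q *\<^sub>v u r) $ i"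
      unfolding v_def shift_seq_simps using i by simp
    ultimately show "(u (Suc r) - cmat Am *\<^sub>v u r - cmat A0 *\<^sub>v u (Suc r) - cmat A1 *\<^sub>v u (Suc (Suc r))) $ i = ?R $ i"
      using i by simp
  qed
qed

end

section \<open>The boundary equation\<close>

context shifted_qbd
begin

abbreviation N where "N \<equiv> 1\<^sub>m m - B - A1 * G"

lemma G_pow_bound:
  assumes x: "x \<in> carrier_vec m" and bd: "\<And>b. b < m \<Longrightarrow> x $ b \<le> c" and a: "a < m"
  shows "(G ^\<^sub>m r *\<^sub>v x) $ a \<le> c"
  using a
proof (induction r arbitrary: a)
  case 0
  then show ?case using x bd by simp
next
  case (Suc r)
  have nonneg: "0 \<le> G $$ (a, b)" if "b < m" for b
    using down.G_nonneg that Suc.prems by (auto simp: less_eq_mat_def)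
  have row: "(\<Sum>b<m. G $$ (a, b)) = 1"
    using arg_cong[OF G_ones, of "\<lambda>v. v $ a"] Suc.prems by (simp add: mat_vec_entry)
  have "(G ^\<^sub>m Suc r *\<^sub>v x) $ a = (\<Sum>b<m. G $$ (a, b) * (G ^\<^sub>m r *\<^sub>v x) $ b)"
    unfolding pow_mat_Suc_left[OF G] using x Suc.prems
    by (simp add: assoc_mult_mat_vec[of G m m _ m] mat_vec_entry carrier_vecD[OF square_mult_vec_carrier[OF pow_carrier_mat[OF G]]]
        del: pow_mat_dim dim_mult_mat_vec)
  also have "\<dots> \<le> (\<Sum>b<m. G $$ (a, b) * c)"
    by (intro sum_mono mult_left_mono) (auto simp: Suc.IH nonneg)
  also have "\<dots> = c" using row by (simp add: sum_distrib_right[symmetric])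
  finally show ?case .
qed

text \<open>
  The function \<open>(r, a) \<mapsto> (G\<^sup>r x)\<^sub>a\<close> is harmonic for \<open>P\<close> and attains its maximum at level \<open>0\<close>, since \<open>G\<close> averages.
\<close>

lemma boundary_harmonic_const:
  assumes x: "x \<in> carrier_vec m" and eq: "B *\<^sub>v x + A1 *\<^sub>v (G *\<^sub>v x) = x" and b: "b < m"
  shows "x $ b = x $ 0"
proof -
  have m0: "0 < m" using m by simp
  have "finite (($) x ` {..<m})" "($) x ` {..<m} \<noteq> {}" using m0 by auto
  from Max_in[OF this] obtain c where c: "c < m" "x $ c = Max (($) x ` {..<m})" by force
  have mx: "x $ b \<le> x $ c" if "b < m" for b using that c(2) by simp
  define f where "f = (\<lambda>(r, a). (G ^\<^sub>m r *\<^sub>v x) $ a)"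
  have Gc: "G ^\<^sub>m r *\<^sub>v x \<in> carrier_vec m" for r by simp
  have GS: "G ^\<^sub>m Suc r *\<^sub>v x = G *\<^sub>v (G ^\<^sub>m r *\<^sub>v x)" for r
    unfolding pow_mat_Suc_left[OF G] using x by (simp add: assoc_mult_mat_vec[of G m m _ m])
  have f0: "f (0, a) = x $ a" for a using x by (simp add: f_def)
  have "f (0, b) = f (0, c)" if b: "b < m" for b
  proof (rule max_principle[where f = f and z = "(0, c)", OF stochastic])
    show "(0, c) \<in> qbd_states m" using c by (simp add: qbd_states_def)
    show "((0, c), (0, b)) \<in> (transition_graph (qbd_states m) (qbd_kernel m B Am A0 A1))\<^sup>*"
      using irreducible_P b c by (simp add: irreducible_on_def qbd_states_def)
    show "f y \<le> f (0, c)" if "y \<in> qbd_states m" for y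
      using that G_pow_bound[OF x mx] unfolding f0 by (auto simp: qbd_states_def f_def)
    fix y assume "y \<in> qbd_states m"
    then obtain r a where y: "y = (r, a)" "a < m" by (auto simp: qbd_states_def)
    have entry: "(X *\<^sub>v (G ^\<^sub>m k *\<^sub>v x)) $ a = (\<Sum>d<m. X $$ (a, d) * f (k, d))" if "X \<in> carrier_mat m m" for X k
      using that y(2) carrier_vecD[OF Gc] by (simp add: mat_vec_entry f_def del: dim_mult_mat_vec pow_mat_dim)
    show "\<exists>s. ((\<lambda>w. qbd_kernel m B Am A0 A1 y w * f w) has_sum s) (qbd_states m) \<and> f y \<le> s"
    proof (cases r)
      case 0
      have "f y = (B *\<^sub>v (G ^\<^sub>m 0 *\<^sub>v x)) $ a + (A1 *\<^sub>v (G ^\<^sub>m 1 *\<^sub>v x)) $ a"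
        using arg_cong[OF eq, of "\<lambda>v. v $ a"] x y 0 by (simp add: f0)
      then have "f y = (\<Sum>d<m. B $$ (a, d) * f (0, d)) + (\<Sum>d<m. A1 $$ (a, d) * f (1, d))"
        unfolding entry[OF B] entry[OF A1] .
      then show ?thesis using qbd_has_sum_0[OF y(2), of B Am A0 A1 f] y(1) 0 by auto
    next
      case (Suc k)
      have "f y = (G *\<^sub>v (G ^\<^sub>m k *\<^sub>v x)) $ a" unfolding y Suc f_def prod.case GS ..
      also have "\<dots> = (Am *\<^sub>v (G ^\<^sub>m k *\<^sub>v x)) $ a + (A0 *\<^sub>v (G ^\<^sub>m Suc k *\<^sub>v x)) $ a + (A1 *\<^sub>v (G ^\<^sub>m Suc (Suc k) *\<^sub>v x)) $ a"
        unfolding GS using arg_cong[OF solution_vec[OF Gc G Am A0 A1 G_eq, of k], of "\<lambda>v. v $ a"] y(2) by simp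
      finally have "f y = (\<Sum>d<m. Am $$ (a, d) * f (k, d)) + (\<Sum>d<m. A0 $$ (a, d) * f (Suc k, d))
          + (\<Sum>d<m. A1 $$ (a, d) * f (Suc (Suc k), d))"
        unfolding entry[OF Am] entry[OF A0] entry[OF A1] .
      then show ?thesis using qbd_has_sum_Suc[OF y(2), of B Am A0 A1 k f] y(1) Suc by auto
    qed
  qed
  from this[OF b] this[OF m0] show ?thesis by (simp add: f0)
qed

lemma cN: "z \<in> carrier_vec m \<Longrightarrow> cmat N *\<^sub>v z = z - cmat B *\<^sub>v z - cmat A1 *\<^sub>v (cmat G *\<^sub>v z)"
  by (simp add: cmat_simps square_simps)

lemma N_kernel:
  assumes x: "x \<in> carrier_vec m" and Nx: "cmat N *\<^sub>v x = 0\<^sub>v m" and b: "b < m"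
  shows "x $ b = x $ 0"
proof -
  have ent: "(cmat B *\<^sub>v x) $ a + (cmat A1 *\<^sub>v (cmat G *\<^sub>v x)) $ a = x $ a" if "a < m" for a
    using arg_cong[OF Nx[unfolded cN[OF x]], of "\<lambda>v. v $ a"] that x by (simp add: diff_diff_eq)
  have part: "map_vec f x $ b = map_vec f x $ 0"
    if f: "\<And>X z. X \<in> carrier_mat m m \<Longrightarrow> z \<in> carrier_vec m \<Longrightarrow> map_vec f (cmat X *\<^sub>v z) = X *\<^sub>v map_vec f z"
      "\<And>y z. f (y + z) = f y + f z" for f
  proof (rule boundary_harmonic_const[OF _ _ b])
    have "B *\<^sub>v map_vec f x + A1 *\<^sub>v (G *\<^sub>v map_vec f x) =
        map_vec f (cmat B *\<^sub>v x) + map_vec f (cmat A1 *\<^sub>v (cmat G *\<^sub>v x))"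
      using x by (simp add: f(1))
    also have "\<dots> = map_vec f x"
      using x arg_cong[OF ent, of _ f] by (intro eq_vecI) (simp_all add: f(2))
    finally show "B *\<^sub>v map_vec f x + A1 *\<^sub>v (G *\<^sub>v map_vec f x) = map_vec f x" .
  qed (use x in simp)
  have "map_vec Re x $ b = map_vec Re x $ 0"
    by (rule part) (auto intro!: eq_vecI simp: mat_vec_entry)
  moreover have "map_vec Im x $ b = map_vec Im x $ 0"
    by (rule part) (auto intro!: eq_vecI simp: mat_vec_entry)
  ultimately show ?thesis using x b m by (simp add: complex_eq_iff)
qed

lemma pi0_N:
  assumes pi0: "pi0 \<in> carrier_vec m" "transpose_mat N *\<^sub>v pi0 = 0\<^sub>v m" and z: "z \<in> carrier_vec m"
  shows "cvec pi0 \<bullet> (cmat N *\<^sub>v z) = 0"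
proof -
  have Nc: "N \<in> carrier_mat m m" by simp
  have "cvec pi0 \<bullet> (cmat N *\<^sub>v z) = (transpose_mat (cmat N) *\<^sub>v cvec pi0) \<bullet> z"
    using z pi0 Nc by (intro transpose_vec_mult_scalar[of _ m m, symmetric]) auto
  also have "transpose_mat (cmat N) *\<^sub>v cvec pi0 = cvec (transpose_mat N *\<^sub>v pi0)"
    using pi0(1) carrier_matD[OF Nc] by (intro eq_vecI) (simp_all add: mat_vec_entry)
  finally show ?thesis using z pi0 by (simp add: of_real_hom.vec_hom_zero)
qed

text \<open>
  Fredholm alternative.  Instead of counting dimensions, \<open>N\<close> is made invertible by adding the rank-one
  matrix \<open>1 \<pi>0\<^sup>T\<close>; for right-hand sides annihilated by \<open>\<pi>0\<close> the solution does not feel the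
  perturbation, because \<open>\<pi>0\<^sup>T 1 > 0\<close>.
\<close>

lemma N_solvable:
  assumes pi0: "pi0 \<in> carrier_vec m" "pi0 \<noteq> 0\<^sub>v m" "0\<^sub>v m \<le> pi0" "transpose_mat N *\<^sub>v pi0 = 0\<^sub>v m"
    and b: "b \<in> carrier_vec m"
  shows "(\<exists>x\<in>carrier_vec m. cmat N *\<^sub>v x = b) \<longleftrightarrow> cvec pi0 \<bullet> b = 0"
proof
  assume "\<exists>x\<in>carrier_vec m. cmat N *\<^sub>v x = b"
  then show "cvec pi0 \<bullet> b = 0" using pi0_N[OF pi0(1,4)] by blast
next
  assume b0: "cvec pi0 \<bullet> b = 0"
  have Nc: "cmat N \<in> carrier_mat m m" by simp
  define w where "w = cvec pi0 \<bullet> cones m"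
  have w: "w \<noteq> 0"
  proof -
    have nonneg: "0 \<le> pi0 $ i" if "i < m" for i using pi0(1,3) that by (auto simp: less_eq_vec_def)
    obtain j where j: "j < m" "pi0 $ j \<noteq> 0" using pi0(1,2) by (metis carrier_vecD eq_vecI index_zero_vec)
    have "0 < (\<Sum>i<m. pi0 $ i)" 
      by (rule sum_pos2[of _ j]) (use nonneg j nonneg[OF j(1)] in \<open>auto simp: less_le\<close>)
    moreover have "w = complex_of_real (\<Sum>i<m. pi0 $ i)"
      using pi0(1) by (simp add: w_def scalar_prod_def atLeast0LessThan)
    ultimately show ?thesis by (simp only: of_real_eq_0_iff)
  qed
  define D where "D = cmat N + outer_prod (cones m) (cvec pi0)"
  have oc: "outer_prod (cones m) (cvec pi0) \<in> carrier_mat m m"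
    using outer_prod_carrier[of "cones m" "cvec pi0"] pi0(1) by simp
  have D: "D \<in> carrier_mat m m" using oc by (simp add: D_def)
  have D_vec: "D *\<^sub>v x = cmat N *\<^sub>v x + (cvec pi0 \<bullet> x) \<cdot>\<^sub>v cones m" if "x \<in> carrier_vec m" for x
    using that oc pi0(1) Nc unfolding D_def
    by (simp add: add_mult_distrib_mat_vec[OF Nc oc] outer_prod_mult_vec[of _ m])
  have pi_D: "cvec pi0 \<bullet> (D *\<^sub>v x) = (cvec pi0 \<bullet> x) * w" if x: "x \<in> carrier_vec m" for x
  proof -
    have "cvec pi0 \<bullet> (D *\<^sub>v x) = cvec pi0 \<bullet> (cmat N *\<^sub>v x) + cvec pi0 \<bullet> ((cvec pi0 \<bullet> x) \<cdot>\<^sub>v cones m)"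
      unfolding D_vec[OF x] using pi0(1) Nc by (intro scalar_prod_add_distrib[of _ m]) auto
    then show ?thesis using pi0(1) by (simp add: pi0_N[OF pi0(1,4) x] w_def)
  qed
  have reduce: "cmat N *\<^sub>v x = D *\<^sub>v x" if x: "x \<in> carrier_vec m" and px: "cvec pi0 \<bullet> (D *\<^sub>v x) = 0" for x
  proof -
    have "cvec pi0 \<bullet> x = 0" using px pi_D[OF x] w by simp
    then show ?thesis unfolding D_vec[OF x] using Nc by (intro eq_vecI) auto
  qed
  have ker: "x = 0\<^sub>v m" if x: "x \<in> carrier_vec m" "D *\<^sub>v x = 0\<^sub>v m" for x
  proof -
    have px: "cvec pi0 \<bullet> (D *\<^sub>v x) = 0" using x pi0(1) by simp
    have "cmat N *\<^sub>v x = 0\<^sub>v m" using reduce[OF x(1) px] x(2) by simp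
    then obtain c where const: "\<And>i. i < m \<Longrightarrow> x $ i = c" using N_kernel[OF x(1)] by blast
    have "cvec pi0 \<bullet> x = c * w"
      using x(1) pi0(1) by (simp add: scalar_prod_def w_def const sum_distrib_left mult.commute)
    then have "c = 0" using px pi_D[OF x(1)] w by simp
    then show ?thesis using const x(1) by (intro eq_vecI) auto
  qed
  obtain Y where Y: "Y \<in> carrier_mat m m" "D * Y = 1\<^sub>m m"
    using inverse_from_kernel[OF D ker] by blast
  have "D *\<^sub>v (Y *\<^sub>v b) = b" using D Y b by (simp add: assoc_mult_mat_vec[of _ m m _ m, symmetric])
  then have "cmat N *\<^sub>v (Y *\<^sub>v b) = b" using reduce[of "Y *\<^sub>v b"] Y(1) b0 by simp
  then show "\<exists>x\<in>carrier_vec m. cmat N *\<^sub>v x = b" using Y(1) by blast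
qed

end

section \<open>The Poisson equation as a first order recursion\<close>

context split_recursion
begin

lemma backward_0:
  assumes y: "y \<in> carrier_vec p"
  shows "backward y 0 = \<sigma> 1 + (L * V1i) *\<^sub>v y"
proof -
  have Gt_0: "Gt *\<^sub>v 0\<^sub>v m = 0\<^sub>v m" by (intro eq_vecI) (simp_all add: mat_vec_entry)
  have "backward y 0 = L *\<^sub>v (V1i *\<^sub>v y) - (K *\<^sub>v sum_V0 1 + K *\<^sub>v (F *\<^sub>v h 1))"
    using y by (simp add: backward_def free_part_rec mult_add_distrib_mat_vec[OF K])
  also have "\<dots> = (L *\<^sub>v (E *\<^sub>v h 1) - (L *\<^sub>v (E *\<^sub>v h 1) + K *\<^sub>v (F *\<^sub>v h 1)) - K *\<^sub>v sum_V0 1) + L *\<^sub>v (V1i *\<^sub>v y)"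
    using y by (intro eq_vecI) simp_all
  also have "\<dots> = \<sigma> 1 + (L * V1i) *\<^sub>v y"
    using y conv_Gt_rec(2)[of 0] conv_V1i_rec(2)[of 0] decompose[OF h[of 1]]
    by (simp add: \<sigma>_split conv_Gt_rec(1) conv_V1i_rec(1) assoc_mult_mat_vec[OF L V1i] Gt_0)
  finally show ?thesis .
qed

lemma coordinates_pow:
  assumes z: "z \<in> carrier_vec m"
  shows "E *\<^sub>v (Gdd ^\<^sub>m n *\<^sub>v z) = V1 ^\<^sub>m n *\<^sub>v (E *\<^sub>v z)" "F *\<^sub>v (Gdd ^\<^sub>m n *\<^sub>v z) = V0 ^\<^sub>m n *\<^sub>v (F *\<^sub>v z)"
proof (induction n)
  case 0
  {
    case 1
    show ?case using z by simp
  next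
    case 2
    show ?case using z by simp
  }
next
  case (Suc n)
  have G: "Gdd ^\<^sub>m Suc n *\<^sub>v z = Gdd *\<^sub>v (Gdd ^\<^sub>m n *\<^sub>v z)"
    unfolding pow_mat_Suc_left[OF Gdd] using z by (simp add: assoc_mult_mat_vec[of _ m m _ m])
  {
    case 1
    show ?case unfolding G pow_mat_Suc_left[OF V1]
      using z Suc by (simp add: E_F_Gdd assoc_mult_mat_vec[of _ p p _ p])
  next
    case 2
    show ?case unfolding G pow_mat_Suc_left[OF V0]
      using z Suc by (simp add: E_F_Gdd assoc_mult_mat_vec[of _ k k _ k])
  }
qed

end

context shifted_qbd
begin

text \<open>
  \<open>W = S\<^sup>-\<^sup>1\<close> conjugates \<open>R\<close> into \<open>Gdd\<close>.
\<close>

lemma lift_W: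
  assumes W: "W \<in> carrier_mat m m" "S * W = 1\<^sub>m m" "W * S = 1\<^sub>m m" and z: "z \<in> carrier_vec m"
  shows "cmat S *\<^sub>v (cmat W *\<^sub>v z) = z" "cmat W *\<^sub>v (cmat S *\<^sub>v z) = z"
    "cmat Gdd *\<^sub>v (cmat W *\<^sub>v z) = cmat W *\<^sub>v (cmat R *\<^sub>v z)"
proof -
  have Sc: "cmat S \<in> carrier_mat m m" and Wc: "cmat W \<in> carrier_mat m m" using W(1) by simp_all
  have "cmat S * cmat W = 1\<^sub>m m" using arg_cong[OF W(2), of cmat] cmat_simps(3)[OF S W(1)] cmat_simps(4) by simp
  from arg_cong[OF this, of "\<lambda>X. X *\<^sub>v z"] show SW: "cmat S *\<^sub>v (cmat W *\<^sub>v z) = z"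
    using z by (simp add: assoc_mult_mat_vec[OF Sc Wc])
  have WS_eq: "cmat W * cmat S = 1\<^sub>m m" using arg_cong[OF W(3), of cmat] cmat_simps(3)[OF W(1) S] cmat_simps(4) by simp
  have WS: "cmat W *\<^sub>v (cmat S *\<^sub>v y) = y" if "y \<in> carrier_vec m" for y
    using that arg_cong[OF WS_eq, of "\<lambda>X. X *\<^sub>v y"] by (simp add: assoc_mult_mat_vec[OF Wc Sc])
  show "cmat W *\<^sub>v (cmat S *\<^sub>v z) = z" using WS[OF z] .
  have "cmat Gdd *\<^sub>v (cmat W *\<^sub>v z) = cmat W *\<^sub>v (cmat S *\<^sub>v (cmat Gdd *\<^sub>v (cmat W *\<^sub>v z)))"
    by (rule WS[symmetric]) simp
  also have "\<dots> = cmat W *\<^sub>v (cmat R *\<^sub>v z)"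
    unfolding cS_Gdd[OF square_mult_vec_carrier[OF Wc]] SW ..
  finally show "cmat Gdd *\<^sub>v (cmat W *\<^sub>v z) = cmat W *\<^sub>v (cmat R *\<^sub>v z)" .
qed

lemma lift_W_pow:
  assumes W: "W \<in> carrier_mat m m" "S * W = 1\<^sub>m m" "W * S = 1\<^sub>m m" and z: "z \<in> carrier_vec m"
  shows "cmat Gdd ^\<^sub>m n *\<^sub>v (cmat W *\<^sub>v z) = cmat W *\<^sub>v (cmat R ^\<^sub>m n *\<^sub>v z)"
  using z
proof (induction n arbitrary: z)
  case 0
  then show ?case using W(1) by simp
next
  case (Suc n)
  have "cmat Gdd ^\<^sub>m Suc n *\<^sub>v (cmat W *\<^sub>v z) = cmat Gdd ^\<^sub>m n *\<^sub>v (cmat Gdd *\<^sub>v (cmat W *\<^sub>v z))"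
    using W(1) by (simp add: assoc_mult_mat_vec[of _ m m _ m])
  also have "\<dots> = cmat W *\<^sub>v (cmat R ^\<^sub>m n *\<^sub>v (cmat R *\<^sub>v z))"
    unfolding lift_W(3)[OF W Suc.prems] by (rule Suc.IH) simp
  also have "\<dots> = cmat W *\<^sub>v (cmat R ^\<^sub>m Suc n *\<^sub>v z)"
    using Suc.prems by (simp add: assoc_mult_mat_vec[of _ m m _ m])
  finally show ?case .
qed

lemma cH_inject:
  assumes "x \<in> carrier_vec m" "y \<in> carrier_vec m" "cmat H *\<^sub>v x = cmat H *\<^sub>v y"
  shows "x = y"
proof -
  have Hc: "H \<in> carrier_mat m m" by simp
  have HiH: "cmat Hi * cmat H = 1\<^sub>m m" using arg_cong[OF Hi_H, of cmat] cmat_simps(3)[OF Hi Hc] cmat_simps(4) by simp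
  have inv: "cmat Hi *\<^sub>v (cmat H *\<^sub>v z) = z" if z: "z \<in> carrier_vec m" for z
  proof -
    have "cmat Hi *\<^sub>v (cmat H *\<^sub>v z) = (cmat Hi * cmat H) *\<^sub>v z"
      by (rule assoc_mult_mat_vec[of _ m m _ m, symmetric]) (simp_all add: z)
    then show ?thesis unfolding HiH using z by simp
  qed
  have "x = cmat Hi *\<^sub>v (cmat H *\<^sub>v x)" by (rule inv[symmetric, OF assms(1)])
  also have "\<dots> = y" unfolding assms(3) by (rule inv[OF assms(2)])
  finally show ?thesis .
qed

lemma boundary_rhs:
  assumes Bt: "Bt = B + A1 * Q" and z: "z \<in> carrier_vec m"
  shows "cmat ((Bt - 1\<^sub>m m) * Gdd + A1) *\<^sub>v z = cmat B *\<^sub>v (cmat Gdd *\<^sub>v z)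
    + cmat A1 *\<^sub>v (cmat Q *\<^sub>v (cmat Gdd *\<^sub>v z)) - cmat Gdd *\<^sub>v z + cmat A1 *\<^sub>v z"
  using z by (simp add: Bt cmat_simps square_simps)

text \<open>
  With \<open>\<delta> r = H (v (r + 1) - Gt v r)\<close> the inner levels read \<open>R \<delta> (r + 1) - \<delta> r = g (r + 1)\<close>; the witness is \<open>d r = W \<delta> r\<close>, and
  \<open>\<delta> r = S d r = H (d r - Gt Gdd d r)\<close> gives the forward recursion after cancelling \<open>H\<close>.
\<close>

lemma poisson_iff_recursion:
  fixes u g :: "nat \<Rightarrow> complex vec"
  assumes W: "W \<in> carrier_mat m m" "S * W = 1\<^sub>m m" "W * S = 1\<^sub>m m" and Bt: "Bt = B + A1 * Q"
    and u: "\<And>r. u r \<in> carrier_vec m" and g: "\<And>r. g r \<in> carrier_vec m"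
  defines "v \<equiv> shift_seq u"
  shows "poisson_equation (qbd_states m) (qbd_kernel m B Am A0 A1) (\<lambda>(r, a). u r $ a) (\<lambda>(r, a). g r $ a) \<longleftrightarrow>
    (\<exists>d. (\<forall>r. d r \<in> carrier_vec m \<and> cmat Gdd *\<^sub>v d (Suc r) = d r + cmat W *\<^sub>v g (Suc r) \<and>
      v (Suc r) = d r + cmat Gt *\<^sub>v (v r - cmat Gdd *\<^sub>v d r)) \<and>
      cmat N *\<^sub>v (v 0 - cmat Gdd *\<^sub>v d 0) = g 0 + cmat ((Bt - 1\<^sub>m m) * Gdd + A1) *\<^sub>v d 0)"
    (is "_ \<longleftrightarrow> (\<exists>d. (\<forall>r. ?rec d r) \<and> ?lin d)")
proof -
  have v: "v r \<in> carrier_vec m" for r unfolding v_def by (rule shift_seq_carrier[OF u])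
  have Wc: "cmat W \<in> carrier_mat m m" using W(1) by simp
  have dim[simp]: "dim_vec (u r) = m" "dim_vec (v r) = m" "dim_vec (g r) = m" "dim_row W = m" for r
    using u[of r] v[of r] g[of r] W(1) by auto
  define \<delta> where "\<delta> r = cmat H *\<^sub>v (v (Suc r) - cmat Gt *\<^sub>v v r)" for r
  have \<delta>: "\<delta> r \<in> carrier_vec m" for r unfolding \<delta>_def by (rule square_mult_vec_carrier) simp
  note [simp] = carrier_vecD[OF \<delta>]
  have level: "u (Suc r) - cmat Am *\<^sub>v u r - cmat A0 *\<^sub>v u (Suc r) - cmat A1 *\<^sub>v u (Suc (Suc r)) =
      cmat R *\<^sub>v \<delta> (Suc r) - \<delta> r" for r
    unfolding \<delta>_def v_def by (rule shift_seq_level[OF u])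
  have inner: "(\<forall>r. u (Suc r) - cmat Am *\<^sub>v u r - cmat A0 *\<^sub>v u (Suc r) - cmat A1 *\<^sub>v u (Suc (Suc r)) = g (Suc r)) \<longleftrightarrow>
      (\<forall>r. cmat R *\<^sub>v \<delta> (Suc r) - \<delta> r = g (Suc r))"
    by (simp only: level)
  have zero: "u 0 - cmat B *\<^sub>v u 0 - cmat A1 *\<^sub>v u 1 = g 0 \<longleftrightarrow> ?lin d" if d: "\<And>r. ?rec d r" for d
  proof -
    define x where "x = v 0 - cmat Gdd *\<^sub>v d 0"
    have d0: "d 0 \<in> carrier_vec m" using d[of 0] by blast
    have x: "x \<in> carrier_vec m" using v by (simp add: x_def)
    note [simp] = carrier_vecD[OF d0] carrier_vecD[OF x]
    have v1: "v (Suc 0) = d 0 + cmat Gt *\<^sub>v x" using d[of 0] by (simp add: x_def)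
    have u0: "u 0 = x + cmat Gdd *\<^sub>v d 0" by (intro eq_vecI) (simp_all add: x_def v_def)
    have "v (Suc 0) = u (Suc 0) - cmat Q *\<^sub>v u 0" by (simp add: v_def)
    then have "u (Suc 0) = v (Suc 0) + cmat Q *\<^sub>v u 0" by (intro eq_vecI) simp_all
    then have u1: "u (Suc 0) = d 0 + (cmat G *\<^sub>v x - cmat Q *\<^sub>v x) + cmat Q *\<^sub>v (x + cmat Gdd *\<^sub>v d 0)"
      using x by (simp add: v1 u0 cGt)
    have A1u1: "cmat A1 *\<^sub>v u (Suc 0) = cmat A1 *\<^sub>v d 0 + cmat A1 *\<^sub>v (cmat G *\<^sub>v x) + cmat A1 *\<^sub>v (cmat Q *\<^sub>v (cmat Gdd *\<^sub>v d 0))"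
      using d0 x by (simp add: u1 square_simps) (intro eq_vecI; simp)
    have Bu0: "cmat B *\<^sub>v u 0 = cmat B *\<^sub>v x + cmat B *\<^sub>v (cmat Gdd *\<^sub>v d 0)"
      using d0 x by (simp add: u0 square_simps)
    have veq: "a = b \<longleftrightarrow> (\<forall>i<m. a $ i = b $ i)" if "dim_vec a = m" "dim_vec b = m" for a b :: "complex vec"
      using that by (auto intro: eq_vecI)
    show ?thesis
      unfolding One_nat_def x_def[symmetric] cN[OF x] boundary_rhs[OF Bt d0] A1u1 Bu0 unfolding u0
      by (subst (1 2) veq) (simp_all add: algebra_simps)
  qed
  have inner_iff: "(\<forall>r. cmat R *\<^sub>v \<delta> (Suc r) - \<delta> r = g (Suc r)) \<longleftrightarrow> (\<exists>d. \<forall>r. ?rec d r)"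
  proof
    assume l: "\<forall>r. cmat R *\<^sub>v \<delta> (Suc r) - \<delta> r = g (Suc r)"
    define d where "d r = cmat W *\<^sub>v \<delta> r" for r
    have d: "d r \<in> carrier_vec m" for r unfolding d_def using Wc by (rule square_mult_vec_carrier)
    note [simp] = carrier_vecD[OF d]
    have "?rec d r" for r
    proof (intro conjI d)
      have e: "(cmat R *\<^sub>v \<delta> (Suc r) - \<delta> r) $ i = g (Suc r) $ i" for i using l by simp
      have "cmat R *\<^sub>v \<delta> (Suc r) = \<delta> r + g (Suc r)"
      proof (rule eq_vecI)
        fix i assume "i < dim_vec (\<delta> r + g (Suc r))"
        then show "(cmat R *\<^sub>v \<delta> (Suc r)) $ i = (\<delta> r + g (Suc r)) $ i" using e[of i] by (simp add: diff_eq_eq add.commute)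
      qed simp
      then show "cmat Gdd *\<^sub>v d (Suc r) = d r + cmat W *\<^sub>v g (Suc r)"
        unfolding d_def lift_W(3)[OF W \<delta>] using Wc \<delta> g by (simp add: mult_add_distrib_mat_vec[of _ m m])
      have "cmat H *\<^sub>v (v (Suc r) - cmat Gt *\<^sub>v v r) = cmat S *\<^sub>v d r"
        unfolding d_def lift_W(1)[OF W \<delta>] by (rule \<delta>_def[symmetric])
      also have "\<dots> = cmat H *\<^sub>v (d r - cmat Gt *\<^sub>v (cmat Gdd *\<^sub>v d r))" by (rule cS[OF d])
      finally have "v (Suc r) - cmat Gt *\<^sub>v v r = d r - cmat Gt *\<^sub>v (cmat Gdd *\<^sub>v d r)"
        by (rule cH_inject[rotated 2]) (simp_all add: v d)
      then have e: "(v (Suc r) - cmat Gt *\<^sub>v v r) $ i = (d r - cmat Gt *\<^sub>v (cmat Gdd *\<^sub>v d r)) $ i" for i by simp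
      show "v (Suc r) = d r + cmat Gt *\<^sub>v (v r - cmat Gdd *\<^sub>v d r)"
      proof (rule eq_vecI)
        fix i assume "i < dim_vec (d r + cmat Gt *\<^sub>v (v r - cmat Gdd *\<^sub>v d r))"
        then show "v (Suc r) $ i = (d r + cmat Gt *\<^sub>v (v r - cmat Gdd *\<^sub>v d r)) $ i"
          using e[of i] v by (simp add: mult_minus_distrib_mat_vec[of _ m m] algebra_simps)
      qed simp
    qed
    then show "\<exists>d. \<forall>r. ?rec d r" by blast
  next
    assume "\<exists>d. \<forall>r. ?rec d r"
    then obtain d where d: "\<And>r. d r \<in> carrier_vec m"
      and d_rec: "\<And>r. cmat Gdd *\<^sub>v d (Suc r) = d r + cmat W *\<^sub>v g (Suc r)"
      and v_rec: "\<And>r. v (Suc r) = d r + cmat Gt *\<^sub>v (v r - cmat Gdd *\<^sub>v d r)" by blast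
    note [simp] = carrier_vecD[OF d]
    have \<delta>_d: "\<delta> r = cmat S *\<^sub>v d r" for r
    proof -
      have "v (Suc r) - cmat Gt *\<^sub>v v r = d r - cmat Gt *\<^sub>v (cmat Gdd *\<^sub>v d r)"
        unfolding v_rec using v d by (simp add: mult_minus_distrib_mat_vec[of _ m m]) (intro eq_vecI; simp)
      then show ?thesis by (simp only: \<delta>_def cS[OF d])
    qed
    show "\<forall>r. cmat R *\<^sub>v \<delta> (Suc r) - \<delta> r = g (Suc r)"
    proof
      fix r
      have Sc: "cmat S \<in> carrier_mat m m" by simp
      have "cmat R *\<^sub>v \<delta> (Suc r) = cmat S *\<^sub>v (d r + cmat W *\<^sub>v g (Suc r))"
        unfolding \<delta>_d d_rec[symmetric] by (rule cS_Gdd[symmetric, OF d])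
      also have "\<dots> = \<delta> r + g (Suc r)"
        using d Wc by (simp only: mult_add_distrib_mat_vec[OF Sc] square_mult_vec_carrier lift_W(1)[OF W g] \<delta>_d)
      finally show "cmat R *\<^sub>v \<delta> (Suc r) - \<delta> r = g (Suc r)" by (intro eq_vecI) simp_all
    qed
  qed
  show ?thesis unfolding poisson_levels[OF u g] inner inner_iff using zero by blast
qed

end

section \<open>The general solution\<close>

lemma pow_mat_sum:
  fixes X :: "'a :: semiring_1 mat"
  assumes "X \<in> carrier_mat n n"
  shows "X ^\<^sub>m (k + l) = X ^\<^sub>m k * X ^\<^sub>m l"
  using assms by (induction l) (simp_all add: assoc_mult_mat[of _ n n _ n _ n])

theorem mainTheorem5:
  fixes m p \<nu> :: nat
    and B Am A0 A1 G Gh R Rh U Hh Q Gt Gdd W Bt :: "real mat"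
    and wG vGh wRh \<pi>0 :: "real vec"
    and M V1 V0 L K E F :: "complex mat"
    and g \<sigma> :: "nat \<Rightarrow> complex vec"
    and ut :: "complex vec \<Rightarrow> complex vec \<Rightarrow> nat \<Rightarrow> complex vec"
    and ystar :: "complex vec"
    and linsys :: "complex vec \<Rightarrow> complex vec \<Rightarrow> bool"
  assumes m: "m \<ge> 1"
    and dims: "B \<in> carrier_mat m m" "Am \<in> carrier_mat m m"
      "A0 \<in> carrier_mat m m" "A1 \<in> carrier_mat m m"
    and nonneg: "0\<^sub>m m m \<le> B" "0\<^sub>m m m \<le> Am" "0\<^sub>m m m \<le> A0" "0\<^sub>m m m \<le> A1"
    and stochastic: "row_stochastic (qbd_states m) (qbd_kernel m B Am A0 A1)"
    and irreducible_P: "irreducible_on (qbd_states m) (qbd_kernel m B Am A0 A1)"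
    and irreducible_A: "irreducible_on {..<m} (\<lambda>a b. (Am + A0 + A1) $$ (a, b))"
    and final: "single_final_class m Am A0 A1"
    and null_rec: "null_recurrent (qbd_states m) (qbd_kernel m B Am A0 A1)"
    and G: "minimal_nonneg_solution m (\<lambda>X. Am + (A0 - 1\<^sub>m m) * X + A1 * (X * X)) G"
    and Gh: "minimal_nonneg_solution m (\<lambda>X. A1 + (A0 - 1\<^sub>m m) * X + Am * (X * X)) Gh"
    and R: "minimal_nonneg_solution m (\<lambda>X. A1 + X * (A0 - 1\<^sub>m m) + X * X * Am) R"
    and Rh: "minimal_nonneg_solution m (\<lambda>X. Am + X * (A0 - 1\<^sub>m m) + X * X * A1) Rh"
    and U: "U = A0 + R * Am"
    and Hh: "Hh = A0 - 1\<^sub>m m + Am * Gh"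
    \<comment> \<open>right shift\<close>
    and wG: "eigenvector G wG 1" "0\<^sub>v m \<le> wG"
    and vGh: "eigenvector (transpose_mat Gh) vGh 1" "0\<^sub>v m \<le> vGh"
    and wRh: "eigenvector Rh wRh 1" "0\<^sub>v m \<le> wRh \<or> wRh \<le> 0\<^sub>v m"
    and normalization: "vGh \<bullet> wG = 1" "vGh \<bullet> (mat_inv Hh *\<^sub>v wRh) = -1"
    and Q: "Q = outer_prod wG vGh"
    and Gt: "Gt = G - Q"
    and Gdd: "Gdd = Gh + outer_prod (wG + mat_inv Hh *\<^sub>v wRh) vGh"
    and W: "W = mat_suminf m m (\<lambda>i. Gt ^\<^sub>m i * mat_inv (U - 1\<^sub>m m) * R ^\<^sub>m i)"
    and Bt: "Bt = B + A1 * Q"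
    \<comment> \<open>splitting of the shifted solution into its invertible and nilpotent parts\<close>
    and p: "p \<le> m"
    and V1: "V1 \<in> carrier_mat p p" "invertible_mat V1"
    and V0: "V0 \<in> carrier_mat (m - p) (m - p)" "p < m \<Longrightarrow> spectral_radius V0 = 0"
    and LK: "L \<in> carrier_mat m p" "K \<in> carrier_mat m (m - p)" "M = block_row L K"
    and EF: "E \<in> carrier_mat p m" "F \<in> carrier_mat (m - p) m" "mat_inv M = E @\<^sub>r F"
    and M: "invertible_mat M" "cmat Gdd * M = M * diag_block_mat [V1, V0]"
    and \<nu>: "\<nu> = (LEAST n. 0 < n \<and> V0 ^\<^sub>m n = 0\<^sub>m (m - p) (m - p))"
    and \<pi>0: "\<pi>0 \<in> carrier_vec m" "\<pi>0 \<noteq> 0\<^sub>v m" "0\<^sub>v m \<le> \<pi>0"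
      "transpose_mat (1\<^sub>m m - B - A1 * G) *\<^sub>v \<pi>0 = 0\<^sub>v m"
    \<comment> \<open>right-hand side of the Poisson equation\<close>
    and g: "\<And>r. g r \<in> carrier_vec m"
      "vec_summable m (\<lambda>k. cmat R ^\<^sub>m k *\<^sub>v g k)"
    \<comment> \<open>notation used in the conclusion\<close>
    and \<sigma>: "\<And>r. \<sigma> r =
      - vec_sum m (\<lambda>k. (cmat Gt ^\<^sub>m (r - k) - L * mat_inv V1 ^\<^sub>m (r - k) * E)
                           *\<^sub>v (cmat W *\<^sub>v g k)) {1..r}
      - vec_sum m (\<lambda>j. (K * V0 ^\<^sub>m j * F) *\<^sub>v (cmat W *\<^sub>v g (j + r))) {1..\<nu> - 1}"
    and ut: "\<And>x y r. ut x y r =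
      cmat Gt ^\<^sub>m r *\<^sub>v x + (L * mat_inv V1 ^\<^sub>m r) *\<^sub>v y + \<sigma> r"
    and linsys: "\<And>x y. linsys x y \<longleftrightarrow>
      cmat (1\<^sub>m m - B - A1 * G) *\<^sub>v x =
        g 0 + cmat ((Bt - 1\<^sub>m m) * Gdd + A1) *\<^sub>v (\<sigma> 1 + (L * mat_inv V1) *\<^sub>v y)"
    and ystar: "ystar =
      - vec_suminf p (\<lambda>k. (V1 ^\<^sub>m Suc k * E) *\<^sub>v (cmat W *\<^sub>v g (Suc k)))"
  shows
    "(\<forall>u. (\<forall>r. u r \<in> carrier_vec m) \<longrightarrow>
        (poisson_equation (qbd_states m) (qbd_kernel m B Am A0 A1)
            (\<lambda>(r, a). u r $ a) (\<lambda>(r, a). g r $ a) \<longleftrightarrow>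
         (\<exists>x \<in> carrier_vec m. \<exists>y \<in> carrier_vec p. linsys x y \<and>
            u 0 = ut x y 0 \<and>
            (\<forall>k\<ge>1. u k = ut x y k + cmat Q *\<^sub>v vec_sum m (ut x y) {..<k})))) \<and>
     vec_summable p (\<lambda>k. (V1 ^\<^sub>m Suc k * E) *\<^sub>v (cmat W *\<^sub>v g (Suc k))) \<and>
     (\<forall>y \<in> carrier_vec p.
        (\<exists>x \<in> carrier_vec m. linsys x y) \<longleftrightarrow>
        cvec \<pi>0 \<bullet> (cmat (mat_inv W) *\<^sub>v (L *\<^sub>v (y - ystar))) =
          cvec \<pi>0 \<bullet> vec_suminf m (\<lambda>k. cmat R ^\<^sub>m k *\<^sub>v g k))"
proof -
  interpret s: shifted_qbd m B Am A0 A1 G Gh R Rh U Hh Q Gt Gdd wG vGh wRh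
    by unfold_locales (rule m dims nonneg stochastic irreducible_P irreducible_A final G Gh R Rh U Hh
        wG vGh wRh normalization Q Gt Gdd)+
  note W_inv = s.W_inverse[OF W]
  have Wc: "cmat W \<in> carrier_mat m m" using W_inv(1) by simp
  have mat_inv_W: "mat_inv W = s.S"
    by (rule mat_inv_inverse[OF W_inv(1) s.S W_inv(3)])
  have m_split: "m = p + (m - p)" using p by simp
  have Mc: "M \<in> carrier_mat m m"
    unfolding LK(3) block_row_def using LK(1,2) p by (intro carrier_matI) auto
  note M_inv = mat_inv_invertible[OF Mc M(1)]
  note blocks = block_inverse[OF LK(1,2) EF(1,2) m_split M_inv(2,3)[unfolded LK(3) EF(3)[unfolded LK(3)]]]
  have Gdd_c: "cmat Gdd \<in> carrier_mat m m" by simp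
  note diag = block_diagonalization[OF LK(1,2) Gdd_c V1(1) V0(1) M(2)[unfolded LK(3)]]
  have nil: "0 < \<nu> \<and> V0 ^\<^sub>m \<nu> = 0\<^sub>m (m - p) (m - p)"
  proof -
    obtain n where "0 < n \<and> V0 ^\<^sub>m n = 0\<^sub>m (m - p) (m - p)"
      using spectral_radius_0_nilpotent[OF V0(1)] V0(2) by auto
    then show ?thesis unfolding \<nu> by (rule LeastI)
  qed
  note V1_inv = mat_inv_invertible[OF V1]
  define h where "h r = cmat W *\<^sub>v g r" for r
  have h_c: "h r \<in> carrier_vec m" for r unfolding h_def using Wc by (rule square_mult_vec_carrier)
  interpret r: split_recursion m p "m - p" \<nu> "cmat Gt" "cmat Gdd" V1 "mat_inv V1" V0 L K E F h \<sigma> ut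
    by unfold_locales
      (use LK(1,2) EF(1,2) V1(1) V0(1) V1_inv blocks diag nil h_c \<sigma> ut in \<open>simp_all add: h_def\<close>)
  let ?rhs = "cmat ((Bt - 1\<^sub>m m) * Gdd + A1)"
  have linsys_e: "linsys x y \<longleftrightarrow> cmat s.N *\<^sub>v x = g 0 + ?rhs *\<^sub>v r.backward y 0" if "y \<in> carrier_vec p" for x y
    unfolding linsys r.backward_0[OF that] ..

  \<comment> \<open>\<open>\<tau>\<close> is the sum over \<open>k \<ge> 1\<close> of \<open>R\<^sup>k g\<^sub>k\<close>; both \<open>ystar\<close> and the nilpotent part of \<open>\<sigma>\<close> at level \<open>0\<close> are images of \<open>W \<tau>\<close>.\<close>
  define a where "a k = cmat R ^\<^sub>m k *\<^sub>v g k" for k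
  have a: "a k \<in> carrier_vec m" for k unfolding a_def by (rule square_mult_vec_carrier) simp
  have a_sum: "vec_summable m a" using g(2) unfolding a_def[abs_def] .
  define \<rho> where "\<rho> = vec_suminf m a"
  define \<tau> where "\<tau> = vec_suminf m (\<lambda>k. a (Suc k))"
  have \<rho>: "\<rho> = g 0 + \<tau>"
    unfolding \<rho>_def \<tau>_def using vec_sums_Suc(2)[OF a a_sum] g(1)[of 0] by (simp add: a_def)
  have \<tau>_c: "\<tau> \<in> carrier_vec m" by (simp add: \<tau>_def)
  note tail = vec_sums_Suc(1)[OF a a_sum]
  have Gdd_h: "cmat Gdd ^\<^sub>m k *\<^sub>v h k = cmat W *\<^sub>v a k" for k
    unfolding h_def a_def by (rule s.lift_W_pow[OF W_inv g(1)])
  have EW: "E * cmat W \<in> carrier_mat p m" and FW: "F * cmat W \<in> carrier_mat (m - p) m"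
    using mult_carrier_mat[OF EF(1) Wc] mult_carrier_mat[OF EF(2) Wc] .
  have V1_term: "(V1 ^\<^sub>m Suc k * E) *\<^sub>v (cmat W *\<^sub>v g (Suc k)) = (E * cmat W) *\<^sub>v a (Suc k)" for k
  proof -
    have V: "V1 ^\<^sub>m Suc k \<in> carrier_mat p p" using V1(1) by (rule pow_carrier_mat)
    have "(V1 ^\<^sub>m Suc k * E) *\<^sub>v (cmat W *\<^sub>v g (Suc k)) = V1 ^\<^sub>m Suc k *\<^sub>v (E *\<^sub>v h (Suc k))"
      unfolding h_def[symmetric] by (rule assoc_mult_mat_vec[OF V EF(1) h_c])
    also have "\<dots> = E *\<^sub>v (cmat W *\<^sub>v a (Suc k))"
      unfolding r.coordinates_pow(1)[OF h_c, symmetric] Gdd_h ..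
    also have "\<dots> = (E * cmat W) *\<^sub>v a (Suc k)" by (rule assoc_mult_mat_vec[OF EF(1) Wc a, symmetric])
    finally show ?thesis .
  qed
  have summable: "vec_summable p (\<lambda>k. (V1 ^\<^sub>m Suc k * E) *\<^sub>v (cmat W *\<^sub>v g (Suc k)))"
    unfolding V1_term by (rule vec_sums_mult(1)[OF EW a tail])
  have ystar_\<tau>: "ystar = - (E *\<^sub>v (cmat W *\<^sub>v \<tau>))"
    unfolding ystar V1_term vec_sums_mult(2)[OF EW a tail] \<tau>_def[symmetric]
    by (simp only: assoc_mult_mat_vec[OF EF(1) Wc \<tau>_c])
  have F_\<tau>: "F *\<^sub>v (cmat W *\<^sub>v \<tau>) = r.sum_V0 0"
  proof -
    define b where "b k = V0 ^\<^sub>m k *\<^sub>v (F *\<^sub>v h k)" for k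
    have b: "b k \<in> carrier_vec (m - p)" for k
      unfolding b_def using V0(1) by (intro square_mult_vec_carrier) simp
    have b_a: "(F * cmat W) *\<^sub>v a k = b k" for k
      unfolding b_def r.coordinates_pow(2)[OF h_c, symmetric] Gdd_h by (rule assoc_mult_mat_vec[OF EF(2) Wc a])
    have b_0: "b (Suc k) = 0\<^sub>v (m - p)" if k: "\<nu> - 1 \<le> k" for k
    proof -
      define n where "n = Suc k - \<nu>"
      have n: "Suc k = n + \<nu>" using k conjunct1[OF nil] by (simp add: n_def)
      have "V0 ^\<^sub>m Suc k = V0 ^\<^sub>m n * V0 ^\<^sub>m \<nu>" unfolding n using V0(1) by (rule pow_mat_sum)
      also have "\<dots> = 0\<^sub>m (m - p) (m - p)" unfolding conjunct2[OF nil] using V0(1) by simp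
      finally show ?thesis unfolding b_def by (intro eq_vecI) (simp_all add: mat_vec_entry)
    qed
    have "F *\<^sub>v (cmat W *\<^sub>v \<tau>) = (F * cmat W) *\<^sub>v \<tau>" by (rule assoc_mult_mat_vec[OF EF(2) Wc \<tau>_c, symmetric])
    also have "\<dots> = vec_suminf (m - p) (\<lambda>k. (F * cmat W) *\<^sub>v a (Suc k))"
      unfolding \<tau>_def by (rule vec_sums_mult(2)[OF FW a tail, symmetric])
    also have "\<dots> = vec_sum (m - p) b {1..\<nu> - 1}"
      unfolding b_a by (rule vec_suminf_finite[where f = b and r = "\<nu> - 1", OF b b_0])
    also have "\<dots> = r.sum_V0 0" by (simp add: r.sum_V0_def b_def[abs_def])
    finally show ?thesis .
  qed

  show ?thesis
  proof (intro conjI allI impI ballI)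
    fix u :: "nat \<Rightarrow> complex vec" assume u: "\<forall>r. u r \<in> carrier_vec m"
    then have uc: "u r \<in> carrier_vec m" for r by simp
    note v = s.shift_seq_carrier[of u, OF uc]
    have "poisson_equation (qbd_states m) (qbd_kernel m B Am A0 A1) (\<lambda>(r, a). u r $ a) (\<lambda>(r, a). g r $ a) \<longleftrightarrow>
      (\<exists>x\<in>carrier_vec m. \<exists>y\<in>carrier_vec p. (\<forall>r. s.shift_seq u r = ut x y r) \<and>
        cmat s.N *\<^sub>v x = g 0 + ?rhs *\<^sub>v r.backward y 0)"
      unfolding s.poisson_iff_recursion[OF W_inv Bt uc g(1)] h_def[symmetric]
      by (rule r.recursion_solutions[OF v])
    also have "\<dots> \<longleftrightarrow> (\<exists>x\<in>carrier_vec m. \<exists>y\<in>carrier_vec p. linsys x y \<and> u 0 = ut x y 0 \<and>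
        (\<forall>k\<ge>1. u k = ut x y k + cmat Q *\<^sub>v vec_sum m (ut x y) {..<k}))"
    proof (intro bex_cong refl)
      fix x y :: "complex vec" assume xy: "x \<in> carrier_vec m" "y \<in> carrier_vec p"
      show "(\<forall>r. s.shift_seq u r = ut x y r) \<and> cmat s.N *\<^sub>v x = g 0 + ?rhs *\<^sub>v r.backward y 0 \<longleftrightarrow>
        linsys x y \<and> u 0 = ut x y 0 \<and> (\<forall>k\<ge>1. u k = ut x y k + cmat Q *\<^sub>v vec_sum m (ut x y) {..<k})"
        unfolding s.shift_seq_iff[OF uc r.ut_carrier[OF xy], symmetric] linsys_e[OF xy(2)] by blast
    qed
    finally show "poisson_equation (qbd_states m) (qbd_kernel m B Am A0 A1) (\<lambda>(r, a). u r $ a) (\<lambda>(r, a). g r $ a) =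
        (\<exists>x\<in>carrier_vec m. \<exists>y\<in>carrier_vec p. linsys x y \<and> u 0 = ut x y 0 \<and>
        (\<forall>k\<ge>1. u k = ut x y k + cmat Q *\<^sub>v vec_sum m (ut x y) {..<k}))" .
  next
    show "vec_summable p (\<lambda>k. (V1 ^\<^sub>m Suc k * E) *\<^sub>v (cmat W *\<^sub>v g (Suc k)))" by (rule summable)
  next
    fix y :: "complex vec" assume y: "y \<in> carrier_vec p"
    let ?e = "r.backward y 0"
    let ?b = "g 0 + ?rhs *\<^sub>v ?e"
    let ?pi = "cvec \<pi>0"
    have pi: "?pi \<in> carrier_vec m" using \<pi>0(1) by simp
    have N_c: "s.N \<in> carrier_mat m m" by simp
    have rhs_c: "?rhs *\<^sub>v ?e \<in> carrier_vec m"
      unfolding s.boundary_rhs[OF Bt r.backward_carrier] by simp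
    have b: "?b \<in> carrier_vec m" using g(1) rhs_c by simp
    have S_e: "cmat s.S *\<^sub>v (cmat Gdd *\<^sub>v ?e) \<in> carrier_vec m"
      by (rule square_mult_vec_carrier) simp
    have "(\<exists>x\<in>carrier_vec m. linsys x y) \<longleftrightarrow> (\<exists>x\<in>carrier_vec m. cmat s.N *\<^sub>v x = ?b)"
      using linsys_e[OF y] by simp
    also have "\<dots> \<longleftrightarrow> ?pi \<bullet> ?b = 0"
      by (rule s.N_solvable[OF \<pi>0(1,2,3,4) b])
    also have "?pi \<bullet> ?b = ?pi \<bullet> g 0 - ?pi \<bullet> (cmat s.S *\<^sub>v (cmat Gdd *\<^sub>v ?e))"
    proof -
      \<comment> \<open>\<open>\<pi>\<^sub>0\<close> kills the range of \<open>N\<close>, so only \<open>A\<^sub>1 (I - Gt Gdd) d\<^sub>0 = - R S d\<^sub>0 = - S Gdd d\<^sub>0\<close> contributes.\<close>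
      let ?y = "cmat Gdd *\<^sub>v ?e"
      have yc: "?y \<in> carrier_vec m" by simp
      have "cmat s.S *\<^sub>v ?y = - (cmat A1 *\<^sub>v (?e - cmat Gt *\<^sub>v ?y))"
        unfolding s.cS_Gdd[OF r.backward_carrier] s.cS[OF r.backward_carrier] by (rule s.cR_H) simp
      also have "\<dots> = - (cmat A1 *\<^sub>v ?e - (cmat A1 *\<^sub>v (cmat G *\<^sub>v ?y) - cmat A1 *\<^sub>v (cmat Q *\<^sub>v ?y)))"
        unfolding s.cGt[OF yc] by (simp add: s.square_simps)
      finally have "?rhs *\<^sub>v ?e = - (cmat s.N *\<^sub>v ?y) - cmat s.S *\<^sub>v ?y"
        unfolding s.boundary_rhs[OF Bt r.backward_carrier] s.cN[OF yc] by (intro eq_vecI) simp_all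
      also have "?pi \<bullet> \<dots> = ?pi \<bullet> (- (cmat s.N *\<^sub>v ?y)) - ?pi \<bullet> (cmat s.S *\<^sub>v ?y)"
        using pi S_e N_c by (intro scalar_prod_minus_distrib[of _ m]) auto
      also have "?pi \<bullet> (- (cmat s.N *\<^sub>v ?y)) = 0"
        using pi s.pi0_N[OF \<pi>0(1,4) yc] by simp
      finally have "?pi \<bullet> (?rhs *\<^sub>v ?e) = - (?pi \<bullet> (cmat s.S *\<^sub>v ?y))" by simp
      then show ?thesis using scalar_prod_add_distrib[OF pi g(1) rhs_c] by simp
    qed
    also have "\<dots> = 0 \<longleftrightarrow> ?pi \<bullet> (cmat (mat_inv W) *\<^sub>v (L *\<^sub>v (y - ystar))) = ?pi \<bullet> \<rho>"
    proof -
      have Wt: "cmat W *\<^sub>v \<tau> \<in> carrier_vec m" using Wc by (rule square_mult_vec_carrier)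
      \<comment> \<open>\<open>L (y - ystar)\<close> differs from \<open>Gdd d\<^sub>0\<close> by \<open>W \<tau>\<close>, as the two components of \<open>W \<tau>\<close> supply \<open>- L ystar\<close> and the nilpotent part.\<close>
      have "y - ystar = y + E *\<^sub>v (cmat W *\<^sub>v \<tau>)" unfolding ystar_\<tau> using y by (intro eq_vecI) simp_all
      then have "L *\<^sub>v (y - ystar) = L *\<^sub>v y + L *\<^sub>v (E *\<^sub>v (cmat W *\<^sub>v \<tau>))"
        using y by (simp add: mult_add_distrib_mat_vec[OF LK(1)])
      also have "\<dots> = (L *\<^sub>v y - K *\<^sub>v r.sum_V0 0) + (L *\<^sub>v (E *\<^sub>v (cmat W *\<^sub>v \<tau>)) + K *\<^sub>v (F *\<^sub>v (cmat W *\<^sub>v \<tau>)))"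
        unfolding F_\<tau> by (intro eq_vecI) simp_all
      also have "\<dots> = cmat Gdd *\<^sub>v ?e + cmat W *\<^sub>v \<tau>"
        unfolding r.decompose[OF Wt] r.Gdd_backward r.free_part_rec(1)[OF y] ..
      finally have "cmat (mat_inv W) *\<^sub>v (L *\<^sub>v (y - ystar)) = cmat s.S *\<^sub>v (cmat Gdd *\<^sub>v ?e) + \<tau>"
        unfolding mat_inv_W using Wt by (simp only: mult_add_distrib_mat_vec[of "cmat s.S" m m] map_carrier_mat s.S
            square_mult_vec_carrier[OF Gdd_c] s.lift_W(1)[OF W_inv \<tau>_c])
      then have "?pi \<bullet> (cmat (mat_inv W) *\<^sub>v (L *\<^sub>v (y - ystar))) = ?pi \<bullet> (cmat s.S *\<^sub>v (cmat Gdd *\<^sub>v ?e)) + ?pi \<bullet> \<tau>"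
        using scalar_prod_add_distrib[OF pi S_e \<tau>_c] by simp
      moreover have "?pi \<bullet> \<rho> = ?pi \<bullet> g 0 + ?pi \<bullet> \<tau>"
        unfolding \<rho> by (rule scalar_prod_add_distrib[OF pi g(1) \<tau>_c])
      ultimately show ?thesis by auto
    qed
    finally show "(\<exists>x\<in>carrier_vec m. linsys x y) \<longleftrightarrow>
      ?pi \<bullet> (cmat (mat_inv W) *\<^sub>v (L *\<^sub>v (y - ystar))) =
        ?pi \<bullet> vec_suminf m (\<lambda>k. cmat R ^\<^sub>m k *\<^sub>v g k)"
      unfolding \<rho>_def a_def[abs_def] .
  qed
qed

end
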